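(* Let $\mathfrak g$ be simple with Coxeter number $h$, short dominant root $\theta_s$ and $l=\#(\Pi\cap\Delta_s)$. Then $\frac{\mathfrak m_{\theta_s}^0(q)}{q^{h-\mathrm{ht}(\theta_s)}}$ is a polynomial in $q$, and $$\sum_{\mu}\mathfrak m_{\theta_s}^\mu(q)=\mathfrak m_{\theta_s}^0(q)\bigl(\mathfrak m_{\theta_s}^0(q)-l+1\bigr)+\frac{\mathfrak m_{\theta_s}^0(q)}{q^{h-\mathrm{ht}(\theta_s)}}\cdot\frac{1-q^h}{1-q},$$ where the sum is over the distinct weights $\mu\in\Delta_s\cup\{0\}$ of $V_{\theta_s}$; equivalently, $$\sum_{\mu} m_{\theta_s}^\mu\,\mathfrak m_{\theta_s}^\mu(q)=\mathfrak m_{\theta_s}^0(q)^2+\frac{\mathfrak m_{\theta_s}^0(q)}{q^{h-\mathrm{ht}(\theta_s)}}\cdot\frac{1-q^h}{1-q}.$$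
   Context: Let $\mathfrak g$ be a semisimple Lie algebra over an algebraically closed field of characteristic zero, with Cartan subalgebra $\mathfrak t$, root system $\Delta$, positive roots $\Delta^+$, simple roots $\Pi=\{\alpha_1,\dots,\alpha_r\}$, $\rho=\frac12\sum_{\gamma\in\Delta^+}\gamma$, integral weight lattice $\mathfrak X$, dominant weights $\mathfrak X_+$, root lattice $Q$, and $Q_+$ the monoid generated by $\Pi$. The Weyl group is $W$, with length function $\ell$ and sign $\varepsilon(w)=(-1)^{\ell(w)}$. For $\gamma=\sum_i c_i\alpha_i\in Q$, $\mathrm{ht}(\gamma)=\sum_i c_i$. Define polynomials $\mathcal P_q(\mu)\in\mathbb Z[q]$ by $\prod_{\alpha\in\Delta^+}(1-qe^{\alpha})^{-1}=\sum_{\mu\in Q_+}\mathcal P_q(\mu)e^\mu$, and $\mathcal P_q(\mu)=0$ for $\mu\notin Q_+$. For $\lambda\in\mathfrak X_+$ and any $\mu\in\mathfrak X$, Lusztig's $q$-analogue of weight multiplicity is $\mathfrak m_\lambda^\mu(q)=\sum_{w\in W}\varepsilon(w)\mathcal P_q(w(\lambda+\rho)-(\mu+\rho))$; $m_\lambda^\mu$ is the dimension of the $\mu$-weight space of the simple module $V_\lambda$. $\Delta_s$ is the set of short roots (all roots if $\mathfrak g$ is simply-laced), $\theta_s$ the unique dominant short root. The weights of $V_{\theta_s}$ are $\Delta_s\cup\{0\}$, with $m_{\theta_s}^\mu=1$ for $\mu\in\Delta_s$ and $m_{\theta_s}^0=l$. *)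

theory Defs
  imports "HOL-Analysis.Analysis" "HOL-Library.Multiset" "HOL-Computational_Algebra.Polynomial"
begin

text \<open>Abstract (reduced, crystallographic) root system in a real Euclidean space,
  playing the role of the root system Delta of a semisimple Lie algebra g
  relative to its Cartan subalgebra t.\<close>

definition refl :: "'a::euclidean_space \<Rightarrow> 'a \<Rightarrow> 'a" where
  "refl \<alpha> v = v - ((2 * (v \<bullet> \<alpha>)) / (\<alpha> \<bullet> \<alpha>)) *\<^sub>R \<alpha>"

definition root_system :: "'a::euclidean_space set \<Rightarrow> bool" where
  "root_system R \<longleftrightarrow>
     finite R \<and> 0 \<notin> R \<and> span R = UNIV \<and>
     (\<forall>\<alpha>\<in>R. refl \<alpha> ` R = R) \<and>
     (\<forall>\<alpha>\<in>R. \<forall>\<beta>\<in>R. (2 * (\<beta> \<bullet> \<alpha>)) / (\<alpha> \<bullet> \<alpha>) \<in> \<int>) \<and>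
     (\<forall>\<alpha>\<in>R. \<forall>c::real. c *\<^sub>R \<alpha> \<in> R \<longrightarrow> c = 1 \<or> c = -1)"

text \<open>Simple Lie algebra = irreducible root system.\<close>
definition irreducible_rs :: "'a::euclidean_space set \<Rightarrow> bool" where
  "irreducible_rs R \<longleftrightarrow>
     \<not> (\<exists>A B. A \<union> B = R \<and> A \<inter> B = {} \<and> A \<noteq> {} \<and> B \<noteq> {} \<and>
            (\<forall>a\<in>A. \<forall>b\<in>B. a \<bullet> b = 0))"

definition nat_comb :: "'a::euclidean_space set \<Rightarrow> 'a \<Rightarrow> bool" where
  "nat_comb S v \<longleftrightarrow> (\<exists>c::'a \<Rightarrow> nat. v = (\<Sum>\<alpha>\<in>S. real (c \<alpha>) *\<^sub>R \<alpha>))"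

definition is_base :: "'a::euclidean_space set \<Rightarrow> 'a set \<Rightarrow> bool" where
  "is_base R P \<longleftrightarrow> P \<subseteq> R \<and> independent P \<and>
     (\<forall>\<beta>\<in>R. nat_comb P \<beta> \<or> nat_comb P (- \<beta>))"

definition pos_roots :: "'a::euclidean_space set \<Rightarrow> 'a set \<Rightarrow> 'a set" where
  "pos_roots R P = {\<beta>\<in>R. nat_comb P \<beta>}"

definition ht :: "'a::euclidean_space set \<Rightarrow> 'a \<Rightarrow> int" where
  "ht P \<gamma> = (THE k. \<exists>c::'a \<Rightarrow> int. \<gamma> = (\<Sum>\<alpha>\<in>P. real_of_int (c \<alpha>) *\<^sub>R \<alpha>) \<and> k = (\<Sum>\<alpha>\<in>P. c \<alpha>))"

definition rho :: "'a::euclidean_space set \<Rightarrow> 'a set \<Rightarrow> 'a" where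
  "rho R P = (1/2) *\<^sub>R (\<Sum>\<gamma>\<in>pos_roots R P. \<gamma>)"

inductive_set weyl_group :: "'a::euclidean_space set \<Rightarrow> ('a \<Rightarrow> 'a) set" for R where
  id_in: "id \<in> weyl_group R"
| refl_in: "\<alpha> \<in> R \<Longrightarrow> w \<in> weyl_group R \<Longrightarrow> refl \<alpha> \<circ> w \<in> weyl_group R"

definition weyl_length :: "'a::euclidean_space set \<Rightarrow> ('a \<Rightarrow> 'a) \<Rightarrow> nat" where
  "weyl_length P w = (LEAST n. \<exists>xs. set xs \<subseteq> P \<and> length xs = n \<and>
                          w = foldr (\<lambda>\<alpha> f. refl \<alpha> \<circ> f) xs id)"

definition weyl_sign :: "'a::euclidean_space set \<Rightarrow> ('a \<Rightarrow> 'a) \<Rightarrow> int" where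
  "weyl_sign P w = (-1) ^ weyl_length P w"

text \<open>Lusztig-Kostant q-partition function: coefficient of e^mu in
  prod_{alpha>0} (1 - q e^alpha)^(-1), i.e. the sum of q^(number of parts) over all ways
  of writing mu as a sum of positive roots (multisets). It is 0 when mu is not in Q_+.\<close>
definition kostant_q :: "'a::euclidean_space set \<Rightarrow> 'a set \<Rightarrow> 'a \<Rightarrow> int poly" where
  "kostant_q R P \<mu> =
     (\<Sum>M\<in>{M. set_mset M \<subseteq> pos_roots R P \<and> sum_mset M = \<mu>}. monom 1 (size M))"

definition lusztig_q :: "'a::euclidean_space set \<Rightarrow> 'a set \<Rightarrow> 'a \<Rightarrow> 'a \<Rightarrow> int poly" where
  "lusztig_q R P lam \<mu> =
     (\<Sum>w\<in>weyl_group R. of_int (weyl_sign P w) *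
        kostant_q R P (w (lam + rho R P) - (\<mu> + rho R P)))"

text \<open>Short roots (all roots in the simply-laced case).\<close>
definition short_roots :: "'a::euclidean_space set \<Rightarrow> 'a set" where
  "short_roots R = {\<alpha>\<in>R. \<forall>\<beta>\<in>R. norm \<alpha> \<le> norm \<beta>}"

definition dominant :: "'a::euclidean_space set \<Rightarrow> 'a \<Rightarrow> bool" where
  "dominant P lam \<longleftrightarrow> (\<forall>\<alpha>\<in>P. lam \<bullet> \<alpha> \<ge> 0)"

definition coxeter_number :: "'a::euclidean_space set \<Rightarrow> nat" where
  "coxeter_number R = card R div DIM('a)"

end

theory Submission
  imports Defs
begin

text \<open>
  Write s for the reflection in a simple root \<alpha>. Splitting \<alpha> off the partition function leaves an
  s-invariant function, whence m(\<mu>) - q m(\<mu> + \<alpha>) changes sign under \<mu> \<mapsto> s \<mu> - \<alpha>. This determines all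
  m(\<mu>) for short \<mu> from heights and m(0), while the character of the short dominant module gives
  m(0) = l + (q - 1) A with A the sum of q^(ht \<gamma> - 1) over the positive short roots \<gamma>. The theorem
  then reads B = p (1 + q + ... + q^(h - 1)), where B is the sum of q^n(\<beta>) over all short roots \<beta> and
  n(\<beta>) is the number of positive roots pairing negatively with \<beta>; the relation between p and m(0)
  drops out by comparing degrees, because ht \<theta> < h.

  For the divisibility of B, Macdonald's argument applied to the dual root system expresses B as
  the product of (1 - q^(a + 1)) / (1 - q^a), where a runs over the heights of the coroots of
  positive roots pairing positively with \<theta>. The coroot of \<theta> has height h - 1, and reflecting in
  \<theta> pairs the other factors so that their heights add up to h - 1. Hence B vanishes at every
  nontrivial h-th root of unity.
\<close>

section \<open>Reflections, bases and heights\<close>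

text \<open>Coroots enter through the specialization of Macdonald's identity at a multiple of rho,
  where the exponential of a coroot becomes a power z^a with a its height. Simple coroots have
  height 1, so the choice z = t kills the summand of every short root except \<theta>. The Coxeter
  number is only given as the number of roots over the rank. It becomes a coroot height through the
  sum of the orthogonal projections onto the root lines: a scalar operator by irreducibility,
  evaluated once by its trace and once at \<theta>. The bound ht \<theta> < h compares the height of
  a root with that of its coroot and uses that \<theta> is short. Vanishing at complex roots of
  unity gives divisibility over the integers because reducing exponents modulo h is already division
  by 1 - q^h with an integral remainder. For the last step write (1 - q) B = (1 - q^h) p. The degree
  of the left side forces p to have degree below ht \<theta>, and in degrees from ht \<theta> on the
  polynomial q^(ht \<theta>) m(0) agrees with -(1 - q) B, hence with q^h p.\<close>

lemma inner_refl_left: "refl \<alpha> x \<bullet> y = x \<bullet> refl \<alpha> y"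
  by (simp add: refl_def inner_diff_left inner_diff_right inner_commute)

lemma refl_self: "\<alpha> \<noteq> 0 \<Longrightarrow> refl \<alpha> \<alpha> = - \<alpha>"
  by (simp add: refl_def algebra_simps scaleR_2)

lemma linear_refl: "linear (refl \<alpha>)"
  by (rule linearI) (simp_all add: refl_def inner_add_left algebra_simps add_divide_distrib)

lemma refl_add: "refl \<alpha> (x + y) = refl \<alpha> x + refl \<alpha> y"
  by (rule linear_add[OF linear_refl])

lemma refl_diff: "refl \<alpha> (x - y) = refl \<alpha> x - refl \<alpha> y"
  by (rule linear_diff[OF linear_refl])

lemma refl_minus: "refl \<alpha> (- x) = - refl \<alpha> x"
  by (rule linear_neg[OF linear_refl])

lemma refl_sum: "refl \<alpha> (sum f A) = (\<Sum>i\<in>A. refl \<alpha> (f i))"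
  by (rule linear_sum[OF linear_refl])

lemma refl_scaleR: "refl \<alpha> (c *\<^sub>R x) = c *\<^sub>R refl \<alpha> x"
  by (rule linear_scale[OF linear_refl])

lemma refl_refl [simp]: "refl \<alpha> (refl \<alpha> x) = x"
proof (cases "\<alpha> = 0")
  case False
  then have "refl \<alpha> x \<bullet> \<alpha> = - (x \<bullet> \<alpha>)"
    by (simp add: inner_refl_left refl_self)
  then show ?thesis
    by (simp add: refl_def[of \<alpha> "refl \<alpha> x"]) (simp add: refl_def)
qed (simp add: refl_def)

lemma refl_comp_refl [simp]: "refl \<alpha> \<circ> refl \<alpha> = id"
  by auto

lemma inner_refl_refl [simp]: "refl \<alpha> x \<bullet> refl \<alpha> y = x \<bullet> y"
  by (simp add: inner_refl_left)

lemma refl_eq_iff [simp]: "refl \<alpha> x = refl \<alpha> y \<longleftrightarrow> x = y"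
  by (metis refl_refl)

lemma inj_refl: "inj_on (refl \<alpha>) A"
  by (rule inj_onI) simp

lemma refl_neg_root: "refl (- \<alpha>) = refl \<alpha>"
  by (rule ext) (simp add: refl_def)

definition coroot :: "'a::euclidean_space \<Rightarrow> 'a" where
  "coroot \<alpha> = (2 / (\<alpha> \<bullet> \<alpha>)) *\<^sub>R \<alpha>"

lemma coroot_inner: "coroot \<alpha> \<bullet> x = 2 * (x \<bullet> \<alpha>) / (\<alpha> \<bullet> \<alpha>)"
  by (simp add: coroot_def inner_commute)

lemma refl_coroot_eq: "refl \<alpha> v = v - (coroot \<alpha> \<bullet> v) *\<^sub>R \<alpha>"
  by (simp add: refl_def coroot_inner)

lemma refl_coroot_eq': "refl \<alpha> v = v - (v \<bullet> \<alpha>) *\<^sub>R coroot \<alpha>"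
  by (simp add: refl_def coroot_def)

lemma coroot_refl: "coroot (refl \<alpha> \<beta>) = refl \<alpha> (coroot \<beta>)"
  by (simp add: coroot_def refl_scaleR)

lemma coroot_minus: "coroot (- \<alpha>) = - coroot \<alpha>"
  by (simp add: coroot_def)

lemma coroot_self: "\<alpha> \<noteq> 0 \<Longrightarrow> coroot \<alpha> \<bullet> \<alpha> = 2"
  by (simp add: coroot_inner)

lemma coroot_pos_iff: "\<alpha> \<noteq> 0 \<Longrightarrow> coroot \<alpha> \<bullet> x > 0 \<longleftrightarrow> x \<bullet> \<alpha> > 0"
  by (simp add: coroot_inner zero_less_divide_iff inner_ge_zero[THEN leD])

lemma coroot_neg_iff: "\<alpha> \<noteq> 0 \<Longrightarrow> coroot \<alpha> \<bullet> x < 0 \<longleftrightarrow> x \<bullet> \<alpha> < 0"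
  using coroot_pos_iff[of \<alpha> "- x"] by simp

lemma nat_comb_0: "nat_comb S 0"
  unfolding nat_comb_def by (intro exI[of _ "\<lambda>_. 0"]) simp

lemma nat_comb_add: "nat_comb S x \<Longrightarrow> nat_comb S y \<Longrightarrow> nat_comb S (x + y)"
  unfolding nat_comb_def
proof (elim exE)
  fix c d :: "'a \<Rightarrow> nat"
  assume "x = (\<Sum>\<alpha>\<in>S. real (c \<alpha>) *\<^sub>R \<alpha>)" "y = (\<Sum>\<alpha>\<in>S. real (d \<alpha>) *\<^sub>R \<alpha>)"
  then show "\<exists>e::'a \<Rightarrow> nat. x + y = (\<Sum>\<alpha>\<in>S. real (e \<alpha>) *\<^sub>R \<alpha>)"
    by (intro exI[of _ "\<lambda>\<alpha>. c \<alpha> + d \<alpha>"]) (simp add: scaleR_add_left sum.distrib)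
qed

lemma nat_comb_inner_nonneg:
  assumes "nat_comb S v" and "\<And>\<alpha>. \<alpha> \<in> S \<Longrightarrow> x \<bullet> \<alpha> \<ge> 0"
  shows "x \<bullet> v \<ge> 0"
  using assms unfolding nat_comb_def by (auto simp: inner_sum_right intro!: sum_nonneg)

locale based_root_system =
  fixes R P :: "'a::euclidean_space set"
  assumes rs: "root_system R" and base: "is_base R P"
begin

abbreviation Pos :: "'a set" where "Pos \<equiv> pos_roots R P"

lemma finite_R: "finite R" and zero_notin_R: "0 \<notin> R" and span_R: "span R = UNIV"
  using rs by (auto simp: root_system_def)

lemma refl_in_R: "\<alpha> \<in> R \<Longrightarrow> \<beta> \<in> R \<Longrightarrow> refl \<alpha> \<beta> \<in> R"
  using rs by (auto simp: root_system_def)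

lemma coroot_inner_Ints: "\<alpha> \<in> R \<Longrightarrow> \<beta> \<in> R \<Longrightarrow> coroot \<alpha> \<bullet> \<beta> \<in> \<int>"
  using rs by (auto simp: root_system_def coroot_inner)

lemma scaled_root: "\<alpha> \<in> R \<Longrightarrow> c *\<^sub>R \<alpha> \<in> R \<Longrightarrow> c = 1 \<or> c = -1"
  using rs by (auto simp: root_system_def)

lemma root_nz: "\<alpha> \<in> R \<Longrightarrow> \<alpha> \<noteq> 0"
  using zero_notin_R by auto

lemma minus_in_R: "\<alpha> \<in> R \<Longrightarrow> - \<alpha> \<in> R"
  using refl_in_R[of \<alpha> \<alpha>] by (simp add: refl_self root_nz)

lemma minus_in_R_iff [simp]: "- \<alpha> \<in> R \<longleftrightarrow> \<alpha> \<in> R"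
  using minus_in_R by fastforce

lemma P_R: "\<alpha> \<in> P \<Longrightarrow> \<alpha> \<in> R" and indep_P: "independent P"
  and base_cases: "\<beta> \<in> R \<Longrightarrow> nat_comb P \<beta> \<or> nat_comb P (- \<beta>)"
  using base by (auto simp: is_base_def)

lemma finite_P: "finite P"
  using finite_R P_R by (meson finite_subset subsetI)

lemma nat_comb_in_span: "nat_comb P v \<Longrightarrow> v \<in> span P"
  unfolding nat_comb_def by (auto intro: span_sum span_scale span_base)

lemma span_P: "span P = UNIV"
proof -
  have "R \<subseteq> span P"
    using base_cases nat_comb_in_span span_neg by fastforce
  then show ?thesis
    using span_R span_minimal[OF _ subspace_span] by blast
qed

lemma in_span_P [simp]: "v \<in> span P"
  by (simp add: span_P)

section \<open>Coordinates, positive roots and heights\<close>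

abbreviation coord :: "'a \<Rightarrow> 'a \<Rightarrow> real" where "coord v \<equiv> representation P v"

lemma coord_diff: "coord (x - y) \<alpha> = coord x \<alpha> - coord y \<alpha>"
  by (simp add: representation_diff indep_P)

lemma coord_minus: "coord (- x) \<alpha> = - coord x \<alpha>"
  by (simp add: representation_neg indep_P)

lemma coord_scale: "coord (c *\<^sub>R x) \<alpha> = c * coord x \<alpha>"
  by (simp add: representation_scale indep_P)

lemma coord_simple: "\<alpha> \<in> P \<Longrightarrow> coord \<alpha> \<beta> = (if \<beta> = \<alpha> then 1 else 0)"
  by (simp add: representation_basis indep_P)

lemma coord_expand: "(\<Sum>\<alpha>\<in>P. coord v \<alpha> *\<^sub>R \<alpha>) = v"
  by (rule sum_representation_eq) (auto simp: indep_P finite_P)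

lemma coord_sum_simple:
  assumes "\<alpha> \<in> P" shows "coord (\<Sum>\<alpha>\<in>P. c \<alpha> *\<^sub>R \<alpha>) \<alpha> = c \<alpha>"
proof -
  have "coord (\<Sum>\<alpha>\<in>P. c \<alpha> *\<^sub>R \<alpha>) \<alpha> = (\<Sum>\<beta>\<in>P. coord (c \<beta> *\<^sub>R \<beta>) \<alpha>)"
    by (subst representation_sum) (auto simp: indep_P)
  also have "\<dots> = (\<Sum>\<beta>\<in>P. if \<alpha> = \<beta> then c \<beta> else 0)"
    by (intro sum.cong) (auto simp: coord_scale coord_simple)
  also have "\<dots> = c \<alpha>"
    using assms finite_P by simp
  finally show ?thesis .
qed

lemma nat_comb_coord:
  assumes "nat_comb P v"
  shows "coord v \<alpha> \<ge> 0"
proof (cases "\<alpha> \<in> P")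
  case True
  then show ?thesis
    using assms unfolding nat_comb_def by (auto simp: coord_sum_simple)
next
  case False
  then show ?thesis
    by (metis order_refl representation_ne_zero)
qed

lemma PosI: "\<beta> \<in> R \<Longrightarrow> nat_comb P \<beta> \<Longrightarrow> \<beta> \<in> Pos"
  and Pos_R: "\<beta> \<in> Pos \<Longrightarrow> \<beta> \<in> R" and Pos_nat_comb: "\<beta> \<in> Pos \<Longrightarrow> nat_comb P \<beta>"
  by (auto simp: pos_roots_def)

lemma Pos_nz: "\<beta> \<in> Pos \<Longrightarrow> \<beta> \<noteq> 0"
  using Pos_R root_nz by blast

lemma finite_Pos: "finite Pos"
  using finite_R by (simp add: pos_roots_def)

lemma nat_comb_simple: "\<alpha> \<in> P \<Longrightarrow> nat_comb P \<alpha>"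
  unfolding nat_comb_def
  by (rule exI[of _ "\<lambda>\<beta>. if \<beta> = \<alpha> then 1 else 0"])
     (simp add: finite_P if_distrib[of real] if_distrib[of "\<lambda>c. c *\<^sub>R _"] cong: if_cong)

lemma P_Pos: "\<alpha> \<in> P \<Longrightarrow> \<alpha> \<in> Pos"
  by (simp add: PosI P_R nat_comb_simple)

lemma nat_comb_antisym:
  assumes "nat_comb P v" "nat_comb P (- v)" shows "v = 0"
proof -
  have "coord v \<alpha> = 0" for \<alpha>
    using nat_comb_coord[OF assms(1), of \<alpha>] nat_comb_coord[OF assms(2), of \<alpha>]
    by (simp add: coord_minus)
  then show ?thesis
    using coord_expand[of v] by simp
qed

lemma neg_Pos_iff: "\<beta> \<in> R \<Longrightarrow> - \<beta> \<in> Pos \<longleftrightarrow> \<beta> \<notin> Pos"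
  using base_cases[of \<beta>] nat_comb_antisym[of \<beta>] root_nz by (auto simp: pos_roots_def)

lemma not_both_Pos: "\<beta> \<in> Pos \<Longrightarrow> - \<beta> \<notin> Pos"
  using neg_Pos_iff Pos_R by blast

lemma R_split: "R = Pos \<union> uminus ` Pos" "Pos \<inter> uminus ` Pos = {}"
proof -
  have "\<beta> \<in> uminus ` Pos" if "\<beta> \<in> R" "\<beta> \<notin> Pos" for \<beta>
    using that neg_Pos_iff[of \<beta>] by (metis imageI minus_minus)
  then show "R = Pos \<union> uminus ` Pos"
    using Pos_R by auto
  show "Pos \<inter> uminus ` Pos = {}"
    using not_both_Pos by auto
qed

text \<open>A simple reflection changes only the \<alpha>-coordinate. If \<beta> became negative,
  all its other coordinates would vanish, and reducedness would leave only \<alpha>.\<close>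

lemma refl_simple_Pos:
  assumes a: "\<alpha> \<in> P" and b: "\<beta> \<in> Pos" "\<beta> \<noteq> \<alpha>"
  shows "refl \<alpha> \<beta> \<in> Pos"
proof (rule ccontr)
  assume neg: "refl \<alpha> \<beta> \<notin> Pos"
  have rb: "refl \<alpha> \<beta> \<in> R"
    by (simp add: refl_in_R P_R Pos_R a b)
  then have n: "nat_comb P (- refl \<alpha> \<beta>)"
    using neg neg_Pos_iff Pos_nat_comb by blast
  have "coord \<beta> \<gamma> = 0" if "\<gamma> \<noteq> \<alpha>" for \<gamma>
  proof -
    have "coord (refl \<alpha> \<beta>) \<gamma> = coord \<beta> \<gamma>"
      using that by (simp add: refl_def coord_diff coord_scale coord_simple a)
    then show ?thesis
      using nat_comb_coord[OF n, of \<gamma>] nat_comb_coord[OF Pos_nat_comb[OF b(1)], of \<gamma>]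
      by (simp add: coord_minus)
  qed
  then have "\<beta> = coord \<beta> \<alpha> *\<^sub>R \<alpha>"
    using coord_expand[of \<beta>] finite_P a
    by (simp add: sum.remove[of P \<alpha>])
  then have "coord \<beta> \<alpha> = 1 \<or> coord \<beta> \<alpha> = -1"
    using scaled_root[OF P_R[OF a]] Pos_R[OF b(1)] by metis
  then show False
    using \<open>\<beta> = coord \<beta> \<alpha> *\<^sub>R \<alpha>\<close> b(2) nat_comb_coord[OF Pos_nat_comb[OF b(1)], of \<alpha>] by auto
qed

lemma refl_simple_bij: "\<alpha> \<in> P \<Longrightarrow> bij_betw (refl \<alpha>) (Pos - {\<alpha>}) (Pos - {\<alpha>})"
proof (rule bij_betw_byWitness[where f' = "refl \<alpha>"])
  assume a: "\<alpha> \<in> P"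
  show "refl \<alpha> ` (Pos - {\<alpha>}) \<subseteq> Pos - {\<alpha>}"
  proof (rule image_subsetI, simp, elim conjE, rule conjI)
    fix \<beta> assume b: "\<beta> \<in> Pos" "\<beta> \<noteq> \<alpha>"
    then show "refl \<alpha> \<beta> \<in> Pos" by (rule refl_simple_Pos[OF a])
    show "refl \<alpha> \<beta> \<noteq> \<alpha>"
    proof
      assume "refl \<alpha> \<beta> = \<alpha>"
      then have "\<beta> = - \<alpha>" by (metis refl_refl refl_self root_nz P_R a)
      then show False using b not_both_Pos P_Pos a by auto
    qed
  qed
  then show "refl \<alpha> ` (Pos - {\<alpha>}) \<subseteq> Pos - {\<alpha>}" .
qed auto

lemma refl_simple_minus: "\<alpha> \<in> P \<Longrightarrow> refl \<alpha> \<alpha> = - \<alpha>"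
  by (simp add: refl_self root_nz P_R)

text \<open>The rho of the dual root system. Pairing with it is the height function, because every
  simple root pairs to 1 with it (\<open>rhoc_simple\<close>).\<close>

definition rhoc :: 'a where "rhoc = (1/2) *\<^sub>R (\<Sum>\<gamma>\<in>Pos. coroot \<gamma>)"

text \<open>Only the summand of \<alpha> changes sign, the others being permuted by
  \<open>refl_simple_bij\<close>. A generic f covers roots and coroots at once.\<close>

lemma refl_half_sum:
  assumes a: "\<alpha> \<in> P" and f: "\<And>\<beta>. refl \<alpha> (f \<beta>) = f (refl \<alpha> \<beta>)" and m: "f (- \<alpha>) = - f \<alpha>"
  shows "refl \<alpha> ((1/2) *\<^sub>R (\<Sum>\<gamma>\<in>Pos. f \<gamma>)) = (1/2) *\<^sub>R (\<Sum>\<gamma>\<in>Pos. f \<gamma>) - f \<alpha>"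
proof -
  have split: "(\<Sum>\<gamma>\<in>Pos. f \<gamma>) = f \<alpha> + (\<Sum>\<gamma>\<in>Pos - {\<alpha>}. f \<gamma>)"
    by (simp add: sum.remove finite_Pos P_Pos a)
  have "(\<Sum>\<gamma>\<in>Pos - {\<alpha>}. f (refl \<alpha> \<gamma>)) = (\<Sum>\<gamma>\<in>Pos - {\<alpha>}. f \<gamma>)"
    by (rule sum.reindex_bij_betw[OF refl_simple_bij[OF a]])
  then have "refl \<alpha> (\<Sum>\<gamma>\<in>Pos. f \<gamma>) = - f \<alpha> + (\<Sum>\<gamma>\<in>Pos - {\<alpha>}. f \<gamma>)"
    by (subst split) (simp add: refl_add refl_sum f refl_simple_minus a m)
  then have "refl \<alpha> (\<Sum>\<gamma>\<in>Pos. f \<gamma>) = (\<Sum>\<gamma>\<in>Pos. f \<gamma>) - 2 *\<^sub>R f \<alpha>"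
    by (simp add: split scaleR_2)
  then show ?thesis
    by (simp add: refl_scaleR scaleR_diff_right)
qed

lemma refl_rho: "\<alpha> \<in> P \<Longrightarrow> refl \<alpha> (rho R P) = rho R P - \<alpha>"
  using refl_half_sum[of \<alpha> "\<lambda>\<beta>. \<beta>"] by (simp add: rho_def)

lemma refl_rhoc: "\<alpha> \<in> P \<Longrightarrow> refl \<alpha> rhoc = rhoc - coroot \<alpha>"
  using refl_half_sum[of \<alpha> coroot] by (simp add: rhoc_def coroot_refl coroot_minus)

lemma rho_simple: "\<alpha> \<in> P \<Longrightarrow> coroot \<alpha> \<bullet> rho R P = 1"
  using refl_rho[of \<alpha>] root_nz[OF P_R, of \<alpha>]
  by (simp add: refl_coroot_eq) (metis scaleR_cancel_right scaleR_one)

lemma rho_simple_pos: "\<alpha> \<in> P \<Longrightarrow> rho R P \<bullet> \<alpha> > 0"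
  using rho_simple[of \<alpha>] coroot_pos_iff[of \<alpha> "rho R P"] root_nz[OF P_R] by simp

lemma rhoc_simple: "\<alpha> \<in> P \<Longrightarrow> rhoc \<bullet> \<alpha> = 1"
proof -
  assume a: "\<alpha> \<in> P"
  have "(rhoc \<bullet> \<alpha>) *\<^sub>R coroot \<alpha> = coroot \<alpha>"
    using refl_rhoc[OF a] by (simp add: refl_coroot_eq')
  moreover have "coroot \<alpha> \<noteq> 0"
    using root_nz[OF P_R[OF a]] by (simp add: coroot_def)
  ultimately show ?thesis
    by (metis (no_types) scaleR_cancel_right scaleR_one)
qed

lemma rhoc_nat_comb: "nat_comb P v \<Longrightarrow> \<exists>n::nat. rhoc \<bullet> v = real n"
  unfolding nat_comb_def
proof (elim exE)
  fix c :: "'a \<Rightarrow> nat" assume "v = (\<Sum>\<alpha>\<in>P. real (c \<alpha>) *\<^sub>R \<alpha>)"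
  then have "rhoc \<bullet> v = real (\<Sum>\<alpha>\<in>P. c \<alpha>)"
    by (simp add: inner_sum_right rhoc_simple)
  then show ?thesis by blast
qed

lemma pos_inner_Pos:
  assumes x: "\<And>\<alpha>. \<alpha> \<in> P \<Longrightarrow> x \<bullet> \<alpha> > 0" and v: "nat_comb P v" "v \<noteq> 0"
  shows "x \<bullet> v > 0"
proof -
  obtain c :: "'a \<Rightarrow> nat" where c: "v = (\<Sum>\<alpha>\<in>P. real (c \<alpha>) *\<^sub>R \<alpha>)"
    using v by (auto simp: nat_comb_def)
  have "x \<bullet> v = (\<Sum>\<alpha>\<in>P. real (c \<alpha>) * (x \<bullet> \<alpha>))"
    by (simp add: c inner_sum_right)
  moreover obtain \<alpha> where "\<alpha> \<in> P" "c \<alpha> \<noteq> 0"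
  proof (rule ccontr)
    assume "\<not> thesis"
    then have "\<forall>\<alpha>\<in>P. c \<alpha> = 0"
      using that by blast
    then show False
      using c v(2) by simp
  qed
  ultimately show ?thesis
    using finite_P x by (auto intro!: sum_pos2[of P \<alpha>] simp: less_imp_le)
qed

lemma rhoc_Pos: "\<beta> \<in> Pos \<Longrightarrow> rhoc \<bullet> \<beta> > 0"
  using pos_inner_Pos[of rhoc \<beta>] rhoc_simple Pos_nat_comb Pos_nz by auto

text \<open>A natural number, for use as an exponent. It is the true height on nonnegative integral
  combinations of P, where floor and \<open>nat\<close> lose nothing
  (\<open>real_hgt\<close>).\<close>

definition hgt :: "'a \<Rightarrow> nat" where "hgt \<gamma> = nat \<lfloor>rhoc \<bullet> \<gamma>\<rfloor>"

lemma real_hgt: "nat_comb P \<gamma> \<Longrightarrow> real (hgt \<gamma>) = rhoc \<bullet> \<gamma>"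
  using rhoc_nat_comb[of \<gamma>] by (auto simp: hgt_def)

lemma hgt_Pos: "\<beta> \<in> Pos \<Longrightarrow> hgt \<beta> \<ge> 1"
  using real_hgt[of \<beta>] rhoc_Pos[of \<beta>] Pos_nat_comb[of \<beta>] by (cases "hgt \<beta>") auto

lemma hgt_simple: "\<alpha> \<in> P \<Longrightarrow> hgt \<alpha> = 1"
  by (simp add: hgt_def rhoc_simple)

lemma ht_eq_hgt:
  assumes "nat_comb P \<gamma>" shows "ht P \<gamma> = int (hgt \<gamma>)"
  unfolding ht_def
proof (rule the_equality)
  obtain c :: "'a \<Rightarrow> nat" where c: "\<gamma> = (\<Sum>\<alpha>\<in>P. real (c \<alpha>) *\<^sub>R \<alpha>)"
    using assms by (auto simp: nat_comb_def)
  have "real (hgt \<gamma>) = real (\<Sum>\<alpha>\<in>P. c \<alpha>)"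
    by (subst real_hgt[OF assms]) (simp add: c inner_sum_right rhoc_simple)
  then have "hgt \<gamma> = (\<Sum>\<alpha>\<in>P. c \<alpha>)"
    by linarith
  then show "\<exists>c::'a \<Rightarrow> int. \<gamma> = (\<Sum>\<alpha>\<in>P. real_of_int (c \<alpha>) *\<^sub>R \<alpha>) \<and> int (hgt \<gamma>) = (\<Sum>\<alpha>\<in>P. c \<alpha>)"
    by (intro exI[of _ "\<lambda>\<alpha>. int (c \<alpha>)"]) (simp add: c)
next
  fix k :: int
  assume "\<exists>c::'a \<Rightarrow> int. \<gamma> = (\<Sum>\<alpha>\<in>P. real_of_int (c \<alpha>) *\<^sub>R \<alpha>) \<and> k = (\<Sum>\<alpha>\<in>P. c \<alpha>)"
  then obtain c :: "'a \<Rightarrow> int" where "\<gamma> = (\<Sum>\<alpha>\<in>P. real_of_int (c \<alpha>) *\<^sub>R \<alpha>)" "k = (\<Sum>\<alpha>\<in>P. c \<alpha>)"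
    by blast
  then have "rhoc \<bullet> \<gamma> = real_of_int k"
    by (simp add: inner_sum_right rhoc_simple)
  then show "k = int (hgt \<gamma>)"
    using real_hgt[OF assms] by linarith
qed

lemma ex_simple_inner_pos:
  assumes "nat_comb P v" "v \<noteq> 0" shows "\<exists>\<alpha>\<in>P. v \<bullet> \<alpha> > 0"
proof (rule ccontr)
  assume "\<not> ?thesis"
  then have "\<And>\<alpha>. \<alpha> \<in> P \<Longrightarrow> (- v) \<bullet> \<alpha> \<ge> 0"
    by (simp add: not_less)
  then have "0 \<le> (- v) \<bullet> v"
    by (rule nat_comb_inner_nonneg[OF assms(1)])
  moreover have "v \<bullet> v > 0"
    using assms(2) by simp
  ultimately show False
    by simp
qed

text \<open>Every positive root pairs positively with some simple root, and reflecting a nonsimple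
  one in it lowers the height.\<close>

lemma Pos_induct [consumes 1, case_names simple step]:
  assumes "\<beta> \<in> Pos"
    and "\<And>\<alpha>. \<alpha> \<in> P \<Longrightarrow> Q \<alpha>"
    and "\<And>\<beta> \<alpha>. \<beta> \<in> Pos \<Longrightarrow> \<alpha> \<in> P \<Longrightarrow> \<beta> \<noteq> \<alpha> \<Longrightarrow> \<beta> \<bullet> \<alpha> > 0 \<Longrightarrow> refl \<alpha> \<beta> \<in> Pos \<Longrightarrow> Q (refl \<alpha> \<beta>) \<Longrightarrow> Q \<beta>"
  shows "Q \<beta>"
  using assms(1)
proof (induction "hgt \<beta>" arbitrary: \<beta> rule: less_induct)
  case less
  show ?case
  proof (cases "\<beta> \<in> P")
    case True
    then show ?thesis by (rule assms(2))
  next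
    case False
    obtain \<alpha> where a: "\<alpha> \<in> P" "\<beta> \<bullet> \<alpha> > 0"
      using ex_simple_inner_pos[OF Pos_nat_comb[OF less.prems] Pos_nz[OF less.prems]] by blast
    have ne: "\<beta> \<noteq> \<alpha>" using a False by auto
    have r: "refl \<alpha> \<beta> \<in> Pos" using refl_simple_Pos a less.prems ne by blast
    have "rhoc \<bullet> refl \<alpha> \<beta> < rhoc \<bullet> \<beta>"
      using a root_nz[OF P_R[OF a(1)]] by (simp add: refl_coroot_eq inner_diff_right rhoc_simple coroot_pos_iff)
    then have "hgt (refl \<alpha> \<beta>) < hgt \<beta>"
      using real_hgt Pos_nat_comb r less.prems by (metis of_nat_less_iff)
    then show ?thesis
      using assms(3) less.hyps less.prems a ne r by blast
  qed
qed

end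

section \<open>The Weyl group\<close>

primrec refl_word :: "'a::euclidean_space list \<Rightarrow> 'a \<Rightarrow> 'a" where
  "refl_word [] = id"
| "refl_word (\<alpha> # xs) = refl \<alpha> \<circ> refl_word xs"

lemma refl_word_foldr: "foldr (\<lambda>\<alpha> f. refl \<alpha> \<circ> f) xs id = refl_word xs"
  by (induction xs) simp_all

lemma refl_word_append: "refl_word (xs @ ys) = refl_word xs \<circ> refl_word ys"
  by (induction xs) (simp_all add: comp_assoc)

lemma refl_isometry_comp:
  assumes "linear w" "\<And>x y. w x \<bullet> w y = x \<bullet> y"
  shows "refl (w \<beta>) \<circ> w = w \<circ> refl \<beta>"
  by (rule ext) (simp add: refl_def linear_diff[OF assms(1)] linear_scale[OF assms(1)] assms(2))

context based_root_system
begin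

abbreviation W :: "('a \<Rightarrow> 'a) set" where "W \<equiv> weyl_group R"

lemma W_linear: "w \<in> W \<Longrightarrow> linear w"
  by (induction rule: weyl_group.induct)
     (simp_all add: linear_id id_def[symmetric] linear_compose linear_refl del: o_apply)

lemma W_inner: "w \<in> W \<Longrightarrow> w x \<bullet> w y = x \<bullet> y"
  by (induction rule: weyl_group.induct) simp_all

lemma W_R: "w \<in> W \<Longrightarrow> \<beta> \<in> R \<Longrightarrow> w \<beta> \<in> R"
  by (induction rule: weyl_group.induct) (simp_all add: refl_in_R)

lemma W_eq_iff: "w \<in> W \<Longrightarrow> w x = w y \<longleftrightarrow> x = y"
  by (induction rule: weyl_group.induct) simp_all

lemma W_R_ex:
  assumes "w \<in> W" "\<beta> \<in> R" shows "\<exists>\<gamma>\<in>R. w \<gamma> = \<beta>"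
proof -
  have "inj_on w R"
    using W_eq_iff[OF assms(1)] by (auto intro: inj_onI)
  then have "w ` R = R"
    using W_R[OF assms(1)] by (intro endo_inj_surj finite_R) auto
  then show ?thesis
    using assms(2) by (metis imageE)
qed

lemma W_minus: "w \<in> W \<Longrightarrow> w (- x) = - w x"
  using W_linear linear_neg by blast

lemma W_comp: "v \<in> W \<Longrightarrow> w \<in> W \<Longrightarrow> v \<circ> w \<in> W"
  by (induction rule: weyl_group.induct) (auto simp: comp_assoc intro: weyl_group.intros)

lemma refl_in_W: "\<alpha> \<in> R \<Longrightarrow> refl \<alpha> \<in> W"
  using weyl_group.refl_in[OF _ weyl_group.id_in, of \<alpha> R] by simp

lemma refl_word_W: "set xs \<subseteq> P \<Longrightarrow> refl_word xs \<in> W"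
  by (induction xs) (auto intro: weyl_group.intros P_R)

text \<open>Conjugation by the simple reflection of the inductive step turns the reflection in
  \<beta> into the reflection in a lower root.\<close>

lemma Pos_refl_word: "\<beta> \<in> Pos \<Longrightarrow> \<exists>xs. set xs \<subseteq> P \<and> refl \<beta> = refl_word xs"
proof (induction rule: Pos_induct)
  case (simple \<alpha>)
  then show ?case
    by (intro exI[of _ "[\<alpha>]"]) simp
next
  case (step \<beta> \<alpha>)
  then obtain xs where xs: "set xs \<subseteq> P" "refl (refl \<alpha> \<beta>) = refl_word xs" by blast
  have "refl \<beta> = refl \<alpha> \<circ> refl (refl \<alpha> \<beta>) \<circ> refl \<alpha>"
    using refl_isometry_comp[of "refl \<alpha>" \<beta>] by (simp add: linear_refl comp_assoc)
       (simp add: comp_assoc[symmetric])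
  then show ?case
    using xs step.hyps(2)
    by (intro exI[of _ "[\<alpha>] @ xs @ [\<alpha>]"]) (simp add: refl_word_append comp_assoc)
qed

lemma R_refl_word: "\<beta> \<in> R \<Longrightarrow> \<exists>xs. set xs \<subseteq> P \<and> refl \<beta> = refl_word xs"
  using Pos_refl_word[of \<beta>] Pos_refl_word[of "- \<beta>"] neg_Pos_iff[of \<beta>]
  by (auto simp: refl_neg_root)

lemma W_refl_word:
  assumes "w \<in> W" obtains xs where "set xs \<subseteq> P" "w = refl_word xs"
proof -
  from assms have "\<exists>xs. set xs \<subseteq> P \<and> w = refl_word xs"
  proof (induction rule: weyl_group.induct)
    case id_in
    then show ?case by (intro exI[of _ "[]"]) simp
  next
    case (refl_in \<alpha> w)
    then obtain xs ys where "set xs \<subseteq> P" "w = refl_word xs" "set ys \<subseteq> P" "refl \<alpha> = refl_word ys"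
      using R_refl_word by blast
    then show ?case
      by (intro exI[of _ "ys @ xs"]) (simp add: refl_word_append)
  qed
  then show thesis using that by blast
qed

lemma W_simple_induct [consumes 1, case_names id step]:
  assumes "w \<in> W" "Q id" "\<And>\<alpha> w. \<alpha> \<in> P \<Longrightarrow> w \<in> W \<Longrightarrow> Q w \<Longrightarrow> Q (refl \<alpha> \<circ> w)"
  shows "Q w"
proof -
  obtain xs where xs: "set xs \<subseteq> P" "w = refl_word xs" using W_refl_word[OF assms(1)] .
  have "Q (refl_word xs)" using xs(1)
    by (induction xs) (auto intro: assms(2,3) refl_word_W)
  then show ?thesis using xs by simp
qed

lemma finite_W: "finite W"
proof (rule inj_on_finite)
  show "inj_on (\<lambda>w. restrict w R) W"
  proof (rule inj_onI)
    fix v w assume vw: "v \<in> W" "w \<in> W" "restrict v R = restrict w R"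
    have eq: "v b = w b" if "b \<in> R" for b
      using vw(3) that by (metis restrict_apply')
    have "v x = w x" for x
      using linear_eq_on[OF W_linear[OF vw(1)] W_linear[OF vw(2)], of x R] eq by (simp add: span_R)
    then show "v = w" by blast
  qed
  show "(\<lambda>w. restrict w R) ` W \<subseteq> R \<rightarrow>\<^sub>E R"
    using W_R by auto
  show "finite (R \<rightarrow>\<^sub>E R)"
    by (intro finite_PiE finite_R)
qed

text \<open>The inversion number, used through its parity: it depends on w alone, so all words for w
  have lengths of the same parity, and no identification with \<open>weyl_length\<close> is called
  for.\<close>

definition ninv :: "('a \<Rightarrow> 'a) \<Rightarrow> nat" where
  "ninv w = card {\<beta>\<in>Pos. w \<beta> \<notin> Pos}"

lemma refl_simple_Pos_iff:
  assumes "\<alpha> \<in> P" "\<beta> \<in> R" "\<beta> \<noteq> \<alpha>" "\<beta> \<noteq> - \<alpha>"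
  shows "refl \<alpha> \<beta> \<in> Pos \<longleftrightarrow> \<beta> \<in> Pos"
proof
  assume "\<beta> \<in> Pos"
  then show "refl \<alpha> \<beta> \<in> Pos" using refl_simple_Pos assms by blast
next
  assume r: "refl \<alpha> \<beta> \<in> Pos"
  show "\<beta> \<in> Pos"
  proof (rule ccontr)
    assume "\<beta> \<notin> Pos"
    then have "- \<beta> \<in> Pos" using neg_Pos_iff assms by blast
    moreover have "- \<beta> \<noteq> \<alpha>" using assms(4) by auto
    ultimately have "- refl \<alpha> \<beta> \<in> Pos"
      using refl_simple_Pos[OF assms(1), of "- \<beta>"] by (simp add: refl_minus)
    then show False using r not_both_Pos by blast
  qed
qed

text \<open>The reflection preserves the sign of every root except \<alpha> and -\<alpha>. So
  exactly one positive root changes its status, the positive one among the preimages of these two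
  under w.\<close>

lemma ninv_refl_parity:
  assumes w: "w \<in> W" and a: "\<alpha> \<in> P"
  shows "(-1::int) ^ ninv (refl \<alpha> \<circ> w) = - ((-1) ^ ninv w)"
proof -
  obtain \<gamma> where g: "\<gamma> \<in> R" "w \<gamma> = \<alpha>" using W_R_ex[OF w P_R[OF a]] by blast
  define \<beta> where "\<beta> = (if \<gamma> \<in> Pos then \<gamma> else - \<gamma>)"
  have b: "\<beta> \<in> Pos" "w \<beta> = \<alpha> \<or> w \<beta> = - \<alpha>"
    using g neg_Pos_iff[of \<gamma>] by (auto simp: \<beta>_def W_minus[OF w])
  have aa: "\<alpha> \<in> Pos" "- \<alpha> \<notin> Pos"
    using a P_Pos not_both_Pos by auto
  have other: "refl \<alpha> (w \<delta>) \<in> Pos \<longleftrightarrow> w \<delta> \<in> Pos" if "\<delta> \<in> Pos" "\<delta> \<noteq> \<beta>" for \<delta>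
  proof (rule refl_simple_Pos_iff[OF a])
    show "w \<delta> \<in> R" using that W_R[OF w] Pos_R by blast
    have "w \<delta> \<noteq> w \<beta>" "w \<delta> \<noteq> w (- \<beta>)"
      using that b(1) not_both_Pos W_eq_iff[OF w] by auto
    then show "w \<delta> \<noteq> \<alpha>" "w \<delta> \<noteq> - \<alpha>"
      using b(2) by (auto simp: W_minus[OF w])
  qed
  define A where "A = {\<delta>\<in>Pos - {\<beta>}. w \<delta> \<notin> Pos}"
  have fA: "finite A" "\<beta> \<notin> A" using finite_Pos by (auto simp: A_def)
  have iff: "w \<beta> \<in> Pos \<longleftrightarrow> w \<beta> = \<alpha>" "refl \<alpha> (w \<beta>) \<in> Pos \<longleftrightarrow> w \<beta> \<noteq> \<alpha>"
  proof -
    have "- \<alpha> \<noteq> \<alpha>" using aa by auto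
    with b(2) show "w \<beta> \<in> Pos \<longleftrightarrow> w \<beta> = \<alpha>" "refl \<alpha> (w \<beta>) \<in> Pos \<longleftrightarrow> w \<beta> \<noteq> \<alpha>"
      by (elim disjE; simp add: aa refl_simple_minus[OF a] refl_minus)+
  qed
  have eq1: "{\<delta>\<in>Pos. refl \<alpha> (w \<delta>) \<notin> Pos} = (if w \<beta> = \<alpha> then insert \<beta> A else A)"
  proof (rule set_eqI)
    fix \<delta> show "\<delta> \<in> {\<delta>\<in>Pos. refl \<alpha> (w \<delta>) \<notin> Pos} \<longleftrightarrow> \<delta> \<in> (if w \<beta> = \<alpha> then insert \<beta> A else A)"
      using other[of \<delta>] iff b(1) by (cases "\<delta> = \<beta>") (auto simp: A_def)
  qed
  have eq2: "{\<delta>\<in>Pos. w \<delta> \<notin> Pos} = (if w \<beta> = \<alpha> then A else insert \<beta> A)"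
  proof (rule set_eqI)
    fix \<delta> show "\<delta> \<in> {\<delta>\<in>Pos. w \<delta> \<notin> Pos} \<longleftrightarrow> \<delta> \<in> (if w \<beta> = \<alpha> then A else insert \<beta> A)"
      using iff b(1) by (cases "\<delta> = \<beta>") (auto simp: A_def)
  qed
  show ?thesis
    using fA by (simp add: ninv_def eq1 eq2)
qed

lemma ninv_refl_word: "set xs \<subseteq> P \<Longrightarrow> (-1::int) ^ ninv (refl_word xs) = (-1) ^ length xs"
proof (induction xs)
  case Nil
  then show ?case by (simp add: ninv_def)
next
  case (Cons a xs)
  then have "(-1::int) ^ ninv (refl a \<circ> refl_word xs) = - ((-1) ^ length xs)"
    using ninv_refl_parity[of "refl_word xs" a] refl_word_W[of xs] by simp
  then show ?case
    unfolding refl_word.simps by (simp only: length_Cons power_Suc mult_minus1)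
qed

text \<open>\<open>weyl_length\<close> is the length of some word for the same element, and both
  words have the parity of \<open>ninv\<close>.\<close>

lemma sign_refl_word:
  assumes "set xs \<subseteq> P" shows "weyl_sign P (refl_word xs) = (-1) ^ length xs"
proof -
  let ?Q = "\<lambda>n. \<exists>ys. set ys \<subseteq> P \<and> length ys = n \<and> refl_word xs = refl_word ys"
  have "\<exists>n. ?Q n"
    using assms by (intro exI[of _ "length xs"] exI[of _ xs]) simp
  then have "?Q (weyl_length P (refl_word xs))"
    unfolding weyl_length_def refl_word_foldr by (rule LeastI_ex)
  then obtain ys where ys: "set ys \<subseteq> P" "length ys = weyl_length P (refl_word xs)"
      "refl_word xs = refl_word ys"
    by blast
  then show ?thesis
    using ninv_refl_word[OF assms] ninv_refl_word[OF ys(1)] by (simp add: weyl_sign_def)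
qed

lemma sign_id: "weyl_sign P id = 1"
  using sign_refl_word[of "[]"] by simp

lemma sign_refl_left:
  assumes "w \<in> W" "\<alpha> \<in> P" shows "weyl_sign P (refl \<alpha> \<circ> w) = - weyl_sign P w"
proof -
  obtain xs where "set xs \<subseteq> P" "w = refl_word xs" using W_refl_word[OF assms(1)] .
  then show ?thesis
    using sign_refl_word[of xs] sign_refl_word[of "\<alpha> # xs"] assms by simp
qed

lemma sign_refl_right:
  assumes "w \<in> W" "\<alpha> \<in> P" shows "weyl_sign P (w \<circ> refl \<alpha>) = - weyl_sign P w"
proof -
  obtain xs where "set xs \<subseteq> P" "w = refl_word xs" using W_refl_word[OF assms(1)] .
  then show ?thesis
    using sign_refl_word[of xs] sign_refl_word[of "xs @ [\<alpha>]"] assms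
    by (simp add: refl_word_append)
qed

lemma sign_square: "weyl_sign P w * weyl_sign P w = 1"
  by (simp add: weyl_sign_def power_add[symmetric])

lemma W_left_bij: "\<alpha> \<in> R \<Longrightarrow> bij_betw (\<lambda>w. refl \<alpha> \<circ> w) W W"
  by (rule bij_betw_byWitness[where f' = "\<lambda>w. refl \<alpha> \<circ> w"])
     (auto simp: comp_assoc[symmetric] intro: weyl_group.refl_in)

lemma W_right_bij: "\<alpha> \<in> R \<Longrightarrow> bij_betw (\<lambda>w. w \<circ> refl \<alpha>) W W"
  by (rule bij_betw_byWitness[where f' = "\<lambda>w. w \<circ> refl \<alpha>"])
     (auto simp: comp_assoc intro: W_comp refl_in_W)

text \<open>Read from the right, the word turns \<alpha> negative at some letter. Just before, the
  image of \<alpha> is that letter itself, and conjugation lets \<open>refl \<alpha>\<close> delete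
  it.\<close>

lemma exchange:
  assumes "set xs \<subseteq> P" "\<alpha> \<in> P" "refl_word xs \<alpha> \<notin> Pos"
  shows "\<exists>ys. set ys \<subseteq> P \<and> length ys < length xs \<and> refl_word xs \<circ> refl \<alpha> = refl_word ys"
  using assms(1,3)
proof (induction xs)
  case Nil
  then show ?case using P_Pos assms(2) by simp
next
  case (Cons a xs)
  let ?w = "refl_word xs"
  have w: "?w \<in> W" using Cons.prems refl_word_W by simp
  show ?case
  proof (cases "?w \<alpha> \<in> Pos")
    case False
    then obtain ys where ys: "set ys \<subseteq> P" "length ys < length xs" "?w \<circ> refl \<alpha> = refl_word ys"
      using Cons.IH[OF _ False] Cons.prems(1) by (metis list.set_intros(2) subset_code(1))
    then show ?thesis
      using Cons.prems by (intro exI[of _ "a # ys"]) (simp only: refl_word.simps comp_assoc, simp)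
  next
    case True
    have "?w \<alpha> = a"
      using True Cons.prems refl_simple_Pos[of a "?w \<alpha>"] by auto
    then have "refl a \<circ> ?w = ?w \<circ> refl \<alpha>"
      using refl_isometry_comp[of ?w \<alpha>] W_linear[OF w] W_inner[OF w] by simp
    then have "refl_word (a # xs) \<circ> refl \<alpha> = ?w"
      by (simp add: comp_assoc)
    then show ?thesis
      using Cons.prems(1) by (intro exI[of _ xs] conjI) (assumption | simp)+
  qed
qed

text \<open>If a nonempty word for w is cut before its last letter, the remaining word sends that
  letter to a negative root; \<open>exchange\<close> then yields a shorter word for w.\<close>

lemma W_preserves_Pos_id:
  assumes "w \<in> W" "\<And>\<beta>. \<beta> \<in> Pos \<Longrightarrow> w \<beta> \<in> Pos"
  shows "w = id"
proof -
  obtain xs where xs: "set xs \<subseteq> P" "w = refl_word xs" using W_refl_word[OF assms(1)] .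
  have "refl_word xs = id" if "set xs \<subseteq> P" "\<And>\<beta>. \<beta> \<in> Pos \<Longrightarrow> refl_word xs \<beta> \<in> Pos" for xs
    using that
  proof (induction "length xs" arbitrary: xs rule: less_induct)
    case less
    show ?case
    proof (cases xs rule: rev_cases)
      case Nil
      then show ?thesis by simp
    next
      case (snoc zs \<alpha>)
      have a: "\<alpha> \<in> P" "set zs \<subseteq> P" using less.prems snoc by auto
      have w: "refl_word zs \<circ> refl \<alpha> = refl_word xs"
        by (simp add: snoc refl_word_append)
      have "refl_word zs \<alpha> = - refl_word xs \<alpha>"
        unfolding w[symmetric]
        by (simp add: refl_simple_minus a W_minus[OF refl_word_W[OF a(2)]])
      then have "refl_word zs \<alpha> \<notin> Pos"
        using less.prems(2)[OF P_Pos[OF a(1)]] not_both_Pos by force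
      then obtain ys where ys: "set ys \<subseteq> P" "length ys < length zs" "refl_word zs \<circ> refl \<alpha> = refl_word ys"
        using exchange a by blast
      then have eq: "refl_word ys = refl_word xs" using w by simp
      have "length ys < length xs" using ys snoc by simp
      then have "refl_word ys = id"
        using less.hyps[of ys] ys(1) less.prems(2) eq by simp
      then show ?thesis using eq by simp
    qed
  qed
  then show ?thesis using xs assms by blast
qed

text \<open>Put v = w x - x, a nonnegative combination. As x and x + v have equal norms and x pairs
  nonnegatively with v, v is 0; then w preserves \<open>Pos\<close>, on which x is positive.\<close>

lemma strictly_dominant_rigid:
  assumes x: "\<And>\<alpha>. \<alpha> \<in> P \<Longrightarrow> x \<bullet> \<alpha> > 0" and w: "w \<in> W"
    and k: "nat_comb P \<kappa>" "nat_comb P (w x - x - \<kappa>)"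
  shows "w = id" "\<kappa> = 0"
proof -
  define v where "v = w x - x"
  have v: "nat_comb P v"
    using nat_comb_add[OF k] by (simp add: v_def)
  have "x \<bullet> x = (x + v) \<bullet> (x + v)"
    using W_inner[OF w, of x x] by (simp add: v_def)
  then have "2 * (x \<bullet> v) + v \<bullet> v = 0"
    by (simp add: inner_add_left inner_add_right inner_commute)
  moreover have "x \<bullet> v \<ge> 0"
    using nat_comb_inner_nonneg[OF v] x less_imp_le by blast
  ultimately have "v \<bullet> v \<le> 0" by linarith
  then have v0: "v = 0"
    using inner_ge_zero[of v] by (metis antisym inner_eq_zero_iff)
  then show "\<kappa> = 0"
    using k nat_comb_antisym by (simp add: v_def)
  have wx: "w x = x" using v0 by (simp add: v_def)
  have pos: "x \<bullet> \<beta> > 0" if "\<beta> \<in> Pos" for \<beta>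
    using pos_inner_Pos[of x \<beta>] that x Pos_nat_comb Pos_nz by blast
  show "w = id"
  proof (rule W_preserves_Pos_id[OF w], rule ccontr)
    fix \<beta> assume b: "\<beta> \<in> Pos" "w \<beta> \<notin> Pos"
    then have "- w \<beta> \<in> Pos"
      using neg_Pos_iff W_R[OF w] Pos_R by blast
    then have "x \<bullet> (- w \<beta>) > 0" by (rule pos)
    moreover have "x \<bullet> w \<beta> = x \<bullet> \<beta>"
      using W_inner[OF w, of x \<beta>] wx by simp
    ultimately show False using pos[OF b(1)] by simp
  qed
qed

end

section \<open>Partition functions and alternating sums\<close>

lemma finite_bounded_msets:
  assumes "finite A" shows "finite {M. set_mset M \<subseteq> A \<and> size M \<le> n}"
proof (rule finite_subset)
  show "{M. set_mset M \<subseteq> A \<and> size M \<le> n} \<subseteq> mset ` {xs. set xs \<subseteq> A \<and> length xs \<le> n}"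
  proof
    fix M assume M: "M \<in> {M. set_mset M \<subseteq> A \<and> size M \<le> n}"
    obtain xs where "mset xs = M" using ex_mset by blast
    then show "M \<in> mset ` {xs. set xs \<subseteq> A \<and> length xs \<le> n}"
      using M by (intro image_eqI[of _ _ xs]) auto
  qed
  show "finite (mset ` {xs. set xs \<subseteq> A \<and> length xs \<le> n})"
    using assms by (intro finite_imageI finite_lists_length_le)
qed

lemma int_poly_double_0: "p = - p \<Longrightarrow> p = 0" for p :: "int poly"
  by (simp add: poly_eq_iff)

text \<open>The set of parts is a parameter, so that a simple root can be removed from it.\<close>

definition part_q :: "'a::euclidean_space set \<Rightarrow> 'a \<Rightarrow> int poly" where
  "part_q B \<mu> = (\<Sum>M | set_mset M \<subseteq> B \<and> sum_mset M = \<mu>. monom 1 (size M))"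

lemma kostant_q_part_q: "kostant_q R P = part_q (pos_roots R P)"
  by (rule ext) (simp add: kostant_q_def part_q_def)

lemma refl_sum_mset: "refl \<alpha> (sum_mset M) = sum_mset (image_mset (refl \<alpha>) M)"
  by (induction M) (simp_all add: refl_add linear_0[OF linear_refl])

context based_root_system
begin

text \<open>Each part has height at least 1. This makes the sets of partitions finite; over an
  infinite set the defining sum would be 0 by convention.\<close>

lemma size_le_rhoc: "set_mset M \<subseteq> Pos \<Longrightarrow> real (size M) \<le> rhoc \<bullet> sum_mset M"
proof (induction M)
  case (add \<beta> M)
  then have "real (hgt \<beta>) \<ge> 1" "real (hgt \<beta>) = rhoc \<bullet> \<beta>"
    using hgt_Pos[of \<beta>] real_hgt[of \<beta>] Pos_nat_comb[of \<beta>] by auto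
  then show ?case
    using add by (simp add: inner_add_right)
qed simp

lemma finite_partitions: "finite {M. set_mset M \<subseteq> Pos \<and> sum_mset M = \<mu>}"
proof (rule finite_subset)
  show "{M. set_mset M \<subseteq> Pos \<and> sum_mset M = \<mu>} \<subseteq> {M. set_mset M \<subseteq> Pos \<and> size M \<le> nat \<lfloor>rhoc \<bullet> \<mu>\<rfloor>}"
    using size_le_rhoc le_nat_floor by blast
qed (rule finite_bounded_msets[OF finite_Pos])

text \<open>A partition either avoids \<alpha> or loses one copy of it; in generating series this is
  multiplication by 1 - q e^\<alpha>.\<close>

lemma part_q_split:
  assumes "\<alpha> \<in> Pos"
  shows "part_q Pos \<mu> = part_q (Pos - {\<alpha>}) \<mu> + [:0, 1:] * part_q Pos (\<mu> - \<alpha>)"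
proof -
  let ?A = "{M. set_mset M \<subseteq> Pos - {\<alpha>} \<and> sum_mset M = \<mu>}"
  let ?B = "{M. set_mset M \<subseteq> Pos \<and> sum_mset M = \<mu> - \<alpha>}"
  have eq: "{M. set_mset M \<subseteq> Pos \<and> sum_mset M = \<mu>} = ?A \<union> add_mset \<alpha> ` ?B"
  proof (intro set_eqI iffI)
    fix M assume M: "M \<in> {M. set_mset M \<subseteq> Pos \<and> sum_mset M = \<mu>}"
    show "M \<in> ?A \<union> add_mset \<alpha> ` ?B"
    proof (cases "\<alpha> \<in># M")
      case True
      then obtain N where N: "M = add_mset \<alpha> N" by (metis insert_DiffM)
      then have "N \<in> ?B" using M by auto
      then show ?thesis using N by blast
    qed (use M in auto)
  qed (use assms in auto)
  have "finite ?A"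
    by (rule finite_subset[OF _ finite_partitions[of \<mu>]]) auto
  moreover have "finite (add_mset \<alpha> ` ?B)"
    by (intro finite_imageI finite_partitions)
  moreover have "?A \<inter> add_mset \<alpha> ` ?B = {}"
  proof -
    have "\<alpha> \<notin># M" if "M \<in> ?A" for M
      using that by blast
    then show ?thesis
      by (metis (no_types, lifting) disjoint_iff imageE union_single_eq_member)
  qed
  ultimately have "part_q Pos \<mu> = part_q (Pos - {\<alpha>}) \<mu> + (\<Sum>M\<in>add_mset \<alpha> ` ?B. monom 1 (size M))"
    unfolding part_q_def eq by (rule sum.union_disjoint)
  also have "(\<Sum>M\<in>add_mset \<alpha> ` ?B. monom 1 (size M)) = [:0, 1:] * part_q Pos (\<mu> - \<alpha>)"
  proof -
    have "(monom 1 (Suc n) :: int poly) = [:0, 1:] * monom 1 n" for n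
      by (simp add: monom_Suc)
    then show ?thesis
      unfolding part_q_def sum_distrib_left by (subst sum.reindex) (auto intro: inj_onI)
  qed
  finally show ?thesis .
qed

lemma part_q_refl:
  assumes a: "\<alpha> \<in> P" shows "part_q (Pos - {\<alpha>}) (refl \<alpha> \<mu>) = part_q (Pos - {\<alpha>}) \<mu>"
proof -
  have bij: "refl \<alpha> \<beta> \<in> Pos - {\<alpha>}" if "\<beta> \<in> Pos - {\<alpha>}" for \<beta>
    using refl_simple_bij[OF a] that by (auto dest: bij_betw_apply)
  have mem: "image_mset (refl \<alpha>) M \<in> {M. set_mset M \<subseteq> Pos - {\<alpha>} \<and> sum_mset M = refl \<alpha> \<nu>}"
    if "M \<in> {M. set_mset M \<subseteq> Pos - {\<alpha>} \<and> sum_mset M = \<nu>}" for M \<nu>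
    using that bij by (auto simp: refl_sum_mset)
  have inv: "image_mset (refl \<alpha>) (image_mset (refl \<alpha>) M) = M" for M
    by (simp add: multiset.map_comp)
  show ?thesis
    unfolding part_q_def
    by (rule sum.reindex_bij_witness[where i = "image_mset (refl \<alpha>)" and j = "image_mset (refl \<alpha>)"])
       (use mem[of _ "refl \<alpha> \<mu>"] mem[of _ \<mu>] inv in simp_all)
qed

lemma part_q_nz: "part_q Pos \<mu> \<noteq> 0 \<Longrightarrow> nat_comb P \<mu>"
proof -
  assume "part_q Pos \<mu> \<noteq> 0"
  then have "{M. set_mset M \<subseteq> Pos \<and> sum_mset M = \<mu>} \<noteq> {}"
    unfolding part_q_def by (metis (no_types, lifting) sum.empty)
  then obtain M where M: "set_mset M \<subseteq> Pos" "sum_mset M = \<mu>" by blast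
  have "nat_comb P (sum_mset M)" using M(1)
    by (induction M) (auto intro: nat_comb_0 nat_comb_add Pos_nat_comb)
  then show ?thesis using M by simp
qed

lemma part_q_0: "part_q Pos 0 = 1"
proof -
  have "{M. set_mset M \<subseteq> Pos \<and> sum_mset M = 0} = {{#}}"
  proof (intro set_eqI iffI)
    fix M assume "M \<in> {M. set_mset M \<subseteq> Pos \<and> sum_mset M = 0}"
    then have "real (size M) \<le> 0"
      using size_le_rhoc[of M] by auto
    then show "M \<in> {{#}}" by simp
  qed simp
  then show ?thesis
    by (simp add: part_q_def)
qed

text \<open>Both arguments already carry the shift by rho, so reflections act linearly on
  them.\<close>

definition alt_q :: "'a \<Rightarrow> 'a \<Rightarrow> int poly" where
  "alt_q x y = (\<Sum>w\<in>W. of_int (weyl_sign P w) * part_q Pos (w x - y))"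

lemma lusztig_q_alt_q: "lusztig_q R P lam \<mu> = alt_q (lam + rho R P) (\<mu> + rho R P)"
  by (simp add: lusztig_q_def alt_q_def kostant_q_part_q)

lemma alt_q_reflect:
  assumes a: "\<alpha> \<in> P"
  shows "alt_q x (refl \<alpha> y) - [:0, 1:] * alt_q x (refl \<alpha> y + \<alpha>) = - (alt_q x y - [:0, 1:] * alt_q x (y + \<alpha>))"
proof -
  have eq: "alt_q x y - [:0, 1:] * alt_q x (y + \<alpha>) =
      (\<Sum>w\<in>W. of_int (weyl_sign P w) * part_q (Pos - {\<alpha>}) (w x - y))" for y
  proof -
    have "part_q (Pos - {\<alpha>}) (w x - y) = part_q Pos (w x - y) - [:0, 1:] * part_q Pos (w x - (y + \<alpha>))" for w
      using part_q_split[OF P_Pos[OF a], of "w x - y"] by (simp add: diff_diff_eq)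
    then show ?thesis
      by (simp only: alt_q_def sum_distrib_left sum_subtractf[symmetric])
         (simp add: algebra_simps)
  qed
  have "(\<Sum>w\<in>W. of_int (weyl_sign P w) * part_q (Pos - {\<alpha>}) (w x - refl \<alpha> y))
      = (\<Sum>w\<in>W. of_int (weyl_sign P (refl \<alpha> \<circ> w)) * part_q (Pos - {\<alpha>}) ((refl \<alpha> \<circ> w) x - refl \<alpha> y))"
    by (rule sum.reindex_bij_betw[OF W_left_bij[OF P_R[OF a]], symmetric])
  also have "\<dots> = (\<Sum>w\<in>W. - (of_int (weyl_sign P w) * part_q (Pos - {\<alpha>}) (w x - y)))"
  proof (rule sum.cong)
    fix w assume w: "w \<in> W"
    have "(refl \<alpha> \<circ> w) x - refl \<alpha> y = refl \<alpha> (w x - y)"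
      by (simp add: refl_diff)
    then show "of_int (weyl_sign P (refl \<alpha> \<circ> w)) * part_q (Pos - {\<alpha>}) ((refl \<alpha> \<circ> w) x - refl \<alpha> y)
      = - (of_int (weyl_sign P w) * part_q (Pos - {\<alpha>}) (w x - y))"
      by (simp only: part_q_refl[OF a] sign_refl_left[OF w a]) simp
  qed simp
  finally show ?thesis
    by (simp only: eq sum_negf)
qed

lemma alt_q_refl_left:
  assumes a: "\<alpha> \<in> P" shows "alt_q (refl \<alpha> x) y = - alt_q x y"
proof -
  have "alt_q (refl \<alpha> x) y = (\<Sum>w\<in>W. of_int (weyl_sign P (w \<circ> refl \<alpha>)) * part_q Pos ((w \<circ> refl \<alpha>) (refl \<alpha> x) - y))"
    unfolding alt_q_def by (rule sum.reindex_bij_betw[OF W_right_bij[OF P_R[OF a]], symmetric])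
  also have "\<dots> = (\<Sum>w\<in>W. - (of_int (weyl_sign P w) * part_q Pos (w x - y)))"
  proof (rule sum.cong)
    fix w assume w: "w \<in> W"
    show "of_int (weyl_sign P (w \<circ> refl \<alpha>)) * part_q Pos ((w \<circ> refl \<alpha>) (refl \<alpha> x) - y)
      = - (of_int (weyl_sign P w) * part_q Pos (w x - y))"
      by (simp only: sign_refl_right[OF w a] o_apply refl_refl) simp
  qed simp
  finally show ?thesis
    by (simp only: alt_q_def sum_negf)
qed

lemma alt_q_fixed: "\<alpha> \<in> P \<Longrightarrow> refl \<alpha> x = x \<Longrightarrow> alt_q x y = 0"
  using alt_q_refl_left[of \<alpha> x y] int_poly_double_0 by simp

text \<open>Here \<mu> + rho is fixed by the reflection, so the quantity in
  \<open>alt_q_reflect\<close> is its own negative.\<close>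

lemma lusztig_q_step:
  assumes a: "\<alpha> \<in> P" and m: "coroot \<alpha> \<bullet> \<mu> = -1"
  shows "lusztig_q R P lam \<mu> = [:0, 1:] * lusztig_q R P lam (\<mu> + \<alpha>)"
proof -
  have "refl \<alpha> (\<mu> + rho R P) = \<mu> + rho R P"
    by (simp add: refl_coroot_eq inner_add_right m rho_simple[OF a])
  then have "alt_q (lam + rho R P) (\<mu> + rho R P) - [:0, 1:] * alt_q (lam + rho R P) (\<mu> + rho R P + \<alpha>) = 0"
    using alt_q_reflect[OF a, of "lam + rho R P" "\<mu> + rho R P"] int_poly_double_0 by metis
  then show ?thesis
    by (simp add: lusztig_q_alt_q add_ac)
qed

text \<open>This is \<open>alt_q_reflect\<close> at \<mu> = 0, where rho goes to rho - \<alpha>. The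
  string from -\<alpha> to \<alpha> passes through 0, which is how the zero weight enters the
  recursion.\<close>

lemma lusztig_q_minus_simple:
  assumes a: "\<alpha> \<in> P"
  shows "lusztig_q R P lam (- \<alpha>) = [:0, 1:] * lusztig_q R P lam \<alpha> - (1 - [:0, 1:]) * lusztig_q R P lam 0"
proof -
  have "refl \<alpha> (rho R P) = - \<alpha> + rho R P"
    by (simp add: refl_rho[OF a])
  then have "alt_q (lam + rho R P) (- \<alpha> + rho R P) - [:0, 1:] * alt_q (lam + rho R P) (- \<alpha> + rho R P + \<alpha>)
      = - (alt_q (lam + rho R P) (rho R P) - [:0, 1:] * alt_q (lam + rho R P) (rho R P + \<alpha>))"
    using alt_q_reflect[OF a, of "lam + rho R P" "rho R P"] by simp
  moreover have "- \<alpha> + rho R P + \<alpha> = rho R P" "rho R P + \<alpha> = \<alpha> + rho R P" by simp_all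
  ultimately show ?thesis
    unfolding lusztig_q_alt_q by (simp only: add_0 left_diff_distrib mult_1)
qed

text \<open>Since lam + rho is strictly dominant, \<open>strictly_dominant_rigid\<close> lets only
  the identity contribute, and only for \<kappa> = 0.\<close>

lemma lusztig_q_above:
  assumes d: "dominant P lam" and k: "nat_comb P \<kappa>"
  shows "lusztig_q R P lam (lam + \<kappa>) = (if \<kappa> = 0 then 1 else 0)"
proof -
  let ?x = "lam + rho R P"
  have x: "?x \<bullet> \<alpha> > 0" if "\<alpha> \<in> P" for \<alpha>
    using d rho_simple_pos[OF that] that by (auto simp: dominant_def inner_add_left intro: add_nonneg_pos)
  have "of_int (weyl_sign P w) * part_q Pos (w ?x - (?x + \<kappa>)) = (if w = id then if \<kappa> = 0 then 1 else 0 else 0)"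
    if w: "w \<in> W" for w
  proof (cases "part_q Pos (w ?x - (?x + \<kappa>)) = 0")
    case True
    then show ?thesis by (auto simp: part_q_0)
  next
    case False
    then have "nat_comb P (w ?x - ?x - \<kappa>)"
      using part_q_nz by (simp only: diff_diff_eq)
    then have "w = id" "\<kappa> = 0"
      using strictly_dominant_rigid[of ?x w \<kappa>] x w k by auto
    then show ?thesis by (simp add: part_q_0 sign_id)
  qed
  then have "alt_q ?x (?x + \<kappa>) = (\<Sum>w\<in>W. if w = id then if \<kappa> = 0 then 1 else 0 else 0)"
    unfolding alt_q_def by (rule sum.cong[OF refl])
  also have "\<dots> = (if \<kappa> = 0 then 1 else 0)"
    using finite_W weyl_group.id_in[of R] by simp
  finally show ?thesis
    by (simp add: lusztig_q_alt_q add_ac)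
qed

text \<open>Invariance of S allows \<beta> to be replaced by \<open>w \<beta>\<close> in the summand
  of w. This is Brauer's way of multiplying an alternating sum by the W-invariant sum of the
  e^\<beta>.\<close>

lemma sum_lusztig_q_0:
  assumes S: "finite S" "\<And>w. w \<in> W \<Longrightarrow> w ` S = S"
  shows "(\<Sum>\<beta>\<in>S. lusztig_q R P 0 (\<mu> - \<beta>)) = (\<Sum>\<beta>\<in>S. alt_q (rho R P + \<beta>) (\<mu> + rho R P))"
proof -
  have "(\<Sum>\<beta>\<in>S. part_q Pos (w (rho R P) - (\<mu> - \<beta> + rho R P)))
      = (\<Sum>\<beta>\<in>S. part_q Pos (w (rho R P + \<beta>) - (\<mu> + rho R P)))" if w: "w \<in> W" for w
  proof -
    have "bij_betw w S S"
      using S(2)[OF w] W_eq_iff[OF w] by (auto simp: bij_betw_def intro: inj_onI)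
    then have "(\<Sum>\<beta>\<in>S. part_q Pos (w (rho R P) - (\<mu> - \<beta> + rho R P)))
      = (\<Sum>\<beta>\<in>S. part_q Pos (w (rho R P) - (\<mu> - w \<beta> + rho R P)))"
      by (rule sum.reindex_bij_betw[symmetric])
    also have "\<dots> = (\<Sum>\<beta>\<in>S. part_q Pos (w (rho R P + \<beta>) - (\<mu> + rho R P)))"
      by (simp add: linear_add[OF W_linear[OF w]] algebra_simps)
    finally show ?thesis .
  qed
  then show ?thesis
    unfolding lusztig_q_alt_q alt_q_def
    by (subst (1 2) sum.swap) (simp add: sum_distrib_left[symmetric])
qed

end

section \<open>Short roots and irreducibility\<close>

context based_root_system
begin

text \<open>The reflection of \<beta> in \<alpha> is a positive root whose \<alpha>-coordinate is
  minus the pairing.\<close>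

lemma simple_obtuse:
  assumes "\<alpha> \<in> P" "\<beta> \<in> P" "\<alpha> \<noteq> \<beta>" shows "\<alpha> \<bullet> \<beta> \<le> 0"
proof (rule ccontr)
  assume "\<not> \<alpha> \<bullet> \<beta> \<le> 0"
  then have "coroot \<alpha> \<bullet> \<beta> > 0"
    using coroot_pos_iff[OF root_nz[OF P_R[OF assms(1)]]] by (simp add: inner_commute)
  moreover have "refl \<alpha> \<beta> \<in> Pos"
    using refl_simple_Pos P_Pos assms by blast
  then have "coord (refl \<alpha> \<beta>) \<alpha> \<ge> 0"
    using nat_comb_coord Pos_nat_comb by blast
  then have "coroot \<alpha> \<bullet> \<beta> \<le> 0"
    using assms by (simp add: refl_coroot_eq coord_diff coord_scale coord_simple)
  ultimately show False by simp
qed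

lemma dominant_Pos_nonneg: "dominant P x \<Longrightarrow> \<beta> \<in> Pos \<Longrightarrow> x \<bullet> \<beta> \<ge> 0"
  using nat_comb_inner_nonneg[OF Pos_nat_comb] by (auto simp: dominant_def)

lemma dominant_root_Pos:
  assumes "\<beta> \<in> R" "dominant P \<beta>" shows "\<beta> \<in> Pos"
proof (rule ccontr)
  assume "\<beta> \<notin> Pos"
  then have "\<beta> \<bullet> (- \<beta>) \<ge> 0"
    using neg_Pos_iff assms dominant_Pos_nonneg by blast
  moreover have "\<beta> \<bullet> \<beta> > 0"
    using root_nz[OF assms(1)] by simp
  ultimately show False by simp
qed

abbreviation Short :: "'a set" where "Short \<equiv> short_roots R"

lemma Short_R: "\<beta> \<in> Short \<Longrightarrow> \<beta> \<in> R"
  by (simp add: short_roots_def)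

lemma Short_norm_le: "\<beta> \<in> Short \<Longrightarrow> \<alpha> \<in> R \<Longrightarrow> \<beta> \<bullet> \<beta> \<le> \<alpha> \<bullet> \<alpha>"
  by (simp add: short_roots_def norm_le)

lemma finite_Short: "finite Short"
  using finite_R by (simp add: short_roots_def)

lemma norm_refl: "norm (refl \<alpha> x) = norm x"
  by (simp add: norm_eq_sqrt_inner)

lemma refl_Short: "\<alpha> \<in> R \<Longrightarrow> \<beta> \<in> Short \<Longrightarrow> refl \<alpha> \<beta> \<in> Short"
  by (auto simp: short_roots_def refl_in_R norm_refl)

lemma minus_Short: "\<beta> \<in> Short \<Longrightarrow> - \<beta> \<in> Short"
  by (auto simp: short_roots_def)

lemma W_Short: "w \<in> W \<Longrightarrow> \<beta> \<in> Short \<Longrightarrow> w \<beta> \<in> Short"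
  by (induction rule: weyl_group.induct) (simp_all add: refl_Short)

lemma W_image_Short: "w \<in> W \<Longrightarrow> w ` Short = Short"
  using W_Short W_eq_iff by (intro endo_inj_surj finite_Short) (auto intro: inj_onI)

text \<open>Cauchy-Schwarz is strict, as \<beta> is no multiple of \<alpha>, and \<beta> is at most
  as long as \<alpha>. So the integral pairing is below 2 in absolute value.\<close>

lemma Short_coroot_cases:
  assumes b: "\<beta> \<in> Short" and a: "\<alpha> \<in> R" "\<beta> \<noteq> \<alpha>" "\<beta> \<noteq> - \<alpha>"
  shows "coroot \<alpha> \<bullet> \<beta> = -1 \<or> coroot \<alpha> \<bullet> \<beta> = 0 \<or> coroot \<alpha> \<bullet> \<beta> = 1"
proof -
  have an: "\<alpha> \<noteq> 0" using a root_nz by blast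
  have "\<not> norm \<alpha> *\<^sub>R \<beta> = norm \<beta> *\<^sub>R \<alpha>" "\<not> norm \<alpha> *\<^sub>R \<beta> = - norm \<beta> *\<^sub>R \<alpha>"
  proof -
    have *: "\<beta> = (norm \<beta> / norm \<alpha>) *\<^sub>R \<alpha>" if "norm \<alpha> *\<^sub>R \<beta> = norm \<beta> *\<^sub>R \<alpha>"
    proof -
      have "\<beta> = (1 / norm \<alpha>) *\<^sub>R (norm \<alpha> *\<^sub>R \<beta>)" using an by simp
      then show ?thesis using that by simp
    qed
    have **: "\<beta> = (- norm \<beta> / norm \<alpha>) *\<^sub>R \<alpha>" if "norm \<alpha> *\<^sub>R \<beta> = - norm \<beta> *\<^sub>R \<alpha>"
    proof -
      have "\<beta> = (1 / norm \<alpha>) *\<^sub>R (norm \<alpha> *\<^sub>R \<beta>)" using an by simp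
      then show ?thesis using that by simp
    qed
    have no: "\<beta> \<noteq> c *\<^sub>R \<alpha>" for c
      using scaled_root[of \<alpha> c] a Short_R[OF b] by auto
    show "\<not> norm \<alpha> *\<^sub>R \<beta> = norm \<beta> *\<^sub>R \<alpha>" "\<not> norm \<alpha> *\<^sub>R \<beta> = - norm \<beta> *\<^sub>R \<alpha>"
      using * ** no by blast+
  qed
  then have "\<bar>\<beta> \<bullet> \<alpha>\<bar> \<noteq> norm \<beta> * norm \<alpha>"
    using norm_cauchy_schwarz_abs_eq[of \<alpha> \<beta>] by (simp only: inner_commute mult.commute) blast
  then have "\<bar>\<beta> \<bullet> \<alpha>\<bar> < norm \<beta> * norm \<alpha>"
    using Cauchy_Schwarz_ineq2[of \<beta> \<alpha>] by linarith
  also have "norm \<beta> * norm \<alpha> \<le> norm \<alpha> * norm \<alpha>"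
    using b a by (intro mult_right_mono) (auto simp: short_roots_def)
  also have "\<dots> = \<alpha> \<bullet> \<alpha>"
    by (simp add: power2_norm_eq_inner[symmetric] power2_eq_square)
  finally have lt: "\<bar>coroot \<alpha> \<bullet> \<beta>\<bar> < 2"
    using an by (simp add: coroot_inner abs_mult field_simps)
  obtain k where k: "coroot \<alpha> \<bullet> \<beta> = of_int k"
    using coroot_inner_Ints[OF a(1) Short_R[OF b]] by (auto elim: Ints_cases)
  then have "\<bar>k\<bar> < 2" using lt by linarith
  then have "k = -1 \<or> k = 0 \<or> k = 1" by linarith
  then show ?thesis using k by auto
qed

lemma Short_coroot_pos:
  assumes "\<beta> \<in> Short" "\<alpha> \<in> R" "\<beta> \<noteq> \<alpha>" "\<beta> \<noteq> - \<alpha>" "\<beta> \<bullet> \<alpha> > 0"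
  shows "coroot \<alpha> \<bullet> \<beta> = 1"
  using Short_coroot_cases[OF assms(1-4)] coroot_pos_iff[of \<alpha> \<beta>] root_nz[OF assms(2)] assms(5) by auto

lemma Short_coroot_neg:
  assumes "\<beta> \<in> Short" "\<alpha> \<in> R" "\<beta> \<noteq> \<alpha>" "\<beta> \<noteq> - \<alpha>" "\<beta> \<bullet> \<alpha> < 0"
  shows "coroot \<alpha> \<bullet> \<beta> = -1"
  using Short_coroot_cases[OF assms(1-4)] coroot_neg_iff[of \<alpha> \<beta>] root_nz[OF assms(2)] assms(5) by auto

lemma refl_coroot_minus_one: "coroot \<alpha> \<bullet> \<beta> = -1 \<Longrightarrow> refl \<alpha> \<beta> = \<beta> + \<alpha>"
  by (simp add: refl_coroot_eq)

lemma refl_coroot_one: "coroot \<alpha> \<bullet> \<beta> = 1 \<Longrightarrow> refl \<alpha> \<beta> = \<beta> - \<alpha>"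
  by (simp add: refl_coroot_eq)

text \<open>A reflection in a simple root of one block preserves the span of that block and fixes
  the span of the other, so the induction never mixes the two.\<close>

lemma span_decomposition_Pos:
  assumes Z: "Z \<subseteq> P" and orth: "\<And>z y. z \<in> Z \<Longrightarrow> y \<in> P - Z \<Longrightarrow> z \<bullet> y = 0" and b: "\<beta> \<in> Pos"
  shows "\<beta> \<in> span Z \<or> \<beta> \<in> span (P - Z)"
  using b
proof (induction rule: Pos_induct)
  case (simple \<alpha>)
  then show ?case using span_base by (cases "\<alpha> \<in> Z") auto
next
  case (step \<beta> \<alpha>)
  have key: "\<beta> \<in> span V" if V: "refl \<alpha> \<beta> \<in> span V" "\<alpha> \<in> V \<or> (\<forall>v\<in>V. \<alpha> \<bullet> v = 0)" for V
  proof (cases "\<alpha> \<in> V")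
    case True
    have "refl \<alpha> \<beta> - (coroot \<alpha> \<bullet> refl \<alpha> \<beta>) *\<^sub>R \<alpha> \<in> span V"
      using V(1) True by (simp add: span_diff span_scale span_base)
    then show ?thesis by (simp only: refl_coroot_eq[symmetric] refl_refl)
  next
    case False
    then have "\<alpha> \<bullet> refl \<alpha> \<beta> = 0"
      using orthogonal_to_span[OF V(1), of \<alpha>] V(2) by (auto simp: orthogonal_def)
    then have "refl \<alpha> \<beta> - (coroot \<alpha> \<bullet> refl \<alpha> \<beta>) *\<^sub>R \<alpha> = refl \<alpha> \<beta>"
      by (simp add: coroot_inner inner_commute)
    then show ?thesis using V(1) by (simp only: refl_coroot_eq[symmetric] refl_refl)
  qed
  have "\<alpha> \<in> Z \<Longrightarrow> \<forall>v\<in>P - Z. \<alpha> \<bullet> v = 0" "\<alpha> \<notin> Z \<Longrightarrow> \<forall>v\<in>Z. \<alpha> \<bullet> v = 0"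
    using orth[of \<alpha>] orth[of _ \<alpha>] step.hyps(2) by (metis DiffI inner_commute)+
  then show ?case
    using step.IH key[of Z] key[of "P - Z"] step.hyps(2) by blast
qed

end

section \<open>Irreducibility and the dominant short root\<close>

locale irreducible_root_system = based_root_system +
  fixes \<theta> :: 'a
  assumes irr: "irreducible_rs R" and theta_Short: "\<theta> \<in> Short" and theta_dominant: "dominant P \<theta>"
begin

lemma theta_R: "\<theta> \<in> R"
  by (rule Short_R[OF theta_Short])

lemma theta_Pos: "\<theta> \<in> Pos"
  by (rule dominant_root_Pos[OF theta_R theta_dominant])

text \<open>A splitting of P into orthogonal blocks would split R, by
  \<open>span_decomposition_Pos\<close>; this is the connectedness of the Dynkin diagram.\<close>

lemma base_connected:
  assumes Z: "Z \<subseteq> P" "Z \<noteq> {}" and orth: "\<And>z y. z \<in> Z \<Longrightarrow> y \<in> P - Z \<Longrightarrow> z \<bullet> y = 0"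
  shows "Z = P"
proof (rule ccontr)
  assume "Z \<noteq> P"
  then obtain y where y: "y \<in> P - Z" using Z by blast
  obtain z where z: "z \<in> Z" using Z by blast
  have spans: "\<beta> \<in> span Z \<or> \<beta> \<in> span (P - Z)" if "\<beta> \<in> R" for \<beta>
  proof (cases "\<beta> \<in> Pos")
    case False
    then have "- \<beta> \<in> Pos" using neg_Pos_iff that by blast
    then show ?thesis
      using span_decomposition_Pos[OF Z(1) orth, of "- \<beta>"] span_neg by fastforce
  qed (use span_decomposition_Pos[OF Z(1) orth] in blast)
  have o1: "y \<bullet> a = 0" if "y \<in> P - Z" "a \<in> span Z" for y a
    using orthogonal_to_span[OF that(2), of y] orth that(1) by (auto simp: orthogonal_def inner_commute)
  have o2: "a \<bullet> b = 0" if "a \<in> span Z" "b \<in> span (P - Z)" for a b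
    using orthogonal_to_span[OF that(2), of a] o1[OF _ that(1)] by (auto simp: orthogonal_def inner_commute)
  let ?A = "R \<inter> span Z" and ?B = "R - span Z"
  have "?A \<union> ?B = R" "?A \<inter> ?B = {}" by auto
  moreover have "?A \<noteq> {}"
    using z Z(1) P_R span_base by blast
  moreover have "y \<notin> span Z"
    using o1[OF y, of y] y root_nz[OF P_R, of y] by auto
  then have "?B \<noteq> {}" using y P_R by blast
  moreover have "\<forall>a\<in>?A. \<forall>b\<in>?B. a \<bullet> b = 0"
    using spans o2 by blast
  ultimately show False
    using irr unfolding irreducible_rs_def by blast
qed

text \<open>For z in the set Z of simple roots with coordinate 0, every term of
  \<open>x \<bullet> z\<close> is at most 0 while the sum is at least 0. So Z is orthogonal to the
  other simple roots; if it were nonempty, it would be P and x would be 0.\<close>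

lemma dominant_coord_pos:
  assumes d: "dominant P x" and nc: "nat_comb P x" "x \<noteq> 0" and a: "\<alpha> \<in> P"
  shows "coord x \<alpha> > 0"
proof (rule ccontr)
  assume "\<not> coord x \<alpha> > 0"
  define Z where "Z = {\<beta>\<in>P. coord x \<beta> = 0}"
  have "\<alpha> \<in> Z"
    using \<open>\<not> coord x \<alpha> > 0\<close> nat_comb_coord[OF nc(1), of \<alpha>] a by (simp add: Z_def)
  moreover have "z \<bullet> y = 0" if z: "z \<in> Z" and y: "y \<in> P - Z" for z y
  proof -
    have nonpos: "coord x \<beta> * (\<beta> \<bullet> z) \<le> 0" if "\<beta> \<in> P" for \<beta>
    proof (cases "\<beta> = z")
      case False
      then show ?thesis
        using simple_obtuse[of \<beta> z] nat_comb_coord[OF nc(1), of \<beta>] that z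
        by (simp add: Z_def mult_nonneg_nonpos)
    qed (use z in \<open>simp add: Z_def\<close>)
    have "x \<bullet> z = (\<Sum>\<beta>\<in>P. coord x \<beta> *\<^sub>R \<beta>) \<bullet> z"
      by (simp add: coord_expand)
    also have "\<dots> = (\<Sum>\<beta>\<in>P. coord x \<beta> * (\<beta> \<bullet> z))"
      by (simp add: inner_sum_left)
    finally have "x \<bullet> z = (\<Sum>\<beta>\<in>P. coord x \<beta> * (\<beta> \<bullet> z))" .
    moreover have "x \<bullet> z \<ge> 0"
      using d z by (simp add: dominant_def Z_def)
    ultimately have "(\<Sum>\<beta>\<in>P. - (coord x \<beta> * (\<beta> \<bullet> z))) \<le> 0"
      unfolding sum_negf by linarith
    moreover have "(\<Sum>\<beta>\<in>P. - (coord x \<beta> * (\<beta> \<bullet> z))) \<ge> 0"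
      using nonpos by (intro sum_nonneg) auto
    ultimately have "\<forall>\<beta>\<in>P. - (coord x \<beta> * (\<beta> \<bullet> z)) = 0"
      using nonpos sum_nonneg_eq_0_iff[OF finite_P, of "\<lambda>\<beta>. - (coord x \<beta> * (\<beta> \<bullet> z))"] by simp
    then show ?thesis
      using y by (auto simp: Z_def inner_commute)
  qed
  ultimately have "Z = P"
    using base_connected[of Z] by (auto simp: Z_def)
  then have "\<forall>\<beta>\<in>P. coord x \<beta> = 0" by (auto simp: Z_def)
  then show False
    using coord_expand[of x] nc(2) by simp
qed

text \<open>All coordinates of \<theta> are positive, so a second dominant short root would pair
  positively with \<theta>. Their difference would be a root, and since both have the same length,
  either sign of it contradicts dominance.\<close>

lemma dominant_Short_unique:
  assumes b: "\<beta> \<in> Short" "dominant P \<beta>" shows "\<beta> = \<theta>"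
proof (rule ccontr)
  assume ne: "\<beta> \<noteq> \<theta>"
  have bP: "\<beta> \<in> Pos" using dominant_root_Pos Short_R b by blast
  obtain \<alpha> where a: "\<alpha> \<in> P" "\<beta> \<bullet> \<alpha> > 0"
    using ex_simple_inner_pos[OF Pos_nat_comb[OF bP] Pos_nz[OF bP]] by blast
  have "\<beta> \<bullet> \<theta> = (\<Sum>\<gamma>\<in>P. coord \<theta> \<gamma> * (\<beta> \<bullet> \<gamma>))"
  proof -
    have "\<beta> \<bullet> \<theta> = \<beta> \<bullet> (\<Sum>\<gamma>\<in>P. coord \<theta> \<gamma> *\<^sub>R \<gamma>)" by (simp add: coord_expand)
    then show ?thesis by (simp add: inner_sum_right)
  qed
  moreover have "(\<Sum>\<gamma>\<in>P. coord \<theta> \<gamma> * (\<beta> \<bullet> \<gamma>)) > 0"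
  proof (rule sum_pos2[OF finite_P a(1)])
    show "0 < coord \<theta> \<alpha> * (\<beta> \<bullet> \<alpha>)"
      using dominant_coord_pos[OF theta_dominant Pos_nat_comb[OF theta_Pos] Pos_nz[OF theta_Pos] a(1)] a(2)
      by simp
    show "0 \<le> coord \<theta> \<gamma> * (\<beta> \<bullet> \<gamma>)" if "\<gamma> \<in> P" for \<gamma>
      using nat_comb_coord[OF Pos_nat_comb[OF theta_Pos], of \<gamma>] b(2) that by (simp add: dominant_def)
  qed
  ultimately have pos: "\<beta> \<bullet> \<theta> > 0" by simp
  have neq: "\<beta> \<noteq> - \<theta>"
    using bP not_both_Pos[OF theta_Pos] by auto
  have one: "coroot \<theta> \<bullet> \<beta> = 1"
    using Short_coroot_pos[OF b(1) theta_R ne neq pos] .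
  have eqn: "\<beta> \<bullet> \<beta> = \<theta> \<bullet> \<theta>"
    using Short_norm_le[OF b(1) theta_R] Short_norm_le[OF theta_Short Short_R[OF b(1)]] by simp
  have tt: "\<theta> \<bullet> \<theta> > 0" using root_nz[OF theta_R] by simp
  have half: "2 * (\<beta> \<bullet> \<theta>) = \<theta> \<bullet> \<theta>"
    using one tt by (simp add: coroot_inner)
  have "\<beta> - \<theta> \<in> R"
    using refl_in_R[OF theta_R Short_R[OF b(1)]] refl_coroot_one[OF one] by simp
  then have "\<beta> - \<theta> \<in> Pos \<or> \<theta> - \<beta> \<in> Pos"
    using neg_Pos_iff[of "\<beta> - \<theta>"] by auto
  then have "\<theta> \<bullet> (\<beta> - \<theta>) \<ge> 0 \<or> \<beta> \<bullet> (\<theta> - \<beta>) \<ge> 0"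
    using dominant_Pos_nonneg[OF theta_dominant] dominant_Pos_nonneg[OF b(2)] by blast
  then show False
    using half tt eqn by (auto simp: inner_diff_right inner_commute)
qed

text \<open>A short root that is not dominant pairs negatively with some simple \<alpha>. The value
  is -1 unless \<beta> = -\<alpha>, where it is -2; excluding that case excludes the jump across
  0.\<close>

lemma Short_ascend:
  assumes b: "\<beta> \<in> Short" "\<beta> \<noteq> \<theta>" "- \<beta> \<notin> P"
  obtains \<alpha> where "\<alpha> \<in> P" "coroot \<alpha> \<bullet> \<beta> = -1" "refl \<alpha> \<beta> = \<beta> + \<alpha>"
proof -
  obtain \<alpha> where a: "\<alpha> \<in> P" "\<beta> \<bullet> \<alpha> < 0"
    using dominant_Short_unique[OF b(1)] b(2) unfolding dominant_def by (meson not_le)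
  have "\<beta> \<noteq> \<alpha>" using a(2) inner_ge_zero[of \<alpha>] by (auto simp: not_less[symmetric])
  moreover have "\<beta> \<noteq> - \<alpha>" using a(1) b(3) by auto
  ultimately have "coroot \<alpha> \<bullet> \<beta> = -1"
    using Short_coroot_neg b(1) a P_R by blast
  then show thesis using that a(1) refl_coroot_minus_one by blast
qed

text \<open>F is generic because the same climb to \<theta> evaluates the q-multiplicities and the
  powers \<open>X ^ nneg \<mu>\<close>. The height bound is carried along so that the subtraction in
  the exponent is not truncated.\<close>

lemma Short_recursion_pos:
  fixes F :: "'a \<Rightarrow> int poly"
  assumes F: "\<And>\<mu> \<alpha>. \<alpha> \<in> P \<Longrightarrow> coroot \<alpha> \<bullet> \<mu> = -1 \<Longrightarrow> F \<mu> = [:0, 1:] * F (\<mu> + \<alpha>)"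
    and g: "\<gamma> \<in> Short" "\<gamma> \<in> Pos"
  shows "hgt \<gamma> \<le> hgt \<theta> \<and> F \<gamma> = [:0, 1:] ^ (hgt \<theta> - hgt \<gamma>) * F \<theta>"
proof -
  \<comment> \<open>Heights grow along the climb, so the induction runs on the distance to their
    maximum.\<close>
  define N where "N = Max (hgt ` Pos)"
  have N: "hgt \<beta> \<le> N" if "\<beta> \<in> Pos" for \<beta>
    using that finite_Pos by (auto simp: N_def)
  show ?thesis
    using g
  proof (induction "N - hgt \<gamma>" arbitrary: \<gamma> rule: less_induct)
    case less
    show ?case
    proof (cases "\<gamma> = \<theta>")
      case False
      have "- \<gamma> \<notin> P" using less.prems not_both_Pos P_Pos by blast
      then obtain \<alpha> where a: "\<alpha> \<in> P" "coroot \<alpha> \<bullet> \<gamma> = -1" "refl \<alpha> \<gamma> = \<gamma> + \<alpha>"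
        using Short_ascend less.prems(1) False by blast
      have "\<gamma> \<noteq> \<alpha>" using a coroot_self[OF root_nz[OF P_R[OF a(1)]]] by auto
      then have p: "\<gamma> + \<alpha> \<in> Pos" "\<gamma> + \<alpha> \<in> Short"
        using refl_simple_Pos[OF a(1) less.prems(2)] refl_Short[OF P_R[OF a(1)] less.prems(1)] a(3) by auto
      have "real (hgt (\<gamma> + \<alpha>)) = real (hgt \<gamma> + 1)"
        using less.prems p by (simp add: real_hgt Pos_nat_comb inner_add_right rhoc_simple[OF a(1)])
      then have h: "hgt (\<gamma> + \<alpha>) = hgt \<gamma> + 1" by linarith
      have "hgt (\<gamma> + \<alpha>) \<le> hgt \<theta> \<and> F (\<gamma> + \<alpha>) = [:0, 1:] ^ (hgt \<theta> - hgt (\<gamma> + \<alpha>)) * F \<theta>"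
        using less.hyps[OF _ p(2) p(1)] h N[OF p(1)] by simp
      moreover have "F \<gamma> = [:0, 1:] * F (\<gamma> + \<alpha>)" using F a by blast
      ultimately show ?thesis
        using h by (metis Suc_diff_le Suc_eq_plus1 Suc_leD diff_Suc_Suc mult.assoc power_Suc)
    qed simp
  qed
qed

text \<open>The climb of a negative short root stops at a negated short simple root, from where it
  would have to cross 0; hence the separate starting value c.\<close>

lemma Short_recursion_neg:
  fixes F :: "'a \<Rightarrow> int poly"
  assumes F: "\<And>\<mu> \<alpha>. \<alpha> \<in> P \<Longrightarrow> coroot \<alpha> \<bullet> \<mu> = -1 \<Longrightarrow> F \<mu> = [:0, 1:] * F (\<mu> + \<alpha>)"
    and c: "\<And>\<alpha>. \<alpha> \<in> P \<Longrightarrow> \<alpha> \<in> Short \<Longrightarrow> F (- \<alpha>) = c"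
    and g: "\<gamma> \<in> Pos" "\<gamma> \<in> Short"
  shows "F (- \<gamma>) = [:0, 1:] ^ (hgt \<gamma> - 1) * c"
  using g
proof (induction rule: Pos_induct)
  case (simple \<alpha>)
  then show ?case using c by (simp add: hgt_simple)
next
  case (step \<beta> \<alpha>)
  have "\<beta> \<noteq> - \<alpha>" using step.hyps not_both_Pos P_Pos by force
  then have one: "coroot \<alpha> \<bullet> \<beta> = 1"
    using Short_coroot_pos step.prems step.hyps P_R by blast
  then have r: "refl \<alpha> \<beta> = \<beta> - \<alpha>" by (rule refl_coroot_one)
  have "real (hgt \<beta>) = real (hgt (refl \<alpha> \<beta>) + 1)"
    using step.hyps by (simp add: real_hgt Pos_nat_comb) (simp add: r inner_diff_right rhoc_simple)
  then have h: "hgt \<beta> = hgt (refl \<alpha> \<beta>) + 1" by linarith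
  have "F (- \<beta>) = [:0, 1:] * F (- refl \<alpha> \<beta>)"
    using F[OF step.hyps(2), of "- \<beta>"] one by (simp add: r)
  also have "F (- refl \<alpha> \<beta>) = [:0, 1:] ^ (hgt (refl \<alpha> \<beta>) - 1) * c"
    using step.IH refl_Short[OF P_R[OF step.hyps(2)] step.prems] by blast
  also have "[:0, 1:] * ([:0, 1:] ^ (hgt (refl \<alpha> \<beta>) - 1) * c) = [:0, 1:] ^ (hgt \<beta> - 1) * c"
  proof -
    have "hgt \<beta> - 1 = Suc (hgt (refl \<alpha> \<beta>) - 1)"
      using h hgt_Pos[OF step.hyps(5)] by simp
    then show ?thesis by (simp only: power_Suc mult.assoc)
  qed
  finally show ?case .
qed

end

section \<open>The q-multiplicities of the short dominant root\<close>

context based_root_system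
begin

text \<open>The length of a shortest Weyl group element that carries the dominant vector of the
  orbit of \<mu> to \<mu>.\<close>

definition nneg :: "'a \<Rightarrow> nat" where "nneg \<mu> = card {\<gamma>\<in>Pos. \<gamma> \<bullet> \<mu> < 0}"

text \<open>The root \<alpha> stops pairing negatively, and the reflection permutes the other
  positive roots.\<close>

lemma nneg_refl:
  assumes a: "\<alpha> \<in> P" and m: "\<alpha> \<bullet> \<mu> < 0"
  shows "nneg \<mu> = Suc (nneg (refl \<alpha> \<mu>))"
proof -
  have am: "\<alpha> \<bullet> refl \<alpha> \<mu> > 0"
    using m by (simp add: inner_refl_left[symmetric] refl_simple_minus[OF a])
  have mem: "refl \<alpha> \<gamma> \<in> {\<gamma>\<in>Pos - {\<alpha>}. \<gamma> \<bullet> refl \<alpha> \<nu> < 0}" if "\<gamma> \<in> {\<gamma>\<in>Pos - {\<alpha>}. \<gamma> \<bullet> \<nu> < 0}" for \<gamma> \<nu>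
    using bij_betw_apply[OF refl_simple_bij[OF a], of \<gamma>] that by simp
  have bij: "bij_betw (refl \<alpha>) {\<gamma>\<in>Pos - {\<alpha>}. \<gamma> \<bullet> refl \<alpha> \<mu> < 0} {\<gamma>\<in>Pos - {\<alpha>}. \<gamma> \<bullet> \<mu> < 0}"
  proof (rule bij_betw_byWitness[where f' = "refl \<alpha>"])
    show "refl \<alpha> ` {\<gamma>\<in>Pos - {\<alpha>}. \<gamma> \<bullet> refl \<alpha> \<mu> < 0} \<subseteq> {\<gamma>\<in>Pos - {\<alpha>}. \<gamma> \<bullet> \<mu> < 0}"
      using mem[of _ "refl \<alpha> \<mu>"] by (intro image_subsetI) (simp only: refl_refl)
    show "refl \<alpha> ` {\<gamma>\<in>Pos - {\<alpha>}. \<gamma> \<bullet> \<mu> < 0} \<subseteq> {\<gamma>\<in>Pos - {\<alpha>}. \<gamma> \<bullet> refl \<alpha> \<mu> < 0}"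
      using mem[of _ \<mu>] by (intro image_subsetI)
  qed simp_all
  have "{\<gamma>\<in>Pos. \<gamma> \<bullet> \<mu> < 0} = insert \<alpha> {\<gamma>\<in>Pos - {\<alpha>}. \<gamma> \<bullet> \<mu> < 0}"
    using m P_Pos[OF a] by auto
  then have "nneg \<mu> = Suc (card {\<gamma>\<in>Pos - {\<alpha>}. \<gamma> \<bullet> \<mu> < 0})"
    using finite_Pos by (simp add: nneg_def)
  also have "card {\<gamma>\<in>Pos - {\<alpha>}. \<gamma> \<bullet> \<mu> < 0} = card {\<gamma>\<in>Pos - {\<alpha>}. \<gamma> \<bullet> refl \<alpha> \<mu> < 0}"
    using bij_betw_same_card[OF bij] by simp
  also have "{\<gamma>\<in>Pos - {\<alpha>}. \<gamma> \<bullet> refl \<alpha> \<mu> < 0} = {\<gamma>\<in>Pos. \<gamma> \<bullet> refl \<alpha> \<mu> < 0}"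
    using am by auto
  finally show ?thesis by (simp add: nneg_def)
qed

lemma nneg_dominant: "dominant P \<mu> \<Longrightarrow> nneg \<mu> = 0"
proof -
  assume d: "dominant P \<mu>"
  have "{\<gamma>\<in>Pos. \<gamma> \<bullet> \<mu> < 0} = {}"
    using dominant_Pos_nonneg[OF d] by (auto simp: inner_commute not_less)
  then show ?thesis unfolding nneg_def by (simp only: card.empty)
qed

lemma sum_Short_split: "(\<Sum>\<beta>\<in>Short. f \<beta>) = (\<Sum>\<gamma>\<in>Short \<inter> Pos. f \<gamma> + f (- \<gamma>))"
  for f :: "'a \<Rightarrow> 'b::comm_monoid_add"
proof -
  have eq: "Short = (Short \<inter> Pos) \<union> uminus ` (Short \<inter> Pos)"
  proof (intro set_eqI iffI)
    fix \<beta> assume b: "\<beta> \<in> Short"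
    show "\<beta> \<in> (Short \<inter> Pos) \<union> uminus ` (Short \<inter> Pos)"
    proof (cases "\<beta> \<in> Pos")
      case False
      then have "- \<beta> \<in> Short \<inter> Pos" using b neg_Pos_iff Short_R minus_Short by blast
      then show ?thesis by (metis UnI2 imageI minus_minus)
    qed (use b in blast)
  qed (use minus_Short in auto)
  have "(\<Sum>\<beta>\<in>Short. f \<beta>) = (\<Sum>\<beta>\<in>Short \<inter> Pos. f \<beta>) + (\<Sum>\<beta>\<in>uminus ` (Short \<inter> Pos). f \<beta>)"
  proof (subst eq, rule sum.union_disjoint)
    show "Short \<inter> Pos \<inter> uminus ` (Short \<inter> Pos) = {}"
      using R_split(2) by blast
  qed (simp_all add: finite_Short)
  also have "(\<Sum>\<beta>\<in>uminus ` (Short \<inter> Pos). f \<beta>) = (\<Sum>\<beta>\<in>Short \<inter> Pos. f (- \<beta>))"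
    by (subst sum.reindex) (auto intro: inj_onI)
  finally show ?thesis by (simp add: sum.distrib)
qed

end

context irreducible_root_system
begin

abbreviation l :: nat where "l \<equiv> card (P \<inter> Short)"

text \<open>This is the character of the short dominant module, l plus the sum of all e^\<beta>, in
  terms of alternating sums. For short \<beta> the vector rho + \<beta> is rho + \<theta>, or the
  reflection of rho in a simple root -\<beta>, or fixed by a simple reflection, and then it
  contributes 0. The middle case occurs l times with sign -1, which the first summand
  compensates.\<close>

lemma lusztig_q_theta:
  "lusztig_q R P \<theta> \<mu> = of_nat l * lusztig_q R P 0 \<mu> + (\<Sum>\<beta>\<in>Short. lusztig_q R P 0 (\<mu> - \<beta>))"
proof -
  let ?r = "rho R P" and ?y = "\<mu> + rho R P"
  have alt: "alt_q (?r + \<beta>) ?y = (if \<beta> = \<theta> then alt_q (?r + \<theta>) ?y else 0) - (if - \<beta> \<in> P then alt_q ?r ?y else 0)"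
    if b: "\<beta> \<in> Short" for \<beta>
  proof -
    consider "\<beta> = \<theta>" | "- \<beta> \<in> P" | "\<beta> \<noteq> \<theta>" "- \<beta> \<notin> P" by blast
    then show ?thesis
    proof cases
      case 1
      then have "- \<beta> \<notin> P" using theta_Pos not_both_Pos P_Pos by blast
      then show ?thesis using 1 by simp
    next
      case 2
      then have "\<beta> \<noteq> \<theta>" using theta_Pos not_both_Pos P_Pos by blast
      moreover have "refl (- \<beta>) ?r = ?r + \<beta>" using refl_rho[OF 2] by simp
      then have "alt_q (?r + \<beta>) ?y = - alt_q ?r ?y"
        using alt_q_refl_left[OF 2, of ?r ?y] by simp
      ultimately show ?thesis using 2 by simp
    next
      case 3
      then obtain \<alpha> where a: "\<alpha> \<in> P" "coroot \<alpha> \<bullet> \<beta> = -1"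
        using Short_ascend b by blast
      have "refl \<alpha> (?r + \<beta>) = ?r + \<beta>"
        by (simp add: refl_coroot_eq inner_add_right a rho_simple)
      then have "alt_q (?r + \<beta>) ?y = 0" using alt_q_fixed a(1) by blast
      then show ?thesis using 3 by simp
    qed
  qed
  have c: "card {\<beta>\<in>Short. - \<beta> \<in> P} = l"
    by (rule bij_betw_same_card[of uminus], rule bij_betw_byWitness[where f' = uminus])
       (auto intro: minus_Short)
  have "(\<Sum>\<beta>\<in>Short. lusztig_q R P 0 (\<mu> - \<beta>)) = (\<Sum>\<beta>\<in>Short. alt_q (?r + \<beta>) ?y)"
    by (rule sum_lusztig_q_0[OF finite_Short W_image_Short])
  also have "\<dots> = (\<Sum>\<beta>\<in>Short. if \<beta> = \<theta> then alt_q (?r + \<theta>) ?y else 0) - (\<Sum>\<beta>\<in>Short. if - \<beta> \<in> P then alt_q ?r ?y else 0)"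
    by (subst sum_subtractf[symmetric], rule sum.cong) (auto simp: alt)
  also have "(\<Sum>\<beta>\<in>Short. if \<beta> = \<theta> then alt_q (?r + \<theta>) ?y else 0) = alt_q (?r + \<theta>) ?y"
    using finite_Short theta_Short by simp
  also have "(\<Sum>\<beta>\<in>Short. if - \<beta> \<in> P then alt_q ?r ?y else 0) = (\<Sum>\<beta>\<in>{\<beta>\<in>Short. - \<beta> \<in> P}. alt_q ?r ?y)"
    by (rule sum.inter_filter[OF finite_Short, symmetric])
  also have "\<dots> = of_nat l * alt_q ?r ?y"
    by (simp add: c)
  finally show ?thesis
    by (simp add: lusztig_q_alt_q add.commute)
qed

section \<open>The q-multiplicities at short weights in terms of heights\<close>

abbreviation X :: "int poly" where "X \<equiv> [:0, 1:]"
abbreviation m0 :: "int poly" where "m0 \<equiv> lusztig_q R P \<theta> 0"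

definition A_poly :: "int poly" where
  "A_poly = (\<Sum>\<gamma>\<in>Short \<inter> Pos. X ^ (hgt \<gamma> - 1))"

text \<open>The two exponents are \<open>nneg \<gamma>\<close> and \<open>nneg (- \<gamma>)\<close>
  written by heights (\<open>B_poly_nneg\<close>). The form by heights serves the comparison of
  degrees, the form by \<open>nneg\<close> the product formula.\<close>

definition B_poly :: "int poly" where
  "B_poly = (\<Sum>\<gamma>\<in>Short \<inter> Pos. X ^ (hgt \<theta> - hgt \<gamma>) + X ^ (hgt \<theta> + hgt \<gamma> - 1))"

lemma dominant_0: "dominant P 0"
  by (simp add: dominant_def)

text \<open>These are the summands of \<open>lusztig_q_theta\<close> at weight 0. The factor X - 1
  is the value at a negated simple root, coming from the values 1 at 0 and 0 at the simple
  root.\<close>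

lemma lusztig_q_0_Short:
  assumes "\<gamma> \<in> Short" "\<gamma> \<in> Pos"
  shows "lusztig_q R P 0 \<gamma> = 0" "lusztig_q R P 0 (- \<gamma>) = X ^ (hgt \<gamma> - 1) * (X - 1)"
proof -
  have above: "lusztig_q R P 0 \<kappa> = (if \<kappa> = 0 then 1 else 0)" if "nat_comb P \<kappa>" for \<kappa>
    using lusztig_q_above[OF dominant_0 that] by simp
  show "lusztig_q R P 0 \<gamma> = 0"
    using above[OF Pos_nat_comb[OF assms(2)]] Pos_nz[OF assms(2)] by simp
  have "lusztig_q R P 0 (- \<alpha>) = X - 1" if "\<alpha> \<in> P" for \<alpha>
    using lusztig_q_minus_simple[OF that, of 0] above[OF nat_comb_simple[OF that]] above[OF nat_comb_0]
      root_nz[OF P_R[OF that]] by simp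
  then show "lusztig_q R P 0 (- \<gamma>) = X ^ (hgt \<gamma> - 1) * (X - 1)"
    using Short_recursion_neg[of "lusztig_q R P 0" "X - 1" \<gamma>] lusztig_q_step assms by blast
qed

lemma lusztig_q_theta_0: "m0 = of_nat l + (X - 1) * A_poly"
proof -
  have "(\<Sum>\<beta>\<in>Short. lusztig_q R P 0 (0 - \<beta>)) = (\<Sum>\<gamma>\<in>Short \<inter> Pos. X ^ (hgt \<gamma> - 1) * (X - 1))"
    unfolding sum_Short_split by (rule sum.cong) (simp_all add: lusztig_q_0_Short)
  also have "\<dots> = (X - 1) * A_poly"
    by (simp only: A_poly_def sum_distrib_left mult.commute)
  finally show ?thesis
    using lusztig_q_theta[of 0] lusztig_q_above[OF dominant_0 nat_comb_0] by simp
qed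

lemma lusztig_q_theta_theta: "lusztig_q R P \<theta> \<theta> = 1"
  using lusztig_q_above[OF theta_dominant nat_comb_0] by simp

text \<open>Positive roots climb to \<theta>, where the value is 1. Negative roots climb to a
  negated simple root, whose value involves m0 by \<open>lusztig_q_minus_simple\<close>.\<close>

lemma lusztig_q_theta_Short:
  assumes "\<gamma> \<in> Short" "\<gamma> \<in> Pos"
  shows "lusztig_q R P \<theta> \<gamma> = X ^ (hgt \<theta> - hgt \<gamma>)"
    "lusztig_q R P \<theta> (- \<gamma>) = X ^ (hgt \<gamma> - 1) * (X ^ hgt \<theta> + (X - 1) * m0)"
proof -
  have pos: "hgt \<gamma> \<le> hgt \<theta> \<and> lusztig_q R P \<theta> \<gamma> = X ^ (hgt \<theta> - hgt \<gamma>)" if "\<gamma> \<in> Short" "\<gamma> \<in> Pos" for \<gamma>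
    using Short_recursion_pos[of "lusztig_q R P \<theta>" \<gamma>] lusztig_q_step that lusztig_q_theta_theta by auto
  then show "lusztig_q R P \<theta> \<gamma> = X ^ (hgt \<theta> - hgt \<gamma>)" using assms by blast
  have "lusztig_q R P \<theta> (- \<alpha>) = X ^ hgt \<theta> + (X - 1) * m0" if a: "\<alpha> \<in> P" "\<alpha> \<in> Short" for \<alpha>
  proof -
    have "lusztig_q R P \<theta> (- \<alpha>) = X * X ^ (hgt \<theta> - 1) - (1 - X) * m0"
      using lusztig_q_minus_simple[OF a(1), of \<theta>] pos[OF a(2) P_Pos[OF a(1)]] by (simp only: hgt_simple[OF a(1)])
    also have "X * X ^ (hgt \<theta> - 1) = X ^ hgt \<theta>"
      using hgt_Pos[OF theta_Pos] by (metis Suc_le_eq One_nat_def Suc_pred power_Suc)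
    finally show ?thesis by (simp only: left_diff_distrib) 
  qed
  then show "lusztig_q R P \<theta> (- \<gamma>) = X ^ (hgt \<gamma> - 1) * (X ^ hgt \<theta> + (X - 1) * m0)"
    using Short_recursion_neg[of "lusztig_q R P \<theta>" _ \<gamma>] lusztig_q_step assms by blast
qed

lemma hgt_le_theta: "\<gamma> \<in> Short \<Longrightarrow> \<gamma> \<in> Pos \<Longrightarrow> hgt \<gamma> \<le> hgt \<theta>"
  using Short_recursion_pos[of "lusztig_q R P \<theta>" \<gamma>] lusztig_q_step by blast

text \<open>The terms containing m0 add up to (X - 1) A m0, which \<open>lusztig_q_theta_0\<close>
  turns into (m0 - l) m0; the remaining ones make up B.\<close>

lemma sum_lusztig_q_Short:
  "(\<Sum>\<mu>\<in>Short. lusztig_q R P \<theta> \<mu>) = B_poly + (m0 - of_nat l) * m0"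
proof -
  have "(\<Sum>\<mu>\<in>Short. lusztig_q R P \<theta> \<mu>)
      = (\<Sum>\<gamma>\<in>Short \<inter> Pos. X ^ (hgt \<theta> - hgt \<gamma>) + X ^ (hgt \<gamma> - 1) * (X ^ hgt \<theta> + (X - 1) * m0))"
    unfolding sum_Short_split by (rule sum.cong) (simp_all add: lusztig_q_theta_Short)
  also have "\<dots> = (\<Sum>\<gamma>\<in>Short \<inter> Pos. (X ^ (hgt \<theta> - hgt \<gamma>) + X ^ (hgt \<theta> + hgt \<gamma> - 1)) + X ^ (hgt \<gamma> - 1) * ((X - 1) * m0))"
  proof (rule sum.cong)
    fix \<gamma> assume "\<gamma> \<in> Short \<inter> Pos"
    then have "hgt \<theta> + hgt \<gamma> - 1 = hgt \<gamma> - 1 + hgt \<theta>" using hgt_Pos[of \<gamma>] by simp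
    then have "X ^ (hgt \<theta> + hgt \<gamma> - 1) = X ^ (hgt \<gamma> - 1) * X ^ hgt \<theta>" by (simp only: power_add)
    then show "X ^ (hgt \<theta> - hgt \<gamma>) + X ^ (hgt \<gamma> - 1) * (X ^ hgt \<theta> + (X - 1) * m0)
       = X ^ (hgt \<theta> - hgt \<gamma>) + X ^ (hgt \<theta> + hgt \<gamma> - 1) + X ^ (hgt \<gamma> - 1) * ((X - 1) * m0)"
      by (simp only: distrib_left add.assoc)
  qed simp
  also have "\<dots> = B_poly + A_poly * ((X - 1) * m0)"
    by (simp only: sum.distrib B_poly_def A_poly_def sum_distrib_right)
  also have "A_poly * ((X - 1) * m0) = (m0 - of_nat l) * m0"
  proof -
    have "(X - 1) * A_poly = m0 - of_nat l" by (subst lusztig_q_theta_0) simp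
    moreover have "A_poly * ((X - 1) * m0) = (X - 1) * A_poly * m0"
      by (simp only: mult_ac)
    ultimately show ?thesis by (simp only:)
  qed
  finally show ?thesis .
qed

text \<open>\<open>X ^ nneg \<mu>\<close> obeys the recursion of the q-multiplicities and has the
  same value at \<theta>. Only the crossing from \<alpha> to -\<alpha> differs: it yields a single
  factor X and no multiple of m0.\<close>

lemma B_poly_nneg: "B_poly = (\<Sum>\<beta>\<in>Short. X ^ nneg \<beta>)"
proof -
  have step: "X ^ nneg \<mu> = X * X ^ nneg (\<mu> + \<alpha>)" if "\<alpha> \<in> P" "coroot \<alpha> \<bullet> \<mu> = -1" for \<mu> \<alpha>
  proof -
    have "\<alpha> \<bullet> \<mu> < 0"
      using that coroot_neg_iff[OF root_nz[OF P_R[OF that(1)]], of \<mu>] by (simp add: inner_commute)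
    then have "nneg \<mu> = Suc (nneg (\<mu> + \<alpha>))"
      using nneg_refl[OF that(1)] refl_coroot_minus_one[OF that(2)] by simp
    then show ?thesis by simp
  qed
  have th: "nneg \<theta> = 0" by (rule nneg_dominant[OF theta_dominant])
  have pos: "X ^ nneg \<gamma> = X ^ (hgt \<theta> - hgt \<gamma>)" if "\<gamma> \<in> Short" "\<gamma> \<in> Pos" for \<gamma>
    using Short_recursion_pos[of "\<lambda>\<mu>. X ^ nneg \<mu>" \<gamma>] step that th by auto
  have simple: "X ^ nneg (- \<alpha>) = X ^ hgt \<theta>" if a: "\<alpha> \<in> P" "\<alpha> \<in> Short" for \<alpha>
  proof -
    have "\<alpha> \<bullet> (- \<alpha>) < 0" using root_nz[OF P_R[OF a(1)]] by simp
    then have "nneg (- \<alpha>) = Suc (nneg \<alpha>)"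
      using nneg_refl[OF a(1)] by (simp add: refl_minus refl_simple_minus[OF a(1)])
    then have "X ^ nneg (- \<alpha>) = X * X ^ (hgt \<theta> - 1)"
      using pos[OF a(2) P_Pos[OF a(1)]] by (simp only: power_Suc hgt_simple[OF a(1)])
    also have "\<dots> = X ^ hgt \<theta>"
      using hgt_Pos[OF theta_Pos] by (metis Suc_le_eq One_nat_def Suc_pred power_Suc)
    finally show ?thesis .
  qed
  have neg: "X ^ nneg (- \<gamma>) = X ^ (hgt \<theta> + hgt \<gamma> - 1)" if "\<gamma> \<in> Short" "\<gamma> \<in> Pos" for \<gamma>
  proof -
    have "X ^ nneg (- \<gamma>) = X ^ (hgt \<gamma> - 1) * X ^ hgt \<theta>"
      using Short_recursion_neg[of "\<lambda>\<mu>. X ^ nneg \<mu>" "X ^ hgt \<theta>" \<gamma>] step that simple by blast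
    moreover have "hgt \<theta> + hgt \<gamma> - 1 = hgt \<gamma> - 1 + hgt \<theta>" using hgt_Pos[of \<gamma>] that by simp
    ultimately show ?thesis by (simp only: power_add)
  qed
  show ?thesis
    unfolding sum_Short_split B_poly_def by (rule sum.cong) (simp_all add: pos neg)
qed

end

section \<open>Macdonald's product formula\<close>

context based_root_system
begin

text \<open>With e = \<open>exp (coroot \<alpha> \<bullet> v / 2)\<close> the factor of \<alpha> is
  e - t / e if \<open>\<alpha> \<bullet> \<beta> > 0\<close>, t e - 1 / e if
  \<open>\<alpha> \<bullet> \<beta> < 0\<close>, and otherwise the factor e - 1 / e of the Weyl
  denominator. Named coefficients let the product be expanded.\<close>

definition upper_coeff :: "real \<Rightarrow> 'a \<Rightarrow> 'a \<Rightarrow> real" where "upper_coeff t \<beta> \<alpha> = (if \<alpha> \<bullet> \<beta> < 0 then t else 1)"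
definition lower_coeff :: "real \<Rightarrow> 'a \<Rightarrow> 'a \<Rightarrow> real" where "lower_coeff t \<beta> \<alpha> = (if \<alpha> \<bullet> \<beta> > 0 then - t else - 1)"

text \<open>
  Up to the Weyl denominator, the product of these factors over the positive \<alpha> is Macdonald's
  product of (1 - t e^(-\<alpha>)) / (1 - e^(-\<alpha>)) over the coroots of all roots \<alpha> with \<alpha> \<bullet> \<beta> > 0; clearing the
  denominator avoids the singular v.
\<close>
definition root_factor :: "real \<Rightarrow> 'a \<Rightarrow> 'a \<Rightarrow> 'a \<Rightarrow> real" where
  "root_factor t \<beta> \<alpha> v = upper_coeff t \<beta> \<alpha> * exp (coroot \<alpha> \<bullet> v / 2) + lower_coeff t \<beta> \<alpha> * exp (- (coroot \<alpha> \<bullet> v / 2))"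

lemma root_factor_refl: "root_factor t \<beta> \<alpha> (refl \<gamma> v) = root_factor t (refl \<gamma> \<beta>) (refl \<gamma> \<alpha>) v"
  by (simp add: root_factor_def upper_coeff_def lower_coeff_def coroot_refl inner_refl_left)

lemma root_factor_minus: "root_factor t \<beta> (- \<alpha>) v = - root_factor t \<beta> \<alpha> v"
  by (simp add: root_factor_def upper_coeff_def lower_coeff_def coroot_minus)

definition macdonald_sum :: "real \<Rightarrow> 'a set \<Rightarrow> 'a \<Rightarrow> real" where
  "macdonald_sum t S v = (\<Sum>\<beta>\<in>S. \<Prod>\<alpha>\<in>Pos. root_factor t \<beta> \<alpha> v)"

text \<open>The reflection permutes the factors of the other positive roots, negates that of
  \<alpha>, and merely renames \<beta> within S.\<close>

lemma macdonald_sum_refl: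
  assumes a: "\<alpha> \<in> P" and S: "refl \<alpha> ` S = S"
  shows "macdonald_sum t S (refl \<alpha> v) = - macdonald_sum t S v"
proof -
  have one: "(\<Prod>\<gamma>\<in>Pos. root_factor t \<beta> \<gamma> (refl \<alpha> v)) = - (\<Prod>\<gamma>\<in>Pos. root_factor t (refl \<alpha> \<beta>) \<gamma> v)" for \<beta>
  proof -
    have "(\<Prod>\<gamma>\<in>Pos. root_factor t \<beta> \<gamma> (refl \<alpha> v)) = root_factor t (refl \<alpha> \<beta>) (refl \<alpha> \<alpha>) v * (\<Prod>\<gamma>\<in>Pos - {\<alpha>}. root_factor t (refl \<alpha> \<beta>) (refl \<alpha> \<gamma>) v)"
      by (simp only: root_factor_refl prod.remove[OF finite_Pos P_Pos[OF a]])
    also have "(\<Prod>\<gamma>\<in>Pos - {\<alpha>}. root_factor t (refl \<alpha> \<beta>) (refl \<alpha> \<gamma>) v) = (\<Prod>\<gamma>\<in>Pos - {\<alpha>}. root_factor t (refl \<alpha> \<beta>) \<gamma> v)"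
      by (rule prod.reindex_bij_betw[OF refl_simple_bij[OF a]])
    also have "root_factor t (refl \<alpha> \<beta>) (refl \<alpha> \<alpha>) v = - root_factor t (refl \<alpha> \<beta>) \<alpha> v"
      by (simp only: refl_simple_minus[OF a] root_factor_minus)
    finally show ?thesis
      by (simp only: prod.remove[OF finite_Pos P_Pos[OF a]] mult_minus_left)
  qed
  have "bij_betw (refl \<alpha>) S S"
    using S by (simp add: bij_betw_def inj_refl)
  then have "(\<Sum>\<beta>\<in>S. \<Prod>\<gamma>\<in>Pos. root_factor t (refl \<alpha> \<beta>) \<gamma> v) = macdonald_sum t S v"
    unfolding macdonald_sum_def by (rule sum.reindex_bij_betw)
  then show ?thesis
    by (simp add: macdonald_sum_def one sum_negf)
qed

lemma macdonald_sum_W: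
  assumes S: "\<And>\<alpha>. \<alpha> \<in> P \<Longrightarrow> refl \<alpha> ` S = S" and w: "w \<in> W"
  shows "macdonald_sum t S (w v) = of_int (weyl_sign P w) * macdonald_sum t S v"
  using w
proof (induction rule: W_simple_induct)
  case id
  show ?case using sign_id by (simp add: id_def)
next
  case (step \<alpha> w)
  have "macdonald_sum t S ((refl \<alpha> \<circ> w) v) = - macdonald_sum t S (w v)"
    using macdonald_sum_refl[OF step.hyps(1) S[OF step.hyps(1)]] by simp
  then show ?case
    by (simp only: step.IH sign_refl_left[OF step.hyps(2,1)] of_int_minus mult_minus_left)
qed

section \<open>Alternating sums of exponentials and the exponents of the Weyl denominator\<close>

definition alt_exp :: "'a \<Rightarrow> 'a \<Rightarrow> real" where
  "alt_exp \<mu> v = (\<Sum>w\<in>W. of_int (weyl_sign P w) * exp (\<mu> \<bullet> w v))"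

lemma alt_exp_refl:
  assumes a: "\<alpha> \<in> P" shows "alt_exp (refl \<alpha> \<mu>) v = - alt_exp \<mu> v"
proof -
  have "alt_exp (refl \<alpha> \<mu>) v = (\<Sum>w\<in>W. of_int (weyl_sign P (refl \<alpha> \<circ> w)) * exp (refl \<alpha> \<mu> \<bullet> (refl \<alpha> \<circ> w) v))"
    unfolding alt_exp_def by (rule sum.reindex_bij_betw[OF W_left_bij[OF P_R[OF a]], symmetric])
  also have "\<dots> = (\<Sum>w\<in>W. - (of_int (weyl_sign P w) * exp (\<mu> \<bullet> w v)))"
  proof (rule sum.cong)
    fix w assume w: "w \<in> W"
    show "of_int (weyl_sign P (refl \<alpha> \<circ> w)) * exp (refl \<alpha> \<mu> \<bullet> (refl \<alpha> \<circ> w) v) = - (of_int (weyl_sign P w) * exp (\<mu> \<bullet> w v))"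
      by (simp only: sign_refl_left[OF w a] o_apply inner_refl_refl of_int_minus mult_minus_left)
  qed simp
  finally show ?thesis by (simp only: alt_exp_def sum_negf)
qed

text \<open>The exponents that appear when the Weyl denominator of the dual root system, or
  \<open>macdonald_sum\<close>, is multiplied out.\<close>

definition half_weights :: "'a set" where
  "half_weights = (\<lambda>B. rhoc - (\<Sum>\<gamma>\<in>B. coroot \<gamma>)) ` Pow Pos"

lemma finite_half_weights: "finite half_weights"
  by (simp add: half_weights_def finite_Pos)

text \<open>Besides permuting the other coroots, the reflection toggles the membership of \<alpha>
  in B, because it takes rhoc to \<open>rhoc - coroot \<alpha>\<close>.\<close>

lemma half_weights_refl:
  assumes a: "\<alpha> \<in> P" and m: "\<mu> \<in> half_weights" shows "refl \<alpha> \<mu> \<in> half_weights"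
proof -
  obtain B where B: "B \<subseteq> Pos" "\<mu> = rhoc - (\<Sum>\<gamma>\<in>B. coroot \<gamma>)"
    using m by (auto simp: half_weights_def)
  have fB: "finite B" using B finite_Pos finite_subset by blast
  have sub: "refl \<alpha> ` (B - {\<alpha>}) \<subseteq> Pos - {\<alpha>}"
    using B(1) by (intro image_subsetI bij_betw_apply[OF refl_simple_bij[OF a]]) auto
  have s: "(\<Sum>\<gamma>\<in>refl \<alpha> ` (B - {\<alpha>}). coroot \<gamma>) = (\<Sum>\<gamma>\<in>B - {\<alpha>}. refl \<alpha> (coroot \<gamma>))"
    by (simp add: sum.reindex[OF inj_refl] coroot_refl)
  have r: "refl \<alpha> \<mu> = rhoc - coroot \<alpha> - (\<Sum>\<gamma>\<in>B. refl \<alpha> (coroot \<gamma>))"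
    by (simp add: B(2) refl_diff refl_sum refl_rhoc[OF a])
  show ?thesis
  proof (cases "\<alpha> \<in> B")
    case True
    have "(\<Sum>\<gamma>\<in>B. refl \<alpha> (coroot \<gamma>)) = - coroot \<alpha> + (\<Sum>\<gamma>\<in>B - {\<alpha>}. refl \<alpha> (coroot \<gamma>))"
      using sum.remove[OF fB True, of "\<lambda>\<gamma>. refl \<alpha> (coroot \<gamma>)"]
      by (simp add: coroot_refl[symmetric] refl_simple_minus[OF a] coroot_minus)
    then have "refl \<alpha> \<mu> = rhoc - (\<Sum>\<gamma>\<in>refl \<alpha> ` (B - {\<alpha>}). coroot \<gamma>)"
      by (simp add: r s)
    then show ?thesis
      using sub by (auto simp: half_weights_def)
  next
    case False
    let ?C = "insert \<alpha> (refl \<alpha> ` (B - {\<alpha>}))"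
    have "(\<Sum>\<gamma>\<in>?C. coroot \<gamma>) = coroot \<alpha> + (\<Sum>\<gamma>\<in>B. refl \<alpha> (coroot \<gamma>))"
      using sub fB False s by (subst sum.insert) auto
    then have "refl \<alpha> \<mu> = rhoc - (\<Sum>\<gamma>\<in>?C. coroot \<gamma>)"
      by (simp add: r diff_diff_eq)
    moreover have "?C \<subseteq> Pos" using sub P_Pos[OF a] by blast
    ultimately show ?thesis by (auto simp: half_weights_def)
  qed
qed

text \<open>Pairings with simple roots are integers and that of rhoc is 1, so positivity makes the
  subtracted sum k antidominant. As k is a sum of positive coroots, \<open>k \<bullet> k\<close> is
  at most 0.\<close>

lemma half_weights_strictly_dominant:
  assumes m: "\<mu> \<in> half_weights" and pos: "\<And>\<alpha>. \<alpha> \<in> P \<Longrightarrow> \<mu> \<bullet> \<alpha> > 0"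
  shows "\<mu> = rhoc"
proof -
  obtain B where B: "B \<subseteq> Pos" "\<mu> = rhoc - (\<Sum>\<gamma>\<in>B. coroot \<gamma>)"
    using m by (auto simp: half_weights_def)
  let ?k = "\<Sum>\<gamma>\<in>B. coroot \<gamma>"
  have k: "- ?k \<bullet> \<alpha> \<ge> 0" if a: "\<alpha> \<in> P" for \<alpha>
  proof -
    have "?k \<bullet> \<alpha> \<in> \<int>"
      unfolding inner_sum_left using B(1) P_R[OF a] Pos_R by (intro Ints_sum coroot_inner_Ints) auto
    then obtain i where i: "?k \<bullet> \<alpha> = of_int i" by (auto elim: Ints_cases)
    have "?k \<bullet> \<alpha> < 1"
      using pos[OF a] rhoc_simple[OF a] by (simp add: B(2) inner_diff_left)
    then have "i < 1" using i by linarith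
    then show ?thesis using i by simp
  qed
  have "coroot \<gamma> \<bullet> ?k \<le> 0" if "\<gamma> \<in> B" for \<gamma>
  proof -
    have g: "\<gamma> \<in> Pos" using that B by blast
    have "- ?k \<bullet> \<gamma> \<ge> 0"
      by (rule nat_comb_inner_nonneg[OF Pos_nat_comb[OF g] k])
    then have "\<not> coroot \<gamma> \<bullet> ?k > 0"
      unfolding coroot_pos_iff[OF Pos_nz[OF g]] by simp
    then show ?thesis by simp
  qed
  then have "?k \<bullet> ?k \<le> 0"
    unfolding inner_sum_left[of coroot B ?k] by (rule sum_nonpos)
  then have "?k = 0"
    using inner_ge_zero[of ?k] by (metis antisym inner_eq_zero_iff)
  then show ?thesis by (simp add: B(2))
qed

text \<open>Simple reflections negate the alternating sum and raise the weight inside a finite set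
  until it is dominant. On a wall the sum is its own negative; off the walls the weight is
  rhoc.\<close>

lemma alt_exp_half_weights:
  assumes "\<mu> \<in> half_weights" shows "\<exists>k. \<forall>v. alt_exp \<mu> v = k * alt_exp rhoc v"
  using assms
proof (induction "card {\<nu>\<in>half_weights. rho R P \<bullet> \<mu> < rho R P \<bullet> \<nu>}" arbitrary: \<mu> rule: less_induct)
  case less
  show ?case
  proof (cases "\<exists>\<alpha>\<in>P. \<mu> \<bullet> \<alpha> < 0")
    case True
    then obtain \<alpha> where a: "\<alpha> \<in> P" "\<mu> \<bullet> \<alpha> < 0" by blast
    let ?m = "refl \<alpha> \<mu>"
    have m: "?m \<in> half_weights" using half_weights_refl a less.prems by blast
    have up: "rho R P \<bullet> \<mu> < rho R P \<bullet> ?m"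
      using mult_neg_pos[OF _ rho_simple_pos[OF a(1)]] coroot_neg_iff[OF root_nz[OF P_R[OF a(1)]], of \<mu>] a(2)
      by (simp add: refl_coroot_eq inner_diff_right)
    have "{\<nu>\<in>half_weights. rho R P \<bullet> ?m < rho R P \<bullet> \<nu>} \<subset> {\<nu>\<in>half_weights. rho R P \<bullet> \<mu> < rho R P \<bullet> \<nu>}"
    proof (rule psubsetI)
      show "{\<nu>\<in>half_weights. rho R P \<bullet> ?m < rho R P \<bullet> \<nu>} \<subseteq> {\<nu>\<in>half_weights. rho R P \<bullet> \<mu> < rho R P \<bullet> \<nu>}"
        using up by auto
      have "?m \<in> {\<nu>\<in>half_weights. rho R P \<bullet> \<mu> < rho R P \<bullet> \<nu>}" "?m \<notin> {\<nu>\<in>half_weights. rho R P \<bullet> ?m < rho R P \<bullet> \<nu>}"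
        using up m by simp_all
      then show "{\<nu>\<in>half_weights. rho R P \<bullet> ?m < rho R P \<bullet> \<nu>} \<noteq> {\<nu>\<in>half_weights. rho R P \<bullet> \<mu> < rho R P \<bullet> \<nu>}"
        by metis
    qed
    then have "card {\<nu>\<in>half_weights. rho R P \<bullet> ?m < rho R P \<bullet> \<nu>} < card {\<nu>\<in>half_weights. rho R P \<bullet> \<mu> < rho R P \<bullet> \<nu>}"
      using finite_half_weights by (intro psubset_card_mono) auto
    then obtain k where "\<forall>v. alt_exp ?m v = k * alt_exp rhoc v"
      using less.hyps m by blast
    then have "\<forall>v. alt_exp \<mu> v = (- k) * alt_exp rhoc v"
      using alt_exp_refl[OF a(1), of \<mu>] by (metis minus_minus mult_minus_left)
    then show ?thesis by blast
  next
    case dom: False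
    show ?thesis
    proof (cases "\<exists>\<alpha>\<in>P. \<mu> \<bullet> \<alpha> = 0")
      case True
      then obtain \<alpha> where a: "\<alpha> \<in> P" "\<mu> \<bullet> \<alpha> = 0" by blast
      then have "refl \<alpha> \<mu> = \<mu>" by (simp add: refl_coroot_eq')
      then have "\<forall>v. alt_exp \<mu> v = 0 * alt_exp rhoc v"
        using alt_exp_refl[OF a(1), of \<mu>] by simp
      then show ?thesis by blast
    next
      case False
      then have "\<And>\<alpha>. \<alpha> \<in> P \<Longrightarrow> \<mu> \<bullet> \<alpha> > 0"
        using dom by (meson linorder_less_linear)
      then have "\<mu> = rhoc" using half_weights_strictly_dominant less.prems by blast
      then show ?thesis by (intro exI[of _ 1]) simp
    qed
  qed
qed

text \<open>A collects the roots whose factor contributes its first exponential; the others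
  contribute the coroots subtracted from rhoc.\<close>

lemma macdonald_sum_expand:
  "macdonald_sum t S v = (\<Sum>A\<in>Pow Pos. (\<Sum>\<beta>\<in>S. (\<Prod>\<alpha>\<in>A. upper_coeff t \<beta> \<alpha>) * (\<Prod>\<alpha>\<in>Pos - A. lower_coeff t \<beta> \<alpha>)) *
      exp ((rhoc - (\<Sum>\<gamma>\<in>Pos - A. coroot \<gamma>)) \<bullet> v))"
proof -
  have e: "(\<Prod>\<alpha>\<in>A. exp (coroot \<alpha> \<bullet> v / 2)) * (\<Prod>\<alpha>\<in>Pos - A. exp (- (coroot \<alpha> \<bullet> v / 2)))
      = exp ((rhoc - (\<Sum>\<gamma>\<in>Pos - A. coroot \<gamma>)) \<bullet> v)" if A: "A \<subseteq> Pos" for A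
  proof -
    have fA: "finite A" using A finite_Pos finite_subset by blast
    have "(\<Sum>\<gamma>\<in>Pos. coroot \<gamma> \<bullet> v) = (\<Sum>\<gamma>\<in>Pos - A. coroot \<gamma> \<bullet> v) + (\<Sum>\<gamma>\<in>A. coroot \<gamma> \<bullet> v)"
      by (rule sum.subset_diff[OF A finite_Pos])
    then have "(\<Sum>\<alpha>\<in>A. coroot \<alpha> \<bullet> v / 2) + (\<Sum>\<alpha>\<in>Pos - A. - (coroot \<alpha> \<bullet> v / 2)) = (rhoc - (\<Sum>\<gamma>\<in>Pos - A. coroot \<gamma>)) \<bullet> v"
      by (simp add: rhoc_def inner_diff_left inner_sum_left sum_negf sum_divide_distrib[symmetric] field_simps)
    then show ?thesis
      using fA finite_Pos by (simp only: exp_sum[symmetric] finite_Diff exp_add[symmetric])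
  qed
  have "macdonald_sum t S v = (\<Sum>\<beta>\<in>S. \<Sum>A\<in>Pow Pos. ((\<Prod>\<alpha>\<in>A. upper_coeff t \<beta> \<alpha>) * (\<Prod>\<alpha>\<in>Pos - A. lower_coeff t \<beta> \<alpha>)) *
      exp ((rhoc - (\<Sum>\<gamma>\<in>Pos - A. coroot \<gamma>)) \<bullet> v))"
    unfolding macdonald_sum_def
  proof (intro sum.cong refl)
    fix \<beta>
    have "(\<Prod>\<alpha>\<in>Pos. root_factor t \<beta> \<alpha> v) = (\<Sum>A\<in>Pow Pos. (\<Prod>\<alpha>\<in>A. upper_coeff t \<beta> \<alpha> * exp (coroot \<alpha> \<bullet> v / 2)) *
        (\<Prod>\<alpha>\<in>Pos - A. lower_coeff t \<beta> \<alpha> * exp (- (coroot \<alpha> \<bullet> v / 2))))"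
      unfolding root_factor_def by (rule prod_add[OF finite_Pos])
    also have "\<dots> = (\<Sum>A\<in>Pow Pos. ((\<Prod>\<alpha>\<in>A. upper_coeff t \<beta> \<alpha>) * (\<Prod>\<alpha>\<in>Pos - A. lower_coeff t \<beta> \<alpha>)) *
        exp ((rhoc - (\<Sum>\<gamma>\<in>Pos - A. coroot \<gamma>)) \<bullet> v))"
      by (intro sum.cong refl) (simp add: prod.distrib e[symmetric])
    finally show "(\<Prod>\<alpha>\<in>Pos. root_factor t \<beta> \<alpha> v) = (\<Sum>A\<in>Pow Pos. ((\<Prod>\<alpha>\<in>A. upper_coeff t \<beta> \<alpha>) * (\<Prod>\<alpha>\<in>Pos - A. lower_coeff t \<beta> \<alpha>)) *
        exp ((rhoc - (\<Sum>\<gamma>\<in>Pos - A. coroot \<gamma>)) \<bullet> v))" .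
  qed
  also have "\<dots> = (\<Sum>A\<in>Pow Pos. \<Sum>\<beta>\<in>S. ((\<Prod>\<alpha>\<in>A. upper_coeff t \<beta> \<alpha>) * (\<Prod>\<alpha>\<in>Pos - A. lower_coeff t \<beta> \<alpha>)) *
      exp ((rhoc - (\<Sum>\<gamma>\<in>Pos - A. coroot \<gamma>)) \<bullet> v))"
    by (rule sum.swap)
  finally show ?thesis
    by (simp only: sum_distrib_right)
qed

text \<open>
  Averaging over W turns each exponential into an alternating sum, and the only weight of this
  shape that is regular is rhoc, up to the action of W.
\<close>
lemma macdonald_sum_multiple:
  assumes S: "\<And>\<alpha>. \<alpha> \<in> P \<Longrightarrow> refl \<alpha> ` S = S"
  shows "\<exists>C. \<forall>v. macdonald_sum t S v = C * alt_exp rhoc v"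
proof -
  define wt where "wt A = rhoc - (\<Sum>\<gamma>\<in>Pos - A. coroot \<gamma>)" for A
  define c where "c A = (\<Sum>\<beta>\<in>S. (\<Prod>\<alpha>\<in>A. upper_coeff t \<beta> \<alpha>) * (\<Prod>\<alpha>\<in>Pos - A. lower_coeff t \<beta> \<alpha>))" for A
  have wt: "wt A \<in> half_weights" for A
    by (auto simp: wt_def half_weights_def)
  obtain k where k: "\<And>A v. alt_exp (wt A) v = k A * alt_exp rhoc v"
    using alt_exp_half_weights[OF wt] by metis
  have ex: "macdonald_sum t S v = (\<Sum>A\<in>Pow Pos. c A * exp (wt A \<bullet> v))" for v
    by (simp add: macdonald_sum_expand c_def wt_def)
  have "real (card W) * macdonald_sum t S v = (\<Sum>A\<in>Pow Pos. c A * k A) * alt_exp rhoc v" for v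
  proof -
    have "of_int (weyl_sign P w) * macdonald_sum t S (w v) = macdonald_sum t S v" if "w \<in> W" for w
    proof -
      have "real_of_int (weyl_sign P w) * real_of_int (weyl_sign P w) = 1"
        by (simp only: of_int_mult[symmetric] sign_square of_int_1)
      then show ?thesis
        by (simp only: macdonald_sum_W[OF S that] mult.assoc[symmetric] mult_1_left)
    qed
    then have "real (card W) * macdonald_sum t S v = (\<Sum>w\<in>W. of_int (weyl_sign P w) * macdonald_sum t S (w v))"
      by simp
    also have "\<dots> = (\<Sum>w\<in>W. \<Sum>A\<in>Pow Pos. c A * (of_int (weyl_sign P w) * exp (wt A \<bullet> w v)))"
      by (simp only: ex sum_distrib_left mult.left_commute)
    also have "\<dots> = (\<Sum>A\<in>Pow Pos. \<Sum>w\<in>W. c A * (of_int (weyl_sign P w) * exp (wt A \<bullet> w v)))"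
      by (rule sum.swap)
    also have "\<dots> = (\<Sum>A\<in>Pow Pos. c A * alt_exp (wt A) v)"
      by (simp only: alt_exp_def sum_distrib_left)
    also have "\<dots> = (\<Sum>A\<in>Pow Pos. c A * k A) * alt_exp rhoc v"
      by (simp only: k sum_distrib_right mult.assoc)
    finally show ?thesis .
  qed
  moreover have "card W > 0"
    using finite_W weyl_group.id_in card_gt_0_iff by blast
  ultimately have "macdonald_sum t S v = ((\<Sum>A\<in>Pow Pos. c A * k A) / real (card W)) * alt_exp rhoc v" for v
    by (simp add: field_simps)
  then show ?thesis by blast
qed

text \<open>The height of the coroot with respect to the simple coroots, each of which pairs to 1
  with rho.\<close>

definition chgt :: "'a \<Rightarrow> nat" where "chgt \<gamma> = nat \<lfloor>coroot \<gamma> \<bullet> rho R P\<rfloor>"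

lemma coroot_rho_Ints: "\<gamma> \<in> Pos \<Longrightarrow> coroot \<gamma> \<bullet> rho R P \<in> \<int>"
proof (induction rule: Pos_induct)
  case (simple \<alpha>)
  then show ?case by (simp add: rho_simple)
next
  case (step \<beta> \<alpha>)
  have "coroot (refl \<alpha> \<beta>) \<bullet> rho R P = coroot \<beta> \<bullet> rho R P - coroot \<beta> \<bullet> \<alpha>"
    by (simp add: coroot_refl inner_refl_left refl_rho[OF step.hyps(2)] inner_diff_right)
  then have "coroot \<beta> \<bullet> rho R P = coroot (refl \<alpha> \<beta>) \<bullet> rho R P + coroot \<beta> \<bullet> \<alpha>" by simp
  moreover have "coroot \<beta> \<bullet> \<alpha> \<in> \<int>"
    using coroot_inner_Ints Pos_R P_R step.hyps by blast
  ultimately show ?case using step.IH by simp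
qed

lemma coroot_rho_pos: "\<gamma> \<in> Pos \<Longrightarrow> coroot \<gamma> \<bullet> rho R P > 0"
  using coroot_pos_iff[OF Pos_nz] pos_inner_Pos[OF rho_simple_pos Pos_nat_comb Pos_nz] by blast

lemma real_chgt: "\<gamma> \<in> Pos \<Longrightarrow> real (chgt \<gamma>) = coroot \<gamma> \<bullet> rho R P"
  using coroot_rho_pos[of \<gamma>] coroot_rho_Ints[of \<gamma>] by (auto simp: chgt_def elim!: Ints_cases)

lemma chgt_pos: "\<gamma> \<in> Pos \<Longrightarrow> chgt \<gamma> \<ge> 1"
  using real_chgt[of \<gamma>] coroot_rho_pos[of \<gamma>] by (cases "chgt \<gamma>") auto

lemma chgt_simple: "\<alpha> \<in> P \<Longrightarrow> chgt \<alpha> = 1"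
  by (simp add: chgt_def rho_simple)

text \<open>The choice v = -ln z rho turns \<open>exp (- (coroot \<alpha> \<bullet> v))\<close> into
  \<open>z ^ chgt \<alpha>\<close>. The prefactor does not involve \<beta> or S, so it cancels when
  two sets S are compared.\<close>

lemma macdonald_sum_principal:
  assumes z: "z > 0"
  shows "(\<Sum>\<beta>\<in>S. \<Prod>\<alpha>\<in>Pos. upper_coeff t \<beta> \<alpha> + lower_coeff t \<beta> \<alpha> * z ^ chgt \<alpha>)
    = (\<Prod>\<alpha>\<in>Pos. exp (- (coroot \<alpha> \<bullet> ((- ln z) *\<^sub>R rho R P) / 2))) * macdonald_sum t S ((- ln z) *\<^sub>R rho R P)"
proof -
  let ?v = "(- ln z) *\<^sub>R rho R P"
  have f: "exp (- (coroot \<alpha> \<bullet> ?v / 2)) * root_factor t \<beta> \<alpha> ?v = upper_coeff t \<beta> \<alpha> + lower_coeff t \<beta> \<alpha> * z ^ chgt \<alpha>" if a: "\<alpha> \<in> Pos" for \<alpha> \<beta>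
  proof -
    have "exp (- (coroot \<alpha> \<bullet> ?v / 2)) * exp (coroot \<alpha> \<bullet> ?v / 2) = 1"
      by (simp add: exp_add[symmetric])
    moreover have "exp (- (coroot \<alpha> \<bullet> ?v / 2)) * exp (- (coroot \<alpha> \<bullet> ?v / 2)) = z ^ chgt \<alpha>"
    proof -
      have "exp (- (coroot \<alpha> \<bullet> ?v / 2)) * exp (- (coroot \<alpha> \<bullet> ?v / 2)) = exp (real (chgt \<alpha>) * ln z)"
        by (simp add: exp_add[symmetric] real_chgt[OF a])
      also have "\<dots> = z ^ chgt \<alpha>"
        using z by (simp add: exp_of_nat_mult)
      finally show ?thesis .
    qed
    ultimately show ?thesis
      unfolding root_factor_def by (simp only: distrib_left mult.left_commute mult_1_right)
  qed
  show ?thesis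
    unfolding macdonald_sum_def sum_distrib_left prod.distrib[symmetric]
    by (intro sum.cong prod.cong refl f[symmetric])
qed

text \<open>
  The constant of proportionality is found by letting z tend to 0.
\<close>
lemma macdonald_identity:
  assumes S: "\<And>\<alpha>. \<alpha> \<in> P \<Longrightarrow> refl \<alpha> ` S = S" and z: "z > 0"
  shows "(\<Sum>\<beta>\<in>S. \<Prod>\<alpha>\<in>Pos. upper_coeff t \<beta> \<alpha> + lower_coeff t \<beta> \<alpha> * z ^ chgt \<alpha>) = (\<Sum>\<beta>\<in>S. t ^ nneg \<beta>) * (\<Prod>\<alpha>\<in>Pos. 1 - z ^ chgt \<alpha>)"
proof -
  have zero: "refl \<alpha> ` {0} = {0}" for \<alpha>
    by (simp add: linear_0[OF linear_refl])
  obtain C C0 where C: "\<And>v. macdonald_sum t S v = C * alt_exp rhoc v" "\<And>v. macdonald_sum t {0} v = C0 * alt_exp rhoc v"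
    using macdonald_sum_multiple[OF S, where t = t] macdonald_sum_multiple[OF zero, where t = t] by metis
  \<comment> \<open>The set {0} gives the Weyl denominator, which replaces
    \<open>alt_exp rhoc\<close> as the reference; C0 is nonzero because this product is positive for
    0 < z < 1.\<close>
  have den: "(\<Sum>\<beta>\<in>{0}. \<Prod>\<alpha>\<in>Pos. upper_coeff t \<beta> \<alpha> + lower_coeff t \<beta> \<alpha> * z ^ chgt \<alpha>) = (\<Prod>\<alpha>\<in>Pos. 1 - z ^ chgt \<alpha>)" for z
    by (simp add: upper_coeff_def lower_coeff_def)
  have pos: "(\<Prod>\<alpha>\<in>Pos. 1 - z ^ chgt \<alpha>) > 0" if "0 < z" "z < 1" for z :: real
    using that chgt_pos by (intro prod_pos) (simp add: power_less_one_iff Suc_le_eq)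
  have "C0 \<noteq> 0"
  proof
    assume "C0 = 0"
    then have "(\<Prod>\<alpha>\<in>Pos. 1 - (1/2::real) ^ chgt \<alpha>) = 0"
      using den[of "1/2"] macdonald_sum_principal[of "1/2" t "{0}"] C(2) by simp
    then show False using pos[of "1/2"] by simp
  qed
  then have quot: "macdonald_sum t S v = (C / C0) * macdonald_sum t {0} v" for v
    by (simp add: C)
  have main: "(\<Sum>\<beta>\<in>S. \<Prod>\<alpha>\<in>Pos. upper_coeff t \<beta> \<alpha> + lower_coeff t \<beta> \<alpha> * z ^ chgt \<alpha>) = (C / C0) * (\<Prod>\<alpha>\<in>Pos. 1 - z ^ chgt \<alpha>)"
    if "z > 0" for z
    unfolding den[symmetric] macdonald_sum_principal[OF that] quot by (simp only: mult.left_commute)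
  have "(\<Sum>\<beta>\<in>S. t ^ nneg \<beta>) = C / C0"
  proof -
    let ?f = "\<lambda>z::real. (\<Sum>\<beta>\<in>S. \<Prod>\<alpha>\<in>Pos. upper_coeff t \<beta> \<alpha> + lower_coeff t \<beta> \<alpha> * z ^ chgt \<alpha>) - (C / C0) * (\<Prod>\<alpha>\<in>Pos. 1 - z ^ chgt \<alpha>)"
    have "isCont ?f 0"
      by (intro continuous_intros)
    then have "(\<lambda>n. ?f (inverse (real (Suc n)))) \<longlonglongrightarrow> ?f 0"
      by (rule isCont_tendsto_compose[OF _ LIMSEQ_inverse_real_of_nat])
    moreover have "(\<lambda>n. ?f (inverse (real (Suc n)))) = (\<lambda>n. 0)"
      by (rule ext) (use main in simp)
    ultimately have lim: "(\<lambda>n. 0) \<longlonglongrightarrow> ?f 0"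
      by (simp only:)
    have "?f 0 = 0"
      by (rule LIMSEQ_unique[OF lim tendsto_const])
    \<comment> \<open>Coroot heights are at least 1, so at z = 0 only the upper coefficients
      survive.\<close>
    moreover have "(\<Prod>\<alpha>\<in>Pos. 1 - (0::real) ^ chgt \<alpha>) = 1"
      using chgt_pos by (intro prod.neutral) (auto simp: Suc_le_eq)
    moreover have "(\<Prod>\<alpha>\<in>Pos. upper_coeff t \<beta> \<alpha> + lower_coeff t \<beta> \<alpha> * 0 ^ chgt \<alpha>) = t ^ nneg \<beta>" for \<beta>
    proof -
      have "(\<Prod>\<alpha>\<in>Pos. upper_coeff t \<beta> \<alpha> + lower_coeff t \<beta> \<alpha> * 0 ^ chgt \<alpha>) = (\<Prod>\<alpha>\<in>Pos. if \<alpha> \<bullet> \<beta> < 0 then t else 1)"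
        using chgt_pos by (intro prod.cong) (auto simp: upper_coeff_def Suc_le_eq)
      also have "\<dots> = t ^ nneg \<beta>"
        by (simp add: prod.If_cases finite_Pos nneg_def Int_def)
      finally show ?thesis .
    qed
    ultimately show ?thesis by simp
  qed
  then show ?thesis using main[OF z] by simp
qed

end

section \<open>The product formula for the orbit of short roots\<close>

context irreducible_root_system
begin

definition Phi :: "'a set" where "Phi = {\<alpha>\<in>Pos. \<alpha> \<bullet> \<theta> > 0}"

text \<open>Take z = t in \<open>macdonald_identity\<close>. Any \<beta> other than \<theta> pairs
  negatively with a simple root, of coroot height 1, whose factor is t - t = 0. In the summand of
  \<theta> the roots orthogonal to \<theta> cancel against the denominator.\<close>

lemma short_orbit_product_formula:
  assumes t: "0 < t" "t < (1::real)"
  shows "(\<Sum>\<beta>\<in>Short. t ^ nneg \<beta>) * (\<Prod>\<alpha>\<in>Phi. 1 - t ^ chgt \<alpha>) = (\<Prod>\<alpha>\<in>Phi. 1 - t ^ (chgt \<alpha> + 1))"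
proof -
  have inv: "refl \<alpha> ` Short = Short" if "\<alpha> \<in> P" for \<alpha>
    using W_image_Short[OF refl_in_W[OF P_R[OF that]]] .
  have vanish: "(\<Prod>\<alpha>\<in>Pos. upper_coeff t \<beta> \<alpha> + lower_coeff t \<beta> \<alpha> * t ^ chgt \<alpha>) = 0" if b: "\<beta> \<in> Short" "\<beta> \<noteq> \<theta>" for \<beta>
  proof -
    obtain \<alpha> where a: "\<alpha> \<in> P" "\<beta> \<bullet> \<alpha> < 0"
      using dominant_Short_unique[OF b(1)] b(2) unfolding dominant_def by (meson not_le)
    then have "upper_coeff t \<beta> \<alpha> + lower_coeff t \<beta> \<alpha> * t ^ chgt \<alpha> = 0"
      by (simp add: upper_coeff_def lower_coeff_def chgt_simple inner_commute)
    then show ?thesis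
      using finite_Pos P_Pos[OF a(1)] by (meson prod_zero)
  qed
  have "(\<Sum>\<beta>\<in>Short. \<Prod>\<alpha>\<in>Pos. upper_coeff t \<beta> \<alpha> + lower_coeff t \<beta> \<alpha> * t ^ chgt \<alpha>) = (\<Prod>\<alpha>\<in>Pos. upper_coeff t \<theta> \<alpha> + lower_coeff t \<theta> \<alpha> * t ^ chgt \<alpha>)"
    using sum.remove[OF finite_Short theta_Short, of "\<lambda>\<beta>. \<Prod>\<alpha>\<in>Pos. upper_coeff t \<beta> \<alpha> + lower_coeff t \<beta> \<alpha> * t ^ chgt \<alpha>"] vanish
    by simp
  also have "\<dots> = (\<Prod>\<alpha>\<in>Pos - Phi. 1 - t ^ chgt \<alpha>) * (\<Prod>\<alpha>\<in>Phi. 1 - t ^ (chgt \<alpha> + 1))"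
  proof -
    have "(\<Prod>\<alpha>\<in>Pos. upper_coeff t \<theta> \<alpha> + lower_coeff t \<theta> \<alpha> * t ^ chgt \<alpha>) =
        (\<Prod>\<alpha>\<in>Pos - Phi. upper_coeff t \<theta> \<alpha> + lower_coeff t \<theta> \<alpha> * t ^ chgt \<alpha>) * (\<Prod>\<alpha>\<in>Phi. upper_coeff t \<theta> \<alpha> + lower_coeff t \<theta> \<alpha> * t ^ chgt \<alpha>)"
      by (rule prod.subset_diff) (auto simp: Phi_def finite_Pos)
    also have "(\<Prod>\<alpha>\<in>Pos - Phi. upper_coeff t \<theta> \<alpha> + lower_coeff t \<theta> \<alpha> * t ^ chgt \<alpha>) = (\<Prod>\<alpha>\<in>Pos - Phi. 1 - t ^ chgt \<alpha>)"
    proof (rule prod.cong)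
      fix \<alpha> assume "\<alpha> \<in> Pos - Phi"
      then have "\<alpha> \<bullet> \<theta> = 0"
        using dominant_Pos_nonneg[OF theta_dominant, of \<alpha>] by (auto simp: Phi_def inner_commute)
      then show "upper_coeff t \<theta> \<alpha> + lower_coeff t \<theta> \<alpha> * t ^ chgt \<alpha> = 1 - t ^ chgt \<alpha>" by (simp add: upper_coeff_def lower_coeff_def)
    qed simp
    also have "(\<Prod>\<alpha>\<in>Phi. upper_coeff t \<theta> \<alpha> + lower_coeff t \<theta> \<alpha> * t ^ chgt \<alpha>) = (\<Prod>\<alpha>\<in>Phi. 1 - t ^ (chgt \<alpha> + 1))"
      by (intro prod.cong) (auto simp: upper_coeff_def lower_coeff_def Phi_def)
    finally show ?thesis .
  qed
  finally have "(\<Sum>\<beta>\<in>Short. t ^ nneg \<beta>) * (\<Prod>\<alpha>\<in>Pos. 1 - t ^ chgt \<alpha>)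
      = (\<Prod>\<alpha>\<in>Pos - Phi. 1 - t ^ chgt \<alpha>) * (\<Prod>\<alpha>\<in>Phi. 1 - t ^ (chgt \<alpha> + 1))"
    using macdonald_identity[OF inv t(1), of t] by simp
  moreover have "(\<Prod>\<alpha>\<in>Pos. 1 - t ^ chgt \<alpha>) = (\<Prod>\<alpha>\<in>Pos - Phi. 1 - t ^ chgt \<alpha>) * (\<Prod>\<alpha>\<in>Phi. 1 - t ^ chgt \<alpha>)"
    by (rule prod.subset_diff) (auto simp: Phi_def finite_Pos)
  moreover have "(\<Prod>\<alpha>\<in>Pos - Phi. 1 - t ^ chgt \<alpha>) > 0"
    using t chgt_pos by (intro prod_pos) (simp add: power_less_one_iff Suc_le_eq)
  ultimately show ?thesis by simp
qed

end

section \<open>The Coxeter number and divisibility\<close>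

lemma X_power_monom: "[:0, 1::'a::comm_semiring_1:] ^ n = monom 1 n"
  by (simp add: monom_altdef)

lemma order_prod:
  fixes f :: "'b \<Rightarrow> 'a::idom poly"
  assumes "finite A" "\<And>x. x \<in> A \<Longrightarrow> f x \<noteq> 0"
  shows "order a (\<Prod>x\<in>A. f x) = (\<Sum>x\<in>A. order a (f x))"
  using assms by (induction A rule: finite_induct) (simp_all add: order_mult)

lemma one_minus_monom_nz: "n > 0 \<Longrightarrow> (1 :: complex poly) - monom 1 n \<noteq> 0"
proof -
  assume "n > 0"
  then have "coeff (1 - monom 1 n :: complex poly) 0 = 1" by simp
  then show ?thesis by (metis coeff_0 zero_neq_one)
qed

text \<open>The derivative is a nonzero multiple of z^(n - 1), which does not vanish at a root; so
  every root is simple.\<close>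

lemma order_one_minus_monom:
  fixes z :: complex
  assumes n: "n > 0" shows "order z (1 - monom 1 n) = (if z ^ n = 1 then 1 else 0)"
proof (cases "z ^ n = 1")
  case True
  have z: "z \<noteq> 0" using True n by (auto simp: power_0_left)
  have d: "poly (pderiv (1 - monom 1 n)) z \<noteq> 0"
    using z n by (simp add: pderiv_diff pderiv_monom poly_monom pderiv_1)
  have "order z (1 - monom 1 n) = Suc (order z (pderiv (1 - monom 1 n)))"
    using True one_minus_monom_nz[OF n] by (intro order_pderiv) (simp_all add: poly_monom)
  then show ?thesis using True order_0I[OF d] by simp
next
  case False
  then show ?thesis by (simp add: order_0I poly_monom)
qed

lemma complex_poly_eqI_unit_interval:
  fixes p q :: "complex poly"
  assumes "\<And>t::real. 0 < t \<Longrightarrow> t < 1 \<Longrightarrow> poly p (of_real t) = poly q (of_real t)"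
  shows "p = q"
proof (rule ccontr)
  assume "p \<noteq> q"
  then have "finite {x. poly (p - q) x = 0}" by (intro poly_roots_finite) simp
  moreover have "complex_of_real ` {0<..<1} \<subseteq> {x. poly (p - q) x = 0}"
    using assms by auto
  ultimately have "finite (complex_of_real ` {0<..<1})" by (rule rev_finite_subset)
  then have "finite {0<..<1::real}" by (rule finite_imageD) (auto intro: inj_onI)
  then show False using infinite_Ioo[of 0 "1::real"] by simp
qed

lemma one_minus_monom_dvd: "(1 - monom 1 h :: int poly) dvd monom 1 n - monom 1 (n mod h)"
proof -
  have "(monom 1 n :: int poly) = monom 1 (h * (n div h) + n mod h)" by simp
  also have "\<dots> = monom 1 h ^ (n div h) * monom 1 (n mod h)"
    by (simp only: monom_power mult_monom) simp
  finally have "(monom 1 n :: int poly) - monom 1 (n mod h) = - ((1 - monom 1 h ^ (n div h)) * monom 1 (n mod h))"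
    by (simp add: algebra_simps)
  also have "\<dots> = (1 - monom 1 h) * (- ((\<Sum>i<n div h. monom 1 h ^ i) * monom 1 (n mod h)))"
    by (simp only: one_diff_power_eq mult_minus_right mult.assoc)
  finally show ?thesis by (metis dvd_triv_left)
qed

text \<open>Reducing all exponents modulo h is division by 1 - X^h with integral remainder r. Over
  the complex numbers r has degree below h and vanishes at all h roots of unity, so it is 0; the
  factor 1 - X takes care of the root 1.\<close>

lemma dvd_of_roots_of_unity:
  fixes n :: "'b \<Rightarrow> nat"
  assumes S: "finite S" and h: "h > 0"
    and root: "\<And>z::complex. z ^ h = 1 \<Longrightarrow> z \<noteq> 1 \<Longrightarrow> (\<Sum>s\<in>S. z ^ n s) = 0"
  shows "(1 - monom 1 h :: int poly) dvd (1 - monom 1 1) * (\<Sum>s\<in>S. monom 1 (n s))"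
proof -
  define r :: "int poly" where "r = (\<Sum>s\<in>S. monom 1 (n s mod h) - monom 1 (Suc (n s) mod h))"
  define rc :: "complex poly" where "rc = (\<Sum>s\<in>S. monom 1 (n s mod h) - monom 1 (Suc (n s) mod h))"
  have "rc = 0"
  proof (rule ccontr)
    assume nz: "rc \<noteq> 0"
    have red: "z ^ (k mod h) = z ^ k" if "z ^ h = 1" for z :: complex and k
    proof -
      have "z ^ k = z ^ (h * (k div h) + k mod h)" by simp
      also have "\<dots> = z ^ (k mod h)" using that by (simp only: power_add power_mult) simp
      finally show ?thesis by simp
    qed
    have "poly rc z = 0" if z: "z ^ h = 1" for z
    proof -
      have "poly rc z = (\<Sum>s\<in>S. z ^ n s - z ^ Suc (n s))"
        by (simp only: rc_def poly_sum poly_diff poly_monom mult_1 red[OF z])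
      also have "\<dots> = (1 - z) * (\<Sum>s\<in>S. z ^ n s)"
        by (simp add: sum_distrib_left algebra_simps)
      also have "\<dots> = 0" using root[OF z] by (cases "z = 1") auto
      finally show ?thesis .
    qed
    then have "{z. z ^ h = 1} \<subseteq> {z. poly rc z = 0}" by blast
    then have "card {z::complex. z ^ h = 1} \<le> card {z. poly rc z = 0}"
      by (intro card_mono poly_roots_finite nz)
    also have "\<dots> \<le> degree rc" by (rule card_poly_roots_bound[OF nz])
    also have "\<dots> < h"
    proof -
      have "degree rc \<le> h - 1" unfolding rc_def
      proof (rule degree_sum_le[OF S])
        fix s
        have "n s mod h \<le> h - 1" "Suc (n s) mod h \<le> h - 1"
          using mod_less_divisor[OF h, of "n s"] mod_less_divisor[OF h, of "Suc (n s)"] by linarith+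
        then show "degree (monom 1 (n s mod h) - monom 1 (Suc (n s) mod h) :: complex poly) \<le> h - 1"
          by (intro degree_diff_le order_trans[OF degree_monom_le])
      qed
      then show ?thesis using h by simp
    qed
    finally show False using card_roots_unity_eq[OF h] by simp
  qed
  then have "of_int (coeff r i) = (0::complex)" for i
  proof -
    have "of_int (coeff r i) = coeff rc i"
      by (auto simp: r_def rc_def coeff_sum intro!: sum.cong)
    then show ?thesis using \<open>rc = 0\<close> by simp
  qed
  then have r0: "r = 0" by (simp add: poly_eq_iff)
  have "(1 - monom 1 1) * (\<Sum>s\<in>S. monom 1 (n s)) = (\<Sum>s\<in>S. (monom 1 (n s) - monom 1 (n s mod h)) - (monom 1 (Suc (n s)) - monom 1 (Suc (n s) mod h))) + r"
    by (simp add: r_def sum.distrib[symmetric] sum_distrib_left left_diff_distrib mult_monom)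
  then show ?thesis
    using r0 by (simp only: add_0_right) (intro dvd_sum dvd_diff one_minus_monom_dvd)
qed

section \<open>The Coxeter number as a coroot height\<close>

context irreducible_root_system
begin

text \<open>The sum of the orthogonal projections onto the lines of the roots, each line counted
  twice; hence its trace is \<open>card R\<close>.\<close>

definition casimir :: "'a \<Rightarrow> 'a" where
  "casimir x = (\<Sum>\<alpha>\<in>R. ((x \<bullet> \<alpha>) / (\<alpha> \<bullet> \<alpha>)) *\<^sub>R \<alpha>)"

lemma linear_casimir: "linear casimir"
  by (rule linearI)
     (simp_all add: casimir_def inner_add_left add_divide_distrib scaleR_add_left sum.distrib scaleR_sum_right)

lemma casimir_sym: "casimir x \<bullet> y = x \<bullet> casimir y"
  by (simp add: casimir_def inner_sum_left inner_sum_right inner_commute mult.commute)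

lemma casimir_refl:
  assumes g: "\<gamma> \<in> R" shows "casimir (refl \<gamma> x) = refl \<gamma> (casimir x)"
proof -
  have "bij_betw (refl \<gamma>) R R"
    by (rule bij_betw_byWitness[where f' = "refl \<gamma>"]) (auto simp: refl_in_R g)
  then have "casimir (refl \<gamma> x) = (\<Sum>\<alpha>\<in>R. ((refl \<gamma> x \<bullet> refl \<gamma> \<alpha>) / (refl \<gamma> \<alpha> \<bullet> refl \<gamma> \<alpha>)) *\<^sub>R refl \<gamma> \<alpha>)"
    unfolding casimir_def by (rule sum.reindex_bij_betw[symmetric])
  then show ?thesis
    by (simp add: casimir_def refl_sum refl_scaleR)
qed

text \<open>Each root is an eigenvector, because the reflection in it negates its image. By symmetry
  of the operator, roots that are not orthogonal share their eigenvalue, so two eigenvalues would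
  split R.\<close>

lemma casimir_scalar: "\<exists>c. \<forall>x. casimir x = c *\<^sub>R x"
proof -
  define c where "c \<alpha> = coroot \<alpha> \<bullet> casimir \<alpha> / 2" for \<alpha>
  have root: "casimir \<alpha> = c \<alpha> *\<^sub>R \<alpha>" if a: "\<alpha> \<in> R" for \<alpha>
  proof -
    have "refl \<alpha> (casimir \<alpha>) = - casimir \<alpha>"
      using casimir_refl[OF a, of \<alpha>] by (simp add: refl_self root_nz[OF a] linear_neg[OF linear_casimir])
    then have "2 *\<^sub>R casimir \<alpha> = (coroot \<alpha> \<bullet> casimir \<alpha>) *\<^sub>R \<alpha>"
      by (simp add: refl_coroot_eq scaleR_2 algebra_simps)
    then have "(1/2) *\<^sub>R (2 *\<^sub>R casimir \<alpha>) = (1/2) *\<^sub>R ((coroot \<alpha> \<bullet> casimir \<alpha>) *\<^sub>R \<alpha>)" by (simp only:)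
    then show ?thesis by (simp add: c_def)
  qed
  have same: "c \<alpha> = c \<beta>" if "\<alpha> \<in> R" "\<beta> \<in> R" "\<alpha> \<bullet> \<beta> \<noteq> 0" for \<alpha> \<beta>
    using casimir_sym[of \<alpha> \<beta>] root[OF that(1)] root[OF that(2)] that(3) by simp
  let ?A = "{\<alpha>\<in>R. c \<alpha> = c \<theta>}" and ?B = "{\<alpha>\<in>R. c \<alpha> \<noteq> c \<theta>}"
  have "?A \<union> ?B = R" "?A \<inter> ?B = {}" "?A \<noteq> {}" using theta_R by auto
  moreover have "\<forall>a\<in>?A. \<forall>b\<in>?B. a \<bullet> b = 0"
    using same by (metis (mono_tags, lifting) mem_Collect_eq)
  ultimately have "?B = {}"
    using irr unfolding irreducible_rs_def by blast
  then have "casimir \<alpha> = c \<theta> *\<^sub>R \<alpha>" if "\<alpha> \<in> R" for \<alpha>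
    using root[OF that] that by auto
  then have "casimir x = c \<theta> *\<^sub>R x" for x
    using linear_eq_on[OF linear_casimir linear_scale_self, of x R] by (simp add: span_R)
  then show ?thesis by blast
qed

lemma theta_coroot:
  assumes "\<alpha> \<in> Pos" "\<alpha> \<noteq> \<theta>" "\<alpha> \<bullet> \<theta> > 0" shows "coroot \<alpha> \<bullet> \<theta> = 1"
proof (rule Short_coroot_pos[OF theta_Short Pos_R[OF assms(1)]])
  show "\<theta> \<noteq> - \<alpha>" using assms(1) theta_Pos not_both_Pos by auto
qed (use assms in \<open>auto simp: inner_commute\<close>)

text \<open>The scalar c of \<open>casimir\<close> is computed twice: the trace gives the number of
  roots over the dimension, and the value at \<theta> gives
  \<open>1 + coroot \<theta> \<bullet> rho R P\<close>.\<close>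

lemma coxeter_number_chgt: "coxeter_number R = chgt \<theta> + 1"
proof -
  obtain c where c: "\<And>x. casimir x = c *\<^sub>R x" using casimir_scalar by blast
  have trace: "(\<Sum>b\<in>Basis. casimir b \<bullet> b) = real (card R)"
  proof -
    have "(\<Sum>b\<in>Basis. casimir b \<bullet> b) = (\<Sum>b\<in>Basis. \<Sum>\<alpha>\<in>R. ((b \<bullet> \<alpha>) * (b \<bullet> \<alpha>)) / (\<alpha> \<bullet> \<alpha>))"
      unfolding casimir_def inner_sum_left by (simp add: inner_commute)
    also have "\<dots> = (\<Sum>\<alpha>\<in>R. \<Sum>b\<in>Basis. ((b \<bullet> \<alpha>) * (b \<bullet> \<alpha>)) / (\<alpha> \<bullet> \<alpha>))"
      by (rule sum.swap)
    also have "\<dots> = (\<Sum>\<alpha>\<in>R. 1)"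
    proof (rule sum.cong)
      fix \<alpha> assume a: "\<alpha> \<in> R"
      have "(\<Sum>b\<in>Basis. ((b \<bullet> \<alpha>) * (b \<bullet> \<alpha>)) / (\<alpha> \<bullet> \<alpha>)) = (\<Sum>b\<in>Basis. (\<alpha> \<bullet> b) * (\<alpha> \<bullet> b)) / (\<alpha> \<bullet> \<alpha>)"
        by (simp add: sum_divide_distrib inner_commute)
      also have "\<dots> = 1"
        using root_nz[OF a] by (simp only: euclidean_inner[symmetric]) simp
      finally show "(\<Sum>b\<in>Basis. ((b \<bullet> \<alpha>) * (b \<bullet> \<alpha>)) / (\<alpha> \<bullet> \<alpha>)) = 1" .
    qed simp
    finally show ?thesis by simp
  qed
  have dim: "real (card R) = c * real DIM('a)"
    unfolding trace[symmetric] by (simp add: c inner_Basis)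
  have tt: "\<theta> \<bullet> \<theta> > 0" using root_nz[OF theta_R] by simp
  have "c * (\<theta> \<bullet> \<theta>) = (\<Sum>\<alpha>\<in>R. (\<theta> \<bullet> \<alpha>) * (\<theta> \<bullet> \<alpha>) / (\<alpha> \<bullet> \<alpha>))"
  proof -
    have "c * (\<theta> \<bullet> \<theta>) = casimir \<theta> \<bullet> \<theta>" by (simp add: c)
    then show ?thesis unfolding casimir_def inner_sum_left by (simp add: inner_commute)
  qed
  also have "\<dots> = (\<Sum>\<alpha>\<in>Pos. (\<theta> \<bullet> \<alpha>) * (\<theta> \<bullet> \<alpha>) / (\<alpha> \<bullet> \<alpha>)) + (\<Sum>\<alpha>\<in>uminus ` Pos. (\<theta> \<bullet> \<alpha>) * (\<theta> \<bullet> \<alpha>) / (\<alpha> \<bullet> \<alpha>))"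
    by (subst R_split(1), rule sum.union_disjoint) (simp_all add: finite_Pos R_split(2))
  also have "(\<Sum>\<alpha>\<in>uminus ` Pos. (\<theta> \<bullet> \<alpha>) * (\<theta> \<bullet> \<alpha>) / (\<alpha> \<bullet> \<alpha>)) = (\<Sum>\<alpha>\<in>Pos. (\<theta> \<bullet> \<alpha>) * (\<theta> \<bullet> \<alpha>) / (\<alpha> \<bullet> \<alpha>))"
    by (subst sum.reindex) (auto intro: inj_onI)
  \<comment> \<open>A positive \<alpha> other than \<theta> that is not orthogonal to \<theta> has
    \<open>coroot \<alpha> \<bullet> \<theta> = 1\<close>, so its term is half of
    \<open>\<alpha> \<bullet> \<theta>\<close>. The term of \<theta> is
    \<open>\<theta> \<bullet> \<theta>\<close>, twice as much as that rule would give.\<close>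
  also have "(\<Sum>\<alpha>\<in>Pos. (\<theta> \<bullet> \<alpha>) * (\<theta> \<bullet> \<alpha>) / (\<alpha> \<bullet> \<alpha>)) = (\<theta> \<bullet> \<theta>) / 2 + rho R P \<bullet> \<theta>"
  proof -
    have "(\<theta> \<bullet> \<alpha>) * (\<theta> \<bullet> \<alpha>) / (\<alpha> \<bullet> \<alpha>) = (1/2) * (\<alpha> \<bullet> \<theta>)" if a: "\<alpha> \<in> Pos - {\<theta>}" for \<alpha>
    proof (cases "\<alpha> \<bullet> \<theta> = 0")
      case False
      then have "\<alpha> \<bullet> \<theta> > 0"
        using dominant_Pos_nonneg[OF theta_dominant, of \<alpha>] a by (simp add: inner_commute)
      then have "coroot \<alpha> \<bullet> \<theta> = 1" using theta_coroot a by blast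
      then have "2 * (\<theta> \<bullet> \<alpha>) / (\<alpha> \<bullet> \<alpha>) = 1" by (simp only: coroot_inner)
      moreover have "(\<theta> \<bullet> \<alpha>) * (\<theta> \<bullet> \<alpha>) / (\<alpha> \<bullet> \<alpha>) = (1/2) * (\<theta> \<bullet> \<alpha>) * (2 * (\<theta> \<bullet> \<alpha>) / (\<alpha> \<bullet> \<alpha>))" by simp
      ultimately show ?thesis by (simp only: inner_commute[of \<alpha> \<theta>] mult_1_right)
    qed (simp add: inner_commute)
    then have "(\<Sum>\<alpha>\<in>Pos - {\<theta>}. (\<theta> \<bullet> \<alpha>) * (\<theta> \<bullet> \<alpha>) / (\<alpha> \<bullet> \<alpha>)) = (\<Sum>\<alpha>\<in>Pos - {\<theta>}. (1/2) * (\<alpha> \<bullet> \<theta>))"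
      by (rule sum.cong[OF refl])
    then have "(\<Sum>\<alpha>\<in>Pos. (\<theta> \<bullet> \<alpha>) * (\<theta> \<bullet> \<alpha>) / (\<alpha> \<bullet> \<alpha>)) = \<theta> \<bullet> \<theta> + (\<Sum>\<alpha>\<in>Pos - {\<theta>}. (1/2) * (\<alpha> \<bullet> \<theta>))"
      using tt by (simp add: sum.remove[OF finite_Pos theta_Pos])
    moreover have "(1/2) * (\<Sum>\<alpha>\<in>Pos. \<alpha> \<bullet> \<theta>) = (1/2) * (\<theta> \<bullet> \<theta>) + (\<Sum>\<alpha>\<in>Pos - {\<theta>}. (1/2) * (\<alpha> \<bullet> \<theta>))"
      by (simp add: sum.remove[OF finite_Pos theta_Pos] sum_distrib_left distrib_left add_divide_distrib sum_divide_distrib)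
    moreover have "rho R P \<bullet> \<theta> = (1/2) * (\<Sum>\<alpha>\<in>Pos. \<alpha> \<bullet> \<theta>)"
      by (simp add: rho_def inner_sum_left)
    ultimately show ?thesis by simp
  qed
  finally have "c * (\<theta> \<bullet> \<theta>) = \<theta> \<bullet> \<theta> + 2 * (rho R P \<bullet> \<theta>)" by simp
  then have "c = 1 + coroot \<theta> \<bullet> rho R P"
    using tt by (simp add: coroot_inner field_simps)
  then have "c = real (chgt \<theta> + 1)"
    by (simp add: real_chgt[OF theta_Pos])
  then have "real (card R) = real ((chgt \<theta> + 1) * DIM('a))"
    using dim by (simp only: of_nat_mult)
  then have "card R = (chgt \<theta> + 1) * DIM('a)"
    by (simp only: of_nat_eq_iff)
  then show ?thesis
    using DIM_positive[where 'a = 'a] by (simp only: coxeter_number_def) simp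
qed

text \<open>No root is shorter than \<theta>, so \<open>coroot \<alpha> \<bullet> \<theta> \<le>
  coroot \<theta> \<bullet> \<alpha>\<close> for positive \<alpha>. Summed over \<open>Pos\<close>,
  the two sides are twice the two heights.\<close>

lemma hgt_theta_le_chgt: "hgt \<theta> \<le> chgt \<theta>"
proof -
  have tt: "\<theta> \<bullet> \<theta> > 0" using root_nz[OF theta_R] by simp
  have "coroot \<alpha> \<bullet> \<theta> \<le> coroot \<theta> \<bullet> \<alpha>" if a: "\<alpha> \<in> Pos" for \<alpha>
  proof -
    have "\<theta> \<bullet> \<alpha> \<ge> 0" using dominant_Pos_nonneg[OF theta_dominant a] .
    then have "2 * (\<theta> \<bullet> \<alpha>) / (\<alpha> \<bullet> \<alpha>) \<le> 2 * (\<theta> \<bullet> \<alpha>) / (\<theta> \<bullet> \<theta>)"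
      using Short_norm_le[OF theta_Short Pos_R[OF a]] tt Pos_nz[OF a]
      by (intro divide_left_mono mult_pos_pos) simp_all
    then show ?thesis by (simp only: coroot_inner inner_commute[of \<alpha> \<theta>])
  qed
  then have "(\<Sum>\<alpha>\<in>Pos. coroot \<alpha> \<bullet> \<theta>) \<le> (\<Sum>\<alpha>\<in>Pos. coroot \<theta> \<bullet> \<alpha>)"
    by (rule sum_mono)
  then have "rhoc \<bullet> \<theta> \<le> coroot \<theta> \<bullet> rho R P"
    by (simp add: rhoc_def rho_def inner_sum_left inner_sum_right)
  then have "real (hgt \<theta>) \<le> real (chgt \<theta>)"
    by (simp add: real_hgt[OF Pos_nat_comb[OF theta_Pos]] real_chgt[OF theta_Pos])
  then show ?thesis by simp
qed

section \<open>Vanishing of B at the nontrivial roots of unity of order dividing h\<close>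

lemma finite_Phi: "finite Phi"
  by (simp add: Phi_def finite_Pos)

lemma theta_Phi: "\<theta> \<in> Phi"
  using theta_Pos root_nz[OF theta_R] by (simp add: Phi_def)

text \<open>As \<open>coroot \<alpha> \<bullet> \<theta> = 1\<close>, the negated reflection takes
  \<open>coroot \<alpha>\<close> to \<open>coroot \<theta> - coroot \<alpha>\<close>; positivity of
  the image follows from dominance of \<theta>.\<close>

lemma Phi_involution:
  assumes a: "\<alpha> \<in> Phi - {\<theta>}"
  shows "- refl \<theta> \<alpha> \<in> Phi - {\<theta>}" "chgt \<alpha> + chgt (- refl \<theta> \<alpha>) = chgt \<theta>"
proof -
  have aP: "\<alpha> \<in> Pos" "\<alpha> \<bullet> \<theta> > 0" "\<alpha> \<noteq> \<theta>" using a by (auto simp: Phi_def)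
  have ip: "(- refl \<theta> \<alpha>) \<bullet> \<theta> > 0"
    using aP by (simp add: inner_refl_left refl_self root_nz[OF theta_R])
  have R: "- refl \<theta> \<alpha> \<in> R" using refl_in_R theta_R Pos_R[OF aP(1)] by simp
  have sP: "- refl \<theta> \<alpha> \<in> Pos"
  proof (rule ccontr)
    assume "- refl \<theta> \<alpha> \<notin> Pos"
    then have "refl \<theta> \<alpha> \<in> Pos" using neg_Pos_iff[of "refl \<theta> \<alpha>"] R by auto
    then show False using dominant_Pos_nonneg[OF theta_dominant, of "refl \<theta> \<alpha>"] ip by (simp add: inner_commute)
  qed
  moreover have "- refl \<theta> \<alpha> \<noteq> \<theta>"
  proof
    assume "- refl \<theta> \<alpha> = \<theta>"
    then have "refl \<theta> (refl \<theta> \<alpha>) = refl \<theta> (- \<theta>)" by (metis minus_minus)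
    then show False using aP(3) by (simp add: refl_minus refl_self root_nz[OF theta_R])
  qed
  ultimately show "- refl \<theta> \<alpha> \<in> Phi - {\<theta>}" using ip by (simp add: Phi_def)
  have "coroot (- refl \<theta> \<alpha>) = coroot \<theta> - coroot \<alpha>"
  proof -
    have "coroot (- refl \<theta> \<alpha>) = - refl \<theta> (coroot \<alpha>)"
      by (simp only: coroot_minus coroot_refl)
    also have "\<dots> = coroot \<theta> - coroot \<alpha>"
      using theta_coroot[OF aP(1,3,2)] by (simp add: refl_coroot_eq')
    finally show ?thesis .
  qed
  then have "real (chgt \<alpha> + chgt (- refl \<theta> \<alpha>)) = real (chgt \<theta>)"
    by (simp add: real_chgt aP sP theta_Pos inner_diff_left)
  then show "chgt \<alpha> + chgt (- refl \<theta> \<alpha>) = chgt \<theta>" by (simp only: of_nat_eq_iff)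
qed

text \<open>Both products may vanish at z, so orders of vanishing are compared. The factors of the
  roots other than \<theta> have equal total orders on the two sides. The root \<theta> adds 1 on
  the right, where the exponent is h, and 0 on the left, since z^(h - 1) = 1 would force z = 1; the
  missing order belongs to B.\<close>

lemma root_of_unity_zero:
  fixes z :: complex
  assumes z: "z ^ (chgt \<theta> + 1) = 1" "z \<noteq> 1"
  shows "(\<Sum>\<beta>\<in>Short. z ^ nneg \<beta>) = 0"
proof -
  define B :: "complex poly" where "B = (\<Sum>\<beta>\<in>Short. monom 1 (nneg \<beta>))"
  define e where "e n = (if z ^ n = 1 then 1 else 0 :: nat)" for n
  have "B * (\<Prod>\<alpha>\<in>Phi. 1 - monom 1 (chgt \<alpha>)) = (\<Prod>\<alpha>\<in>Phi. 1 - monom 1 (chgt \<alpha> + 1))"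
  proof (rule complex_poly_eqI_unit_interval)
    fix t :: real assume t: "0 < t" "t < 1"
    have "complex_of_real ((\<Sum>\<beta>\<in>Short. t ^ nneg \<beta>) * (\<Prod>\<alpha>\<in>Phi. 1 - t ^ chgt \<alpha>)) = of_real (\<Prod>\<alpha>\<in>Phi. 1 - t ^ (chgt \<alpha> + 1))"
      by (simp only: short_orbit_product_formula[OF t])
    then show "poly (B * (\<Prod>\<alpha>\<in>Phi. 1 - monom 1 (chgt \<alpha>))) (complex_of_real t) = poly (\<Prod>\<alpha>\<in>Phi. 1 - monom 1 (chgt \<alpha> + 1)) (complex_of_real t)"
      by (simp add: B_def poly_sum poly_prod poly_monom)
  qed
  moreover have nz: "(1 - monom 1 (chgt \<alpha>) :: complex poly) \<noteq> 0" "(1 - monom 1 (chgt \<alpha> + 1) :: complex poly) \<noteq> 0"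
    if "\<alpha> \<in> Phi" for \<alpha>
  proof -
    have "chgt \<alpha> > 0" using that chgt_pos[of \<alpha>] by (simp add: Phi_def)
    then show "(1 - monom 1 (chgt \<alpha>) :: complex poly) \<noteq> 0" "(1 - monom 1 (chgt \<alpha> + 1) :: complex poly) \<noteq> 0"
      by (intro one_minus_monom_nz; simp)+
  qed
  ultimately have "order z (B * (\<Prod>\<alpha>\<in>Phi. 1 - monom 1 (chgt \<alpha>))) = order z (\<Prod>\<alpha>\<in>Phi. 1 - monom 1 (chgt \<alpha> + 1))"
    by simp
  also have "\<dots> = (\<Sum>\<alpha>\<in>Phi. e (chgt \<alpha> + 1))"
    using nz by (subst order_prod[OF finite_Phi]) (auto simp only: order_one_minus_monom e_def intro!: sum.cong)
  also have "\<dots> = e (chgt \<theta> + 1) + (\<Sum>\<alpha>\<in>Phi - {\<theta>}. e (chgt \<alpha> + 1))"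
    by (rule sum.remove[OF finite_Phi theta_Phi])
  also have "(\<Sum>\<alpha>\<in>Phi - {\<theta>}. e (chgt \<alpha> + 1)) = (\<Sum>\<alpha>\<in>Phi - {\<theta>}. e (chgt \<alpha>))"
  \<comment> \<open>The involution matches coroot heights a and b with a + (b + 1) = h, so z^a = 1
    exactly when z^(b + 1) = 1.\<close>
  proof (rule sum.reindex_bij_witness[where i = "\<lambda>\<alpha>. - refl \<theta> \<alpha>" and j = "\<lambda>\<alpha>. - refl \<theta> \<alpha>"])
    fix \<alpha> assume a: "\<alpha> \<in> Phi - {\<theta>}"
    show "- refl \<theta> (- refl \<theta> \<alpha>) = \<alpha>" "- refl \<theta> (- refl \<theta> \<alpha>) = \<alpha>" by (simp_all add: refl_minus)
    show "- refl \<theta> \<alpha> \<in> Phi - {\<theta>}" "- refl \<theta> \<alpha> \<in> Phi - {\<theta>}" by (rule Phi_involution(1)[OF a])+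
    have "chgt (- refl \<theta> \<alpha>) + (chgt \<alpha> + 1) = chgt \<theta> + 1" using Phi_involution(2)[OF a] by simp
    then have "z ^ chgt (- refl \<theta> \<alpha>) * z ^ (chgt \<alpha> + 1) = 1" using z(1) by (simp only: power_add[symmetric])
    then show "e (chgt (- refl \<theta> \<alpha>)) = e (chgt \<alpha> + 1)" by (auto simp: e_def)
  qed
  finally have ord: "order z (B * (\<Prod>\<alpha>\<in>Phi. 1 - monom 1 (chgt \<alpha>))) = 1 + (\<Sum>\<alpha>\<in>Phi - {\<theta>}. e (chgt \<alpha>))"
    using z(1) by (simp add: e_def)
  have "poly B z = 0"
  proof (cases "B = 0")
    case False
    have pn: "(\<Prod>\<alpha>\<in>Phi. 1 - monom 1 (chgt \<alpha>) :: complex poly) \<noteq> 0"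
      using nz(1) finite_Phi by (simp add: prod_zero_iff)
    have "order z (\<Prod>\<alpha>\<in>Phi. 1 - monom 1 (chgt \<alpha>)) = (\<Sum>\<alpha>\<in>Phi. e (chgt \<alpha>))"
      using nz(1) chgt_pos by (subst order_prod[OF finite_Phi]) (auto simp: order_one_minus_monom e_def Phi_def Suc_le_eq intro!: sum.cong)
    also have "\<dots> = e (chgt \<theta>) + (\<Sum>\<alpha>\<in>Phi - {\<theta>}. e (chgt \<alpha>))"
      by (rule sum.remove[OF finite_Phi theta_Phi])
    also have "e (chgt \<theta>) = 0"
      using z by (auto simp: e_def)
    finally have "order z B + (\<Sum>\<alpha>\<in>Phi - {\<theta>}. e (chgt \<alpha>)) = 1 + (\<Sum>\<alpha>\<in>Phi - {\<theta>}. e (chgt \<alpha>))"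
      using ord order_mult[of B "\<Prod>\<alpha>\<in>Phi. 1 - monom 1 (chgt \<alpha>)" z] False pn by simp
    then have "order z B \<noteq> 0" by simp
    then show ?thesis using order_root by blast
  qed simp
  then show ?thesis by (simp add: B_def poly_sum poly_monom)
qed

section \<open>Comparison of degrees\<close>

lemma hgt_1_simple: "\<gamma> \<in> Pos \<Longrightarrow> hgt \<gamma> = 1 \<Longrightarrow> \<gamma> \<in> P"
proof (induction rule: Pos_induct)
  case (step \<beta> \<alpha>)
  have "rhoc \<bullet> refl \<alpha> \<beta> < rhoc \<bullet> \<beta>"
    using step.hyps root_nz[OF P_R[OF step.hyps(2)]]
    by (simp add: refl_coroot_eq inner_diff_right rhoc_simple coroot_pos_iff)
  then have "real (hgt (refl \<alpha> \<beta>)) < real (hgt \<beta>)"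
    using step.hyps by (simp only: real_hgt Pos_nat_comb)
  then show ?case using hgt_Pos[OF step.hyps(5)] step.prems by simp
qed

text \<open>
  Equivalently, (1 - X) B is the difference of a polynomial of degree less than ht \<theta> and
  X^(ht \<theta>) m(0).
\<close>
lemma low_degree_part:
  assumes i: "i \<ge> hgt \<theta>"
  shows "coeff ((1 - X) * B_poly + X ^ hgt \<theta> * m0) i = 0"
proof -
  let ?S = "Short \<inter> Pos" and ?H = "hgt \<theta>"
  have fS: "finite ?S" using finite_Short by simp
  have l: "X ^ ?H * of_nat l = (\<Sum>\<gamma>\<in>?S. if hgt \<gamma> = 1 then X ^ ?H else 0)"
  proof -
    have "{\<gamma>\<in>?S. hgt \<gamma> = 1} = P \<inter> Short"
      using hgt_1_simple P_Pos hgt_simple by blast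
    then show ?thesis
      using sum.inter_filter[OF fS, of "\<lambda>_. X ^ ?H" "\<lambda>\<gamma>. hgt \<gamma> = 1"] by (simp add: mult.commute)
  qed
  have "(1 - X) * B_poly + X ^ ?H * m0
      = (1 - X) * B_poly + (X ^ ?H * of_nat l + X ^ ?H * ((X - 1) * A_poly))"
    by (simp only: lusztig_q_theta_0 distrib_left)
  also have "\<dots> = (\<Sum>\<gamma>\<in>?S. (1 - X) * (X ^ (?H - hgt \<gamma>) + X ^ (?H + hgt \<gamma> - 1)) +
        ((if hgt \<gamma> = 1 then X ^ ?H else 0) + X ^ ?H * ((X - 1) * X ^ (hgt \<gamma> - 1))))"
    by (simp only: l B_poly_def A_poly_def sum_distrib_left) (simp only: sum.distrib)
  \<comment> \<open>In each summand the terms beyond degree H = \<open>hgt \<theta>\<close> cancel.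
    At height 1 the leftover -X^H is removed by the contribution of l to m0; at greater heights the
    leftover has exponent below H.\<close>
  also have "\<dots> = (\<Sum>\<gamma>\<in>?S. X ^ (?H - hgt \<gamma>) - (if hgt \<gamma> = 1 then 0 else X ^ (?H - hgt \<gamma> + 1)))"
  proof (rule sum.cong)
    fix \<gamma> assume g: "\<gamma> \<in> ?S"
    define a b c where "a = X ^ (?H - hgt \<gamma>)" and "b = X ^ (hgt \<gamma> - 1)" and "c = X ^ ?H"
    have g1: "hgt \<gamma> \<ge> 1" "hgt \<gamma> \<le> ?H" using hgt_Pos hgt_le_theta g by auto
    then have "?H + hgt \<gamma> - 1 = ?H + (hgt \<gamma> - 1)" by simp
    then have 1: "X ^ (?H + hgt \<gamma> - 1) = c * b" by (simp only: power_add b_def c_def)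
    have 2: "X ^ (?H - hgt \<gamma> + 1) = X * a" by (simp only: power_add power_one_right a_def mult.commute)
    have 3: "c = X * a" if "hgt \<gamma> = 1"
    proof -
      have "?H = ?H - hgt \<gamma> + 1" using that g1 by simp
      then show ?thesis using 2 c_def by metis
    qed
    have "(1 - Y) * (a + c * b) + (d + c * ((Y - 1) * b)) = a - Y * a + d" for Y d :: "int poly"
      by (simp add: algebra_simps)
    then show "(1 - X) * (X ^ (?H - hgt \<gamma>) + X ^ (?H + hgt \<gamma> - 1)) +
        ((if hgt \<gamma> = 1 then X ^ ?H else 0) + X ^ ?H * ((X - 1) * X ^ (hgt \<gamma> - 1)))
      = X ^ (?H - hgt \<gamma>) - (if hgt \<gamma> = 1 then 0 else X ^ (?H - hgt \<gamma> + 1))"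
      unfolding 1 2 a_def[symmetric] b_def[symmetric] c_def[symmetric]
      using 3 by (cases "hgt \<gamma> = 1") (simp_all only: simp_thms if_True if_False diff_add_cancel diff_0_right add_0_right)
  qed simp
  finally have eq: "(1 - X) * B_poly + X ^ ?H * m0
      = (\<Sum>\<gamma>\<in>?S. X ^ (?H - hgt \<gamma>) - (if hgt \<gamma> = 1 then 0 else X ^ (?H - hgt \<gamma> + 1)))" .
  have "coeff (X ^ (?H - hgt \<gamma>) - (if hgt \<gamma> = 1 then 0 else X ^ (?H - hgt \<gamma> + 1))) i = 0" if "\<gamma> \<in> ?S" for \<gamma>
  proof -
    have "hgt \<gamma> \<ge> 1" "hgt \<gamma> \<le> ?H" using hgt_Pos hgt_le_theta that by auto
    then have "?H - hgt \<gamma> \<noteq> i" "hgt \<gamma> \<noteq> 1 \<Longrightarrow> ?H - hgt \<gamma> + 1 \<noteq> i" using i by linarith+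
    then show ?thesis
      unfolding X_power_monom by (cases "hgt \<gamma> = 1") (simp_all del: One_nat_def)
  qed
  then show ?thesis unfolding eq coeff_sum by (rule sum.neutral[OF ballI])
qed

lemma degree_B_poly: "degree ((1 - X) * B_poly) \<le> 2 * hgt \<theta>"
proof -
  have "degree B_poly \<le> 2 * hgt \<theta> - 1"
    unfolding B_poly_def
  proof (rule degree_sum_le)
    fix \<gamma> assume g: "\<gamma> \<in> Short \<inter> Pos"
    have "hgt \<gamma> \<ge> 1" "hgt \<gamma> \<le> hgt \<theta>" using hgt_Pos hgt_le_theta g by auto
    then have "hgt \<theta> - hgt \<gamma> \<le> 2 * hgt \<theta> - 1" "hgt \<theta> + hgt \<gamma> - 1 \<le> 2 * hgt \<theta> - 1" by linarith+
    then show "degree (X ^ (hgt \<theta> - hgt \<gamma>) + X ^ (hgt \<theta> + hgt \<gamma> - 1)) \<le> 2 * hgt \<theta> - 1"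
      unfolding X_power_monom by (intro degree_add_le order_trans[OF degree_monom_le])
  qed (simp add: finite_Short)
  moreover have "degree (1 - X) \<le> 1"
    by (intro degree_diff_le) simp_all
  ultimately show ?thesis
    using degree_mult_le[of "1 - X" B_poly] hgt_Pos[OF theta_Pos] by linarith
qed

text \<open>The quotient p has degree below \<open>hgt \<theta>\<close>, hence below h, so the
  blocks p and X^h p of (1 - X) B do not overlap; \<open>low_degree_part\<close> matches the upper
  block with \<open>X ^ hgt \<theta> * m0\<close>.\<close>

lemma lusztig_factorization:
  obtains p where "m0 = X ^ (coxeter_number R - hgt \<theta>) * p" "B_poly = p * (\<Sum>i<coxeter_number R. X ^ i)"
proof -
  define h where "h = coxeter_number R"
  let ?H = "hgt \<theta>"
  have h: "h = chgt \<theta> + 1" "?H < h"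
    using coxeter_number_chgt hgt_theta_le_chgt by (simp_all add: h_def)
  have "(1 - monom 1 h :: int poly) dvd (1 - monom 1 1) * (\<Sum>\<beta>\<in>Short. monom 1 (nneg \<beta>))"
    using h root_of_unity_zero by (intro dvd_of_roots_of_unity finite_Short) simp_all
  then have "(1 - X ^ h) dvd (1 - X) * B_poly"
    unfolding B_poly_nneg X_power_monom using X_power_monom[of 1, where ?'a = int] by simp
  then obtain p where p: "(1 - X) * B_poly = (1 - X ^ h) * p" by (elim dvdE)
  have B: "B_poly = p * (\<Sum>i<h. X ^ i)"
  proof -
    have "(1 - X) * B_poly = (1 - X) * (p * (\<Sum>i<h. X ^ i))"
      unfolding p one_diff_power_eq by (simp only: mult.assoc mult.commute[of p])
    moreover have "1 - X \<noteq> 0"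
      by (simp add: one_pCons)
    ultimately show ?thesis by (metis mult_left_cancel)
  qed
  \<comment> \<open>With H = \<open>hgt \<theta>\<close>, the degrees give h + degree p \<le> 2 H,
    and H < h.\<close>
  have pc: "coeff p i = 0" if i: "i \<ge> ?H" for i
  proof (cases "p = 0")
    case False
    have "degree (1 - X ^ h) = h"
    proof (rule antisym)
      show "degree (1 - X ^ h) \<le> h"
        unfolding X_power_monom by (intro degree_diff_le degree_monom_le) simp
      have "coeff (1 - X ^ h) h \<noteq> 0"
        unfolding X_power_monom using h by simp
      then show "h \<le> degree (1 - X ^ h)" by (rule le_degree)
    qed
    moreover have "1 - X ^ h \<noteq> 0" using calculation h by auto
    ultimately have "degree ((1 - X ^ h) * p) = h + degree p"
      using False by (metis degree_mult_eq)
    then have "h + degree p \<le> 2 * ?H"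
      using degree_B_poly unfolding p by simp
    then have "degree p < i" using h(2) i by linarith
    then show ?thesis by (rule coeff_eq_0)
  qed simp
  have "m0 = X ^ (h - ?H) * p"
  proof (rule poly_eqI)
    fix i
    have Xh: "X ^ h = X ^ ?H * X ^ (h - ?H)"
      using h(2) by (simp only: power_add[symmetric]) simp
    \<comment> \<open>On the right both terms have no coefficients from degree H on; after removal
      of the factor X^H these are all coefficients of the difference on the left.\<close>
    have "X ^ ?H * (X ^ (h - ?H) * p - m0) = p - ((1 - X) * B_poly + X ^ ?H * m0)"
      unfolding p Xh by (simp only: algebra_simps)
    then have "coeff (monom 1 ?H * (X ^ (h - ?H) * p - m0)) (i + ?H) = 0"
      using pc[of "i + ?H"] low_degree_part[of "i + ?H"] unfolding X_power_monom[of ?H, symmetric]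
      by (simp only: coeff_diff)
    then show "coeff m0 i = coeff (X ^ (h - ?H) * p) i"
      by (simp add: coeff_monom_mult del: mult_pCons_left)
  qed
  then show thesis using that B by (simp only: h_def)
qed

end

text \<open>The quotient of m0 by the power of q is the witness p, unique because Z[q] is a domain;
  the fraction (1 - q^h) / (1 - q) is the geometric sum.\<close>

theorem theorem2p5:
  fixes R P :: "'a::euclidean_space set" and \<theta>s :: 'a
  assumes "root_system R" and "irreducible_rs R" and "is_base R P"
    and "\<theta>s \<in> short_roots R" and "dominant P \<theta>s"
  defines "h \<equiv> coxeter_number R"
    and "l \<equiv> card (P \<inter> short_roots R)"
    and "m0 \<equiv> lusztig_q R P \<theta>s 0"
  shows "\<exists>p :: int poly.
           m0 = [:0, 1:] ^ nat (int h - ht P \<theta>s) * p \<and>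
           (\<Sum>\<mu>\<in>insert 0 (short_roots R). lusztig_q R P \<theta>s \<mu>)
             = m0 * (m0 - of_nat l + 1) + p * (\<Sum>i<h. [:0, 1:] ^ i) \<and>
           (\<Sum>\<mu>\<in>insert 0 (short_roots R).
               of_nat (if \<mu> = 0 then l else 1) * lusztig_q R P \<theta>s \<mu>)
             = m0 ^ 2 + p * (\<Sum>i<h. [:0, 1:] ^ i)"
proof -
  interpret irreducible_root_system R P \<theta>s
    using assms(1-5) by unfold_locales
  obtain p where p: "m0 = [:0, 1:] ^ (h - hgt \<theta>s) * p" "B_poly = p * (\<Sum>i<h. [:0, 1:] ^ i)"
    using lusztig_factorization unfolding h_def m0_def by blast
  have ht: "nat (int h - ht P \<theta>s) = h - hgt \<theta>s"
    using ht_eq_hgt[OF Pos_nat_comb[OF theta_Pos]] by simp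
  have z: "0 \<notin> Short" using root_nz Short_R by blast
  have S: "(\<Sum>\<mu>\<in>Short. lusztig_q R P \<theta>s \<mu>) = p * (\<Sum>i<h. [:0, 1:] ^ i) + (m0 - of_nat l) * m0"
    using sum_lusztig_q_Short p(2) by (simp only: m0_def l_def)
  have 1: "(\<Sum>\<mu>\<in>insert 0 Short. lusztig_q R P \<theta>s \<mu>) = m0 + (\<Sum>\<mu>\<in>Short. lusztig_q R P \<theta>s \<mu>)"
    using z finite_Short by (simp add: m0_def)
  have 2: "(\<Sum>\<mu>\<in>insert 0 Short. of_nat (if \<mu> = 0 then l else 1) * lusztig_q R P \<theta>s \<mu>)
      = of_nat l * m0 + (\<Sum>\<mu>\<in>Short. lusztig_q R P \<theta>s \<mu>)"
  proof -
    have "(\<Sum>\<mu>\<in>Short. of_nat (if \<mu> = 0 then l else 1) * lusztig_q R P \<theta>s \<mu>) = (\<Sum>\<mu>\<in>Short. lusztig_q R P \<theta>s \<mu>)"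
      using z by (intro sum.cong) auto
    then show ?thesis using z finite_Short by (simp add: m0_def)
  qed
  show ?thesis
  proof (intro exI[of _ p] conjI)
    show "m0 = [:0, 1:] ^ nat (int h - ht P \<theta>s) * p"
      unfolding ht by (rule p(1))
    show "(\<Sum>\<mu>\<in>insert 0 Short. lusztig_q R P \<theta>s \<mu>) = m0 * (m0 - of_nat l + 1) + p * (\<Sum>i<h. [:0, 1:] ^ i)"
      unfolding 1 S by (simp only: algebra_simps mult_1_right)
    show "(\<Sum>\<mu>\<in>insert 0 Short. of_nat (if \<mu> = 0 then l else 1) * lusztig_q R P \<theta>s \<mu>)
        = m0 ^ 2 + p * (\<Sum>i<h. [:0, 1:] ^ i)"
      unfolding 2 S power2_eq_square by (simp only: algebra_simps)
  qed
qed

end
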